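(* Define graphs $F_g$ ($1\le g\le 12$) and constants $c_g$ ($1\le g\le 11$) by $F_1=K_4$, $F_2=W_5$, $F_3=W_7$, $F_4=\overline{C}_7$, $F_5=W_9$, $F_6=H_2^{+}$, $F_7=W_{11}$, $F_8=H_2$, $F_9=W_{13}$, $F_{10}=T_0$, $F_{11}=W_{15}$, $F_{12}=H_1^{++}$, and $c_1=\tfrac23$, $c_2=\tfrac25$, $c_3=\tfrac13$, $c_4=\tfrac27$, $c_5=\tfrac14$, $c_6=\tfrac29$, $c_7=\tfrac15$, $c_8=\tfrac2{11}$, $c_9=\tfrac16$, $c_{10}=\tfrac2{13}$, $c_{11}=\tfrac17$. Let $r\ge 3$ be an integer and let $H$ be a graph with chromatic number $r+1$. If $g+1$ is minimal such that $H$ is not homomorphic to $K_{r-3}+F_{g+1}$, then \[ \delta_H = 1-\frac{1}{r-1+c_g}. \] If $H$ is homomorphic to all of $K_{r-3}+F_g$ ($1\le g\le 12$), then there is a smallest positive integer $g$ for which $H$ is not homomorphic to $K_{r-2}+C_{2g+1}$, and \[ 1-\frac{1}{r-1} < 1-\frac{1}{r-1+2/(2g-1)} \le \delta_H \le 1-\frac{1}{r-1+1/7}. \]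
   Context: All graphs are finite and simple. $K_m$ is the complete graph on $m$ vertices ($K_0$ is the empty graph), $C_m$ the cycle on $m$ vertices. The join $G+F$ is obtained from disjoint copies of $G$ and $F$ by joining every vertex of $G$ to every vertex of $F$ (so $K_0+F=F$). A graph $G$ is homomorphic to $F$ if there is a map $\varphi:V(G)\to V(F)$ sending edges to edges. The graphs: $W_k$ (the $k$-wheel) is one vertex joined to all vertices of a $k$-cycle. $\overline{C}_7$ is the complement of the $7$-cycle, equivalently the graph on $v_0,\dots,v_6$ with $v_iv_j$ an edge iff $j-i\equiv \pm1,\pm2 \pmod 7$. $H_2$ is $\overline{C}_7$ with the edge $v_6v_1$ removed. $H_2^{+}$ is $H_2$ together with a new vertex $u$ adjacent to exactly $v_0,v_2,v_5$. $H_1^{++}$ has vertices $v_0,\dots,v_6,u_l,u_r$ and edges $v_iv_{i+1}$ (indices mod 7) for all $i$, together with $v_3v_5, v_5v_0, v_0v_2, v_2v_4, v_6v_1$, and $u_l$ adjacent to $v_0,v_2,v_3$, $u_r$ adjacent to $v_0,v_3,v_5$. $T_0$ has vertices $v_0,\dots,v_6,t,u_1,u_6$ with edges $v_iv_{i+1}$ (indices mod 7) for all $i$, $u_1$ adjacent to $v_0,v_2,v_3,v_4,v_5,v_6$, $u_6$ adjacent to $v_0,v_1,v_2,v_3,v_4,v_5$, and $t$ adjacent to $v_0,u_1,u_6$ (no other edges). $\delta(G)$ is minimum degree, $|G|$ the number of vertices; $G$ is $H$-free if it has no subgraph isomorphic to $H$. For a graph $H$ of chromatic number $r+1$, $\delta_H$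 is the infimum of all $c$ such that for every $\eta>0$ there is $n_0$ such that every $H$-free graph $G$ on $n\ge n_0$ vertices with $\delta(G)\ge cn$ can be made $r$-partite by deleting at most $\eta n^2$ edges. *)

theory Defs
  imports Complex_Main
begin

datatype 'a graph = Graph (verts: "'a set") (edges: "'a set set")

definition simple_graph :: "'a graph \<Rightarrow> bool" where
  "simple_graph G \<longleftrightarrow> finite (verts G) \<and> (\<forall>e\<in>edges G. e \<subseteq> verts G \<and> card e = 2)"

definition homomorphic :: "'a graph \<Rightarrow> 'b graph \<Rightarrow> bool" where
  "homomorphic G F \<longleftrightarrow>
     (\<exists>\<phi>. \<phi> ` verts G \<subseteq> verts F \<and> (\<forall>u v. {u, v} \<in> edges G \<longrightarrow> {\<phi> u, \<phi> v} \<in> edges F))"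

definition isomorphic :: "'a graph \<Rightarrow> 'b graph \<Rightarrow> bool" where
  "isomorphic G F \<longleftrightarrow>
     (\<exists>f. bij_betw f (verts G) (verts F) \<and> (\<lambda>e. f ` e) ` edges G = edges F)"

definition subgraph :: "'a graph \<Rightarrow> 'a graph \<Rightarrow> bool" where
  "subgraph S G \<longleftrightarrow> simple_graph S \<and> verts S \<subseteq> verts G \<and> edges S \<subseteq> edges G"

definition free_of :: "'b graph \<Rightarrow> 'a graph \<Rightarrow> bool" where
  "free_of H G \<longleftrightarrow> \<not> (\<exists>S. subgraph S G \<and> isomorphic H S)"

definition degree :: "'a graph \<Rightarrow> 'a \<Rightarrow> nat" where
  "degree G v = card {u \<in> verts G. {u, v} \<in> edges G}"

definition min_degree :: "'a graph \<Rightarrow> nat" where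
  "min_degree G = Min (degree G ` verts G)"

text \<open>Classes of the partition may be empty, so this is also \<open>k\<close>-colourability.\<close>

definition partite :: "nat \<Rightarrow> 'a graph \<Rightarrow> bool" where
  "partite k G \<longleftrightarrow>
     (\<exists>f. f ` verts G \<subseteq> {..<k} \<and> (\<forall>u v. {u, v} \<in> edges G \<longrightarrow> f u \<noteq> f v))"

definition chromatic_number :: "'a graph \<Rightarrow> nat" where
  "chromatic_number G = (LEAST k. partite k G)"

definition delete_edges :: "'a graph \<Rightarrow> 'a set set \<Rightarrow> 'a graph" where
  "delete_edges G D = Graph (verts G) (edges G - D)"

text \<open>
  The threshold \<open>\<delta>\<^sub>H\<close>, with \<open>r = \<chi>(H) - 1\<close>. Every finite graph has an isomorphic copy
  on natural numbers, so it suffices to let \<open>G\<close> range over those. The set of admissible \<open>c\<close> is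
  closed upwards and contains every \<open>c > 1\<close>; for \<open>r \<ge> 2\<close> it contains positive numbers only, so
  the infimum is a genuine one.
\<close>

definition delta_threshold :: "'a graph \<Rightarrow> real" where
  "delta_threshold H = Inf {c :: real.
     \<forall>\<eta>>0. \<exists>n0 :: nat. \<forall>G :: nat graph.
       simple_graph G \<and> card (verts G) \<ge> n0 \<and> free_of H G \<and>
       real (min_degree G) \<ge> c * real (card (verts G))
       \<longrightarrow> (\<exists>D \<subseteq> edges G. real (card D) \<le> \<eta> * (real (card (verts G)))\<^sup>2 \<and>
             partite (chromatic_number H - 1) (delete_edges G D))}"

definition join :: "'a graph \<Rightarrow> 'b graph \<Rightarrow> ('a + 'b) graph" where
  "join G F = Graph (verts G <+> verts F)
     ((\<lambda>e. Inl ` e) ` edges G \<union> (\<lambda>e. Inr ` e) ` edges F \<union>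
      {{Inl u, Inr v} | u v. u \<in> verts G \<and> v \<in> verts F})"

definition complete_graph :: "nat \<Rightarrow> nat graph" where
  "complete_graph m = Graph {..<m} {e. e \<subseteq> {..<m} \<and> card e = 2}"

text \<open>Cycles and wheels are intended for length at least 3 only. The hub of \<open>wheel k\<close> is \<open>k\<close>.\<close>

definition cycle_edges :: "nat \<Rightarrow> nat set set" where
  "cycle_edges m = {{i, (i + 1) mod m} | i. i < m}"

definition cycle_graph :: "nat \<Rightarrow> nat graph" where
  "cycle_graph m = Graph {..<m} (cycle_edges m)"

definition wheel :: "nat \<Rightarrow> nat graph" where
  "wheel k = Graph {..k} (cycle_edges k \<union> {{k, i} | i. i < k})"

text \<open>In the graphs below the number \<open>i \<le> 6\<close> is the vertex \<open>v\<^sub>i\<close>.\<close>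

definition C7_complement :: "nat graph" where
  "C7_complement = Graph {..<7}
     {{i, j} | i j. i < 7 \<and> j < 7 \<and> (\<exists>d\<in>{1, -1, 2, -2}. 7 dvd int j - int i - d)}"

definition H2 :: "nat graph" where
  "H2 = delete_edges C7_complement {{6, 1}}"

text \<open>The new vertex \<open>u\<close> is 7.\<close>

definition H2_plus :: "nat graph" where
  "H2_plus = Graph (insert 7 (verts H2)) (edges H2 \<union> {{7, i} | i. i \<in> {0, 2, 5}})"

text \<open>The vertices \<open>u\<^sub>l\<close>, \<open>u\<^sub>r\<close> are 7 and 8.\<close>

definition H1_plus_plus :: "nat graph" where
  "H1_plus_plus = Graph {..<9}
     (cycle_edges 7 \<union> {{3, 5}, {5, 0}, {0, 2}, {2, 4}, {6, 1}} \<union>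
      {{7, i} | i. i \<in> {0, 2, 3}} \<union> {{8, i} | i. i \<in> {0, 3, 5}})"

text \<open>The vertices \<open>t\<close>, \<open>u\<^sub>1\<close>, \<open>u\<^sub>6\<close> are 7, 8 and 9.\<close>

definition T0 :: "nat graph" where
  "T0 = Graph {..<10}
     (cycle_edges 7 \<union> {{8, i} | i. i \<in> {0, 2, 3, 4, 5, 6}} \<union>
      {{9, i} | i. i \<in> {0, 1, 2, 3, 4, 5}} \<union> {{7, i} | i. i \<in> {0, 8, 9}})"

text \<open>Only \<open>1 \<le> g \<le> 12\<close>, respectively \<open>1 \<le> g \<le> 11\<close>, is meaningful.\<close>

definition F_graph :: "nat \<Rightarrow> nat graph" where
  "F_graph g = [complete_graph 4, wheel 5, wheel 7, C7_complement, wheel 9, H2_plus,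
     wheel 11, H2, wheel 13, T0, wheel 15, H1_plus_plus] ! (g - 1)"

definition c_const :: "nat \<Rightarrow> real" where
  "c_const g = [2/3, 2/5, 1/3, 2/7, 1/4, 2/9, 1/5, 2/11, 1/6, 2/13, 1/7] ! (g - 1)"

end

(*
  Upper bounds. Write m for the largest number of vertices missed by a vertex of a graph G. If
  (r - 1 + c_g) m < |G| and G contains no homomorphic image of K_{r-3} + F_i for i <= g, then G is
  r-colourable: by density the links of (r-3)-cliques contain no odd wheel, no Moser spindle and no
  T_0 without t; these properties allow one to delete an independent set, namely all vertices
  without a neighbour in a largest common neighbourhood of an (r-1)-clique, so that the rest has the
  same properties for r - 1, until it has no odd cycle. Each exclusion is a weighted count of the
  vertices missed by a small configuration.

  If G is only H-free, and far from being r-partite, then a positive proportion of the samples of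
  bounded size is not r-colourable. Enlarging them by random vertices makes them dense, so they
  contain homomorphic images of some K_{r-3} + F_i, and a positive density of such images yields a
  blow-up that contains H.

  Lower bounds. Weighted blow-ups of K_{r-3} + F_{g+1} or K_{r-2} + C_{2g+1} are H-free, and as these
  graphs are not r-colourable, choosing a majority colour in each class shows that quadratically
  many edges have to be deleted.
*)
theory Submission
  imports Defs
begin

section \<open>Dense graphs and weighted counting\<close>

text \<open>Passing to the neighbours of one more vertex and deleting an independent set cost the
  same: at most \<open>m\<close> vertices are lost, and no vertex misses more than \<open>m\<close>
  afterwards. So everything reduces to links of \<open>(r - 3)\<close>-cliques, where
  \<open>r - 1 + c_g\<close> has become \<open>2 + c_g\<close>. This number is the value of a linear
  program: the total weight of a configuration divided by the weight that every vertex must miss.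
  The same fraction is total over missed weight in the extremal blow-up of \<open>F_{g+1}\<close>.

  The obstacle is an odd closed walk of length \<open>n\<close> outside an independent set. Counting
  alone excludes it if \<open>card V / m\<close> exceeds \<open>(2n - 3)/(n - 2)\<close>, that is
  \<open>7/3\<close>, \<open>11/5\<close>, \<open>15/7\<close> for \<open>n\<close> = 5, 7, 9. Only
  \<open>15/7\<close> is available, so the lengths five and seven need structure: the Moser spindle
  serves for the former, \<open>T_0\<close> without \<open>t\<close> for the latter. To survive the
  removal of colours, the spindle condition is generalised to \<open>RR_free\<close>, about vertices
  joined to common cliques.

  Homomorphic images are excluded throughout, since entries of a sample may coincide and a blow-up
  turns images back into copies.\<close>

definition induced :: "'a set \<Rightarrow> ('a \<Rightarrow> 'a \<Rightarrow> bool) \<Rightarrow> 'a \<Rightarrow> 'a \<Rightarrow> bool" where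
  "induced S A x y \<longleftrightarrow> x \<in> S \<and> y \<in> S \<and> A x y"

definition clique :: "('a \<Rightarrow> 'a \<Rightarrow> bool) \<Rightarrow> 'a set \<Rightarrow> bool" where
  "clique A Z \<longleftrightarrow> (\<forall>x\<in>Z. \<forall>y\<in>Z. x \<noteq> y \<longrightarrow> A x y)"

text \<open>A weighted list instead of a weight function: the vertices of a homomorphic image may
  coincide, and equal entries then simply add their weights.\<close>

definition miss :: "('a \<Rightarrow> 'a \<Rightarrow> bool) \<Rightarrow> (nat \<times> 'a) list \<Rightarrow> 'a \<Rightarrow> nat" where
  "miss A ws p = (\<Sum>(w, x)\<leftarrow>ws. if A p x then 0 else w)"

lemma miss_Nil [simp]: "miss A [] p = 0"
  by (simp add: miss_def)

lemma miss_Cons [simp]: "miss A ((w, x) # ws) p = (if A p x then 0 else w) + miss A ws p"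
  by (simp add: miss_def)

lemma miss_append [simp]: "miss A (us @ ws) p = miss A us p + miss A ws p"
  by (simp add: miss_def)

lemma miss_map_const:
  assumes "distinct xs"
  shows "miss A (map (Pair w) xs) p = w * card {x \<in> set xs. \<not> A p x}"
  using assms
proof (induction xs)
  case (Cons y ys)
  have "{x \<in> set (y # ys). \<not> A p x} =
      (if A p y then {x \<in> set ys. \<not> A p x} else insert y {x \<in> set ys. \<not> A p x})"
    by auto
  then show ?case using Cons by auto
qed simp

text \<open>A vertex is among those it misses, so \<open>m\<close> bounds \<open>card V\<close>
  minus the minimum degree. Adjacency is confined to \<open>V\<close>, so that the relation alone
  carries the graph.\<close>

locale dense_graph =
  fixes V :: "'a set" and A :: "'a \<Rightarrow> 'a \<Rightarrow> bool" and m :: nat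
  assumes finite_V: "finite V"
    and adj_sym: "A x y \<Longrightarrow> A y x"
    and irrefl: "\<not> A x x"
    and in_V: "A x y \<Longrightarrow> x \<in> V"
    and missed: "v \<in> V \<Longrightarrow> card {p \<in> V. \<not> A p v} \<le> m"
begin

lemma adj_commute: "A x y \<longleftrightarrow> A y x"
  using adj_sym by blast

lemma in_V2: "A x y \<Longrightarrow> y \<in> V"
  using adj_sym in_V by blast

text \<open>Double counting: an entry \<open>(w, x)\<close> contributes \<open>w\<close> for each of
  the at most \<open>m\<close> vertices that miss \<open>x\<close>.\<close>

lemma sum_miss:
  assumes "snd ` set ws \<subseteq> V"
  shows "(\<Sum>p\<in>V. miss A ws p) \<le> sum_list (map fst ws) * m"
  using assms
proof (induction ws)
  case (Cons wx ws)
  obtain w x where wx: "wx = (w, x)" by force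
  have "(\<Sum>p\<in>V. if A p x then 0 else w) = (\<Sum>p\<in>V. if \<not> A p x then w else 0)"
    by (rule sum.cong) auto
  also have "\<dots> = (\<Sum>p\<in>{p \<in> V. \<not> A p x}. w)"
    by (rule sum.inter_filter[symmetric, OF finite_V])
  also have "\<dots> \<le> w * m" using missed[of x] Cons.prems wx by simp
  finally have "(\<Sum>p\<in>V. if A p x then 0 else w) \<le> w * m" .
  moreover have "(\<Sum>p\<in>V. miss A ws p) \<le> sum_list (map fst ws) * m"
    using Cons by simp
  ultimately show ?case unfolding wx miss_Cons sum.distrib by (simp add: add_mult_distrib)
qed simp

text \<open>The vertices of an exceptional set \<open>I\<close> may miss less than the others. For
  independent \<open>I\<close> one has \<open>card I \<le> m\<close>, so with total weight
  \<open>W\<close> the bound becomes \<open>a * card V \<le> (W + a - b) * m\<close>, which is then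
  contradicted by density.\<close>

lemma weight_bound:
  assumes "I \<subseteq> V" and "snd ` set ws \<subseteq> V"
    and "\<And>p. p \<in> V \<Longrightarrow> p \<notin> I \<Longrightarrow> a \<le> miss A ws p"
    and "\<And>p. p \<in> I \<Longrightarrow> b \<le> miss A ws p"
    and "b \<le> a"
  shows "a * card V \<le> sum_list (map fst ws) * m + (a - b) * card I"
proof -
  have fI: "finite I" using assms(1) finite_V finite_subset by blast
  have "a * card (V - I) + b * card I \<le> (\<Sum>p\<in>V - I. miss A ws p) + (\<Sum>p\<in>I. miss A ws p)"
    using sum_mono[of "V - I" "\<lambda>_. a" "miss A ws"] sum_mono[of I "\<lambda>_. b" "miss A ws"] assms
    by (simp add: mult.commute)
  also have "\<dots> = (\<Sum>p\<in>V. miss A ws p)"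
    by (rule sum.subset_diff[symmetric]) (use assms finite_V in auto)
  also have "\<dots> \<le> sum_list (map fst ws) * m" by (rule sum_miss) fact
  finally have 1: "a * card (V - I) + b * card I \<le> sum_list (map fst ws) * m" .
  have "card V = card (V - I) + card I"
    using card_Diff_subset[OF fI assms(1)] card_mono[OF finite_V assms(1)] by simp
  then have "a * card V = a * card (V - I) + b * card I + (a - b) * card I"
    using mult_le_mono1[OF \<open>b \<le> a\<close>, of "card I"]
    by (simp add: add_mult_distrib2 diff_mult_distrib)
  then show ?thesis using 1 by simp
qed

lemma weight_bound_all:
  assumes "snd ` set ws \<subseteq> V" and "\<And>p. p \<in> V \<Longrightarrow> a \<le> miss A ws p"
  shows "a * card V \<le> sum_list (map fst ws) * m"
  using weight_bound[of "{}" ws a 0] assms by simp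

definition N :: "'a set \<Rightarrow> 'a set" where
  "N Z = {v \<in> V. \<forall>z\<in>Z. A v z}"

lemma N_subset: "N Z \<subseteq> V"
  by (auto simp: N_def)

lemma finite_N [simp]: "finite (N Z)"
  using N_subset finite_V finite_subset by blast

lemma N_insert: "N (insert z Z) = {v \<in> N Z. A v z}"
  by (auto simp: N_def)

lemma N_disjoint: "z \<in> Z \<Longrightarrow> z \<notin> N Z"
  using irrefl by (auto simp: N_def)

lemma card_N:
  assumes "Z \<subseteq> V"
  shows "card V \<le> card (N Z) + card Z * m"
proof -
  have fZ: "finite Z" using assms finite_V finite_subset by blast
  then show ?thesis using assms
  proof (induction Z)
    case (insert z Z)
    have "N Z \<subseteq> N (insert z Z) \<union> {p \<in> V. \<not> A p z}" using N_subset by (auto simp: N_insert)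
    then have "card (N Z) \<le> card (N (insert z Z) \<union> {p \<in> V. \<not> A p z})"
      by (rule card_mono[rotated]) (simp add: finite_V)
    also have "\<dots> \<le> card (N (insert z Z)) + card {p \<in> V. \<not> A p z}" by (rule card_Un_le)
    also have "\<dots> \<le> card (N (insert z Z)) + m" using insert.prems missed[of z] by simp
    finally have "card (N Z) \<le> card (N (insert z Z)) + m" .
    moreover have "card V \<le> card (N Z) + card Z * m" using insert by simp
    ultimately show ?case using insert.hyps by simp
  qed (simp add: N_def)
qed

lemma dense_graph_induced:
  assumes "S \<subseteq> V"
  shows "dense_graph S (induced S A) m"
proof
  show "finite S" using assms finite_V finite_subset by blast
  show "card {p \<in> S. \<not> induced S A p v} \<le> m" if "v \<in> S" for v
  proof -
    have "{p \<in> S. \<not> induced S A p v} \<subseteq> {p \<in> V. \<not> A p v}" using that assms by (auto simp: induced_def)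
    then have "card {p \<in> S. \<not> induced S A p v} \<le> card {p \<in> V. \<not> A p v}"
      by (rule card_mono[rotated]) (simp add: finite_V)
    also have "\<dots> \<le> m" using missed that assms by blast
    finally show ?thesis .
  qed
qed (use adj_sym irrefl in \<open>auto simp: induced_def\<close>)

text \<open>Any member of \<open>I\<close> misses all of \<open>I\<close>, itself included.\<close>

lemma card_independent:
  assumes "I \<subseteq> V" and "\<And>x y. x \<in> I \<Longrightarrow> y \<in> I \<Longrightarrow> \<not> A x y"
  shows "card I \<le> m"
proof (cases "I = {}")
  case False
  then obtain x where x: "x \<in> I" by blast
  have "I \<subseteq> {p \<in> V. \<not> A p x}" using assms x by auto
  then have "card I \<le> card {p \<in> V. \<not> A p x}" by (rule card_mono[rotated]) (simp add: finite_V)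
  also have "\<dots> \<le> m" using missed x assms by blast
  finally show ?thesis .
qed simp

end

section \<open>Odd closed walks\<close>

text \<open>A periodic function on all of \<open>nat\<close> avoids wrap-around in index arithmetic.
  Walks may repeat vertices, like homomorphic images of cycles.\<close>

definition closed_walk :: "('a \<Rightarrow> 'a \<Rightarrow> bool) \<Rightarrow> nat \<Rightarrow> (nat \<Rightarrow> 'a) \<Rightarrow> bool" where
  "closed_walk A n c \<longleftrightarrow> (\<forall>i. A (c i) (c (Suc i)) \<and> c (i + n) = c i)"

definition no_odd_walk :: "('a \<Rightarrow> 'a \<Rightarrow> bool) \<Rightarrow> bool" where
  "no_odd_walk A \<longleftrightarrow> (\<forall>n c. odd n \<longrightarrow> \<not> closed_walk A n c)"

lemma closed_walk_mono:
  "closed_walk A n c \<Longrightarrow> (\<And>x y. A x y \<Longrightarrow> B x y) \<Longrightarrow> closed_walk B n c"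
  by (auto simp: closed_walk_def)

lemma no_odd_walk_mono:
  "no_odd_walk B \<Longrightarrow> (\<And>x y. A x y \<Longrightarrow> B x y) \<Longrightarrow> no_odd_walk A"
  unfolding no_odd_walk_def using closed_walk_mono by metis

lemma closed_walk_mod:
  assumes "n > 0" and "\<And>i. i < n \<Longrightarrow> A (f i) (f (Suc i mod n))"
  shows "closed_walk A n (\<lambda>i. f (i mod n))"
  unfolding closed_walk_def
proof (intro allI conjI)
  fix i
  have "Suc i mod n = Suc (i mod n) mod n" by (simp add: mod_Suc_eq)
  then show "A (f (i mod n)) (f (Suc i mod n))" using assms by simp
qed simp

lemma closed_walk_mod_eq: "closed_walk A n c \<Longrightarrow> c (i mod n) = c i"
proof -
  assume "closed_walk A n c"
  then have *: "c (i + n) = c i" for i by (simp add: closed_walk_def)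
  have "c (j + k * n) = c j" for j k
  proof (induction k)
    case (Suc k)
    then show ?case using *[of "j + k * n"] by (simp add: algebra_simps)
  qed simp
  then show ?thesis using mod_mult_div_eq[of i n] by (metis mult.commute)
qed

text \<open>Follow the walk from \<open>c i\<close> to \<open>c (i + d)\<close> and return through
  \<open>p\<close>.\<close>

lemma walk_shortcut:
  assumes "closed_walk A n c" "A p (c i)" "A (c (i + d)) p"
  shows "\<exists>c'. closed_walk A (d + 2) c'"
proof -
  define f where "f j = (case j of 0 \<Rightarrow> p | Suc k \<Rightarrow> c (i + k))" for j
  have step: "A (f j) (f (Suc j mod (d + 2)))" if "j < d + 2" for j
  proof (cases "j = d + 1")
    case True
    then show ?thesis using assms by (simp add: f_def)
  next
    case False
    then have "Suc j mod (d + 2) = Suc j" using that by simp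
    then show ?thesis using assms by (auto simp: f_def closed_walk_def split: nat.split)
  qed
  have "closed_walk A (d + 2) (\<lambda>i. f (i mod (d + 2)))"
    by (rule closed_walk_mod) (use step in simp_all)
  then show ?thesis by blast
qed

definition shortest_odd_walk :: "('a \<Rightarrow> 'a \<Rightarrow> bool) \<Rightarrow> nat \<Rightarrow> (nat \<Rightarrow> 'a) \<Rightarrow> bool" where
  "shortest_odd_walk A n c \<longleftrightarrow>
     odd n \<and> closed_walk A n c \<and> (\<forall>k c'. odd k \<longrightarrow> closed_walk A k c' \<longrightarrow> n \<le> k)"

lemma shortest_odd_walk_exists:
  assumes "\<not> no_odd_walk A"
  shows "\<exists>n c. shortest_odd_walk A n c"
proof -
  let ?P = "\<lambda>n. odd n \<and> (\<exists>c. closed_walk A n c)"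
  have "\<exists>n. ?P n" using assms by (auto simp: no_odd_walk_def)
  then have "?P (LEAST n. ?P n)" by (rule LeastI_ex)
  moreover have "(LEAST n. ?P n) \<le> k" if "?P k" for k using that by (rule Least_le)
  ultimately show ?thesis unfolding shortest_odd_walk_def by blast
qed

text \<open>The two arcs between \<open>c i\<close> and \<open>c j\<close> have lengths of different
  parity. Closing the odd one through \<open>p\<close> gives an odd closed walk that is two longer,
  so by minimality the odd arc has length at least \<open>n - 2\<close>; the even arc is then
  2.\<close>

lemma shortest_odd_walk_neighbours:
  assumes "shortest_odd_walk A n c" and sym: "\<And>x y. A x y \<Longrightarrow> A y x"
    and "A p (c i)" "A p (c j)" "i < j" "j < n"
  shows "j - i = 2 \<or> j - i = n - 2"
proof (cases "odd (j - i)")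
  case True
  have "\<exists>c'. closed_walk A ((j - i) + 2) c'"
    by (rule walk_shortcut[of A n c p i]) (use assms in \<open>auto simp: shortest_odd_walk_def\<close>)
  then have le: "n \<le> j - i + 2" using assms(1) True by (auto simp: shortest_odd_walk_def)
  have "even (n - 1)" using assms(1) by (simp add: shortest_odd_walk_def)
  then have "j - i \<noteq> n - 1" using True by metis
  then show ?thesis using le assms(5,6) by linarith
next
  case False
  have "j + (n - (j - i)) = i + n" using assms by simp
  then have "c (j + (n - (j - i))) = c i" using assms(1)
    by (metis shortest_odd_walk_def closed_walk_def)
  then have "\<exists>c'. closed_walk A ((n - (j - i)) + 2) c'"
    by (intro walk_shortcut[of A n c p j]) (use assms in \<open>auto simp: shortest_odd_walk_def\<close>)
  moreover have "odd (n - (j - i) + 2)" using False assms by (auto simp: shortest_odd_walk_def)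
  ultimately have "n \<le> n - (j - i) + 2" using assms(1) by (auto simp: shortest_odd_walk_def)
  then have "j - i \<le> 2" using assms(5,6) by linarith
  then show ?thesis using False assms(5) by presburger
qed

lemma card_le_2_nat:
  fixes S :: "nat set"
  assumes "finite S" and "\<And>i j k. i \<in> S \<Longrightarrow> j \<in> S \<Longrightarrow> k \<in> S \<Longrightarrow> i < j \<Longrightarrow> j < k \<Longrightarrow> False"
  shows "card S \<le> 2"
proof (rule ccontr)
  assume "\<not> card S \<le> 2"
  then have c: "card S \<ge> 3" by simp
  then have ne: "S \<noteq> {}" by auto
  have "S - {Min S, Max S} \<noteq> {}"
  proof
    assume "S - {Min S, Max S} = {}"
    then have "card S \<le> card {Min S, Max S}" by (intro card_mono) auto
    then show False using c by (simp add: card_insert_if split: if_splits)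
  qed
  then obtain j where "j \<in> S" "j \<noteq> Min S" "j \<noteq> Max S" by blast
  then show False using assms(2)[of "Min S" j "Max S"] assms(1) ne
    by (metis Max_ge Max_in Min_in Min_le le_neq_implies_less)
qed

text \<open>Three neighbours would give three differences in \<open>{2, n - 2}\<close>, one the sum
  of the other two. This is possible only for \<open>n = 3\<close> or \<open>n = 6\<close>.\<close>

lemma shortest_odd_walk_card:
  assumes "shortest_odd_walk A n c" and "\<And>x y. A x y \<Longrightarrow> A y x" and "n \<ge> 5"
  shows "card {i \<in> {..<n}. A p (c i)} \<le> 2"
proof (rule card_le_2_nat)
  fix i j k
  assume h: "i \<in> {i \<in> {..<n}. A p (c i)}" "j \<in> {i \<in> {..<n}. A p (c i)}" "k \<in> {i \<in> {..<n}. A p (c i)}"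
    and lt: "i < j" "j < k"
  note nb = shortest_odd_walk_neighbours[OF assms(1,2)]
  have "j - i = 2 \<or> j - i = n - 2" "k - j = 2 \<or> k - j = n - 2" "k - i = 2 \<or> k - i = n - 2"
    using nb[of p i j] nb[of p j k] nb[of p i k] h lt by auto
  moreover have "k - i = (k - j) + (j - i)" using lt by simp
  moreover have "n \<noteq> 6" using assms(1) by (auto simp: shortest_odd_walk_def)
  ultimately show False using assms(3) by linarith
qed simp

lemma miss_walk: "miss A (map (\<lambda>i. (1, c i)) [0..<n]) p = card {i \<in> {..<n}. \<not> A p (c i)}"
proof (induction n)
  case (Suc n)
  have "{i \<in> {..<Suc n}. \<not> A p (c i)} =
    (if A p (c n) then {i \<in> {..<n}. \<not> A p (c i)} else insert n {i \<in> {..<n}. \<not> A p (c i)})"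
    by (auto simp: less_Suc_eq)
  then show ?case using Suc by auto
qed simp

lemma miss_walk_eq:
  "miss A (map (\<lambda>i. (1, c i)) [0..<n]) p = n - card {i \<in> {..<n}. A p (c i)}"
proof -
  have "{i \<in> {..<n}. \<not> A p (c i)} = {..<n} - {i \<in> {..<n}. A p (c i)}" by auto
  then have "card {i \<in> {..<n}. \<not> A p (c i)} = n - card {i \<in> {..<n}. A p (c i)}"
    using card_Diff_subset[of "{i \<in> {..<n}. A p (c i)}" "{..<n}"] by auto
  then show ?thesis unfolding miss_walk .
qed

lemma sum_list_walk [simp]: "sum_list (map fst (map (\<lambda>i. (Suc 0, c i)) [0..<n])) = n"
  by (induction n) auto

text \<open>Colour a vertex by the parity of a walk from the root of its component. Two walks of
  different parity to the same vertex would combine to an odd closed walk at the root.\<close>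

lemma two_colourable_if_no_odd_walk:
  assumes sym: "\<And>x y. A x y \<Longrightarrow> A y x" and no: "no_odd_walk A"
  shows "\<exists>f :: 'a \<Rightarrow> bool. \<forall>x y. A x y \<longrightarrow> f x \<noteq> f y"
proof -
  define E where "E = {(x, y). A x y}"
  have conv: "E\<inverse> = E" using sym by (auto simp: E_def)
  have rev: "(y, x) \<in> E ^^ n" if "(x, y) \<in> E ^^ n" for x y n
    using that
  proof (induction n arbitrary: y)
    case (Suc n)
    then obtain z where "(x, z) \<in> E ^^ n" "(z, y) \<in> E" by auto
    moreover have "(y, z) \<in> E" using \<open>(z, y) \<in> E\<close> conv by blast
    ultimately show ?case using Suc.IH[of z] relpow_Suc_I2[of y z E x n] by simp
  qed simp
  have no_odd: "(x, x) \<notin> E ^^ n" if "odd n" for x n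
  proof
    assume "(x, x) \<in> E ^^ n"
    then obtain f where f: "f 0 = x" "f n = x" "\<forall>i<n. (f i, f (Suc i)) \<in> E"
      by (auto simp: relpow_fun_conv)
    have "n > 0" using that odd_pos by blast
    moreover have "A (f i) (f (Suc i mod n))" if "i < n" for i
      using f that by (cases "Suc i = n") (auto simp: E_def)
    ultimately have "closed_walk A n (\<lambda>i. f (i mod n))" by (rule closed_walk_mod)
    then show False using no that by (auto simp: no_odd_walk_def)
  qed
  \<comment> \<open>The two ends of an edge are reachable from the same vertices, so
    \<open>SOME\<close> yields the same root for both.\<close>
  define root where "root y = (SOME x. (x, y) \<in> E\<^sup>*)" for y
  have root: "(root y, y) \<in> E\<^sup>*" for y unfolding root_def by (rule someI[of _ y]) simp
  define f where "f y = (\<exists>n. even n \<and> (root y, y) \<in> E ^^ n)" for y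
  have "f x \<noteq> f y" if "A x y" for x y
  proof -
    have xy: "(x, y) \<in> E" "(y, x) \<in> E" using that sym by (auto simp: E_def)
    have "(z, x) \<in> E\<^sup>* \<longleftrightarrow> (z, y) \<in> E\<^sup>*" for z using xy by (meson rtrancl.rtrancl_into_rtrancl)
    then have r: "root x = root y" by (simp add: root_def)
    obtain k where k: "(root x, x) \<in> E ^^ k" using root rtrancl_imp_relpow by blast
    have ky: "(root x, y) \<in> E ^^ Suc k" using k xy by auto
    have par: "even a = even b" if "(root x, z) \<in> E ^^ a" "(root x, z) \<in> E ^^ b" for a b z
    proof -
      have "(root x, root x) \<in> E ^^ (a + b)" using that rev[of "root x" z b] by (auto simp: relpow_add)
      then show ?thesis using no_odd[of "a + b"] by auto
    qed
    have "f x = even k" using k par unfolding f_def by blast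
    moreover have "f y = even (Suc k)" using ky par unfolding f_def r[symmetric] by blast
    ultimately show ?thesis by simp
  qed
  then show ?thesis by blast
qed

section \<open>Forbidden configurations\<close>

text \<open>Each predicate excludes homomorphic images as well as subgraphs. \<open>H1\<close> is \<open>H\<^sub>1\<^sup>+\<^sup>+\<close> without
  \<open>u\<^sub>l, u\<^sub>r\<close>, and \<open>T0m\<close> is \<open>T\<^sub>0\<close> without \<open>t\<close>.\<close>

definition K4_free :: "('a \<Rightarrow> 'a \<Rightarrow> bool) \<Rightarrow> bool" where
  "K4_free A \<longleftrightarrow> (\<forall>v0 v1 v2 v3. \<not> (
    A v1 v0 \<and> A v2 v0 \<and> A v2 v1 \<and> A v3 v0 \<and> A v3 v1 \<and> A v3 v2))"

lemmas K4_freeD = K4_free_def[THEN iffD1, rule_format]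

definition W5_free :: "('a \<Rightarrow> 'a \<Rightarrow> bool) \<Rightarrow> bool" where
  "W5_free A \<longleftrightarrow> (\<forall>v0 v1 v2 v3 v4 h. \<not> (
    A v0 v1 \<and> A v1 v2 \<and> A v2 v3 \<and> A v3 v4 \<and> A v4 v0 \<and> A h v0 \<and>
    A h v1 \<and> A h v2 \<and> A h v3 \<and> A h v4))"

lemmas W5_freeD = W5_free_def[THEN iffD1, rule_format]

definition W7_free :: "('a \<Rightarrow> 'a \<Rightarrow> bool) \<Rightarrow> bool" where
  "W7_free A \<longleftrightarrow> (\<forall>v0 v1 v2 v3 v4 v5 v6 h. \<not> (
    A v0 v1 \<and> A v1 v2 \<and> A v2 v3 \<and> A v3 v4 \<and> A v4 v5 \<and> A v5 v6 \<and>
    A v6 v0 \<and> A h v0 \<and> A h v1 \<and> A h v2 \<and> A h v3 \<and> A h v4 \<and>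
    A h v5 \<and> A h v6))"

lemmas W7_freeD = W7_free_def[THEN iffD1, rule_format]

definition C7c_free :: "('a \<Rightarrow> 'a \<Rightarrow> bool) \<Rightarrow> bool" where
  "C7c_free A \<longleftrightarrow> (\<forall>v0 v1 v2 v3 v4 v5 v6. \<not> (
    A v0 v1 \<and> A v0 v2 \<and> A v1 v2 \<and> A v1 v3 \<and> A v2 v3 \<and> A v2 v4 \<and>
    A v3 v4 \<and> A v3 v5 \<and> A v4 v5 \<and> A v4 v6 \<and> A v5 v6 \<and> A v5 v0 \<and>
    A v6 v0 \<and> A v6 v1))"

lemmas C7c_freeD = C7c_free_def[THEN iffD1, rule_format]

definition H2p_free :: "('a \<Rightarrow> 'a \<Rightarrow> bool) \<Rightarrow> bool" where
  "H2p_free A \<longleftrightarrow> (\<forall>v0 v1 v2 v3 v4 v5 v6 u. \<not> (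
    A v0 v1 \<and> A v0 v2 \<and> A v1 v2 \<and> A v1 v3 \<and> A v2 v3 \<and> A v2 v4 \<and>
    A v3 v4 \<and> A v3 v5 \<and> A v4 v5 \<and> A v4 v6 \<and> A v5 v6 \<and> A v5 v0 \<and>
    A v6 v0 \<and> A u v0 \<and> A u v2 \<and> A u v5))"

lemmas H2p_freeD = H2p_free_def[THEN iffD1, rule_format]

definition H2_free :: "('a \<Rightarrow> 'a \<Rightarrow> bool) \<Rightarrow> bool" where
  "H2_free A \<longleftrightarrow> (\<forall>v0 v1 v2 v3 v4 v5 v6. \<not> (
    A v0 v1 \<and> A v0 v2 \<and> A v1 v2 \<and> A v1 v3 \<and> A v2 v3 \<and> A v2 v4 \<and>
    A v3 v4 \<and> A v3 v5 \<and> A v4 v5 \<and> A v4 v6 \<and> A v5 v6 \<and> A v5 v0 \<and>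
    A v6 v0))"

lemmas H2_freeD = H2_free_def[THEN iffD1, rule_format]

definition H1_free :: "('a \<Rightarrow> 'a \<Rightarrow> bool) \<Rightarrow> bool" where
  "H1_free A \<longleftrightarrow> (\<forall>v0 v1 v2 v3 v4 v5 v6. \<not> (
    A v0 v1 \<and> A v1 v2 \<and> A v2 v3 \<and> A v3 v4 \<and> A v4 v5 \<and> A v5 v6 \<and>
    A v6 v0 \<and> A v3 v5 \<and> A v5 v0 \<and> A v0 v2 \<and> A v2 v4 \<and> A v6 v1))"

lemmas H1_freeD = H1_free_def[THEN iffD1, rule_format]

text \<open>The Moser spindle: the rhombi \<open>u a b v\<close> and \<open>u c d w\<close> share
  the tip \<open>u\<close>, and their opposite tips \<open>v\<close>, \<open>w\<close> are
  adjacent.\<close>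

definition moser_free :: "('a \<Rightarrow> 'a \<Rightarrow> bool) \<Rightarrow> bool" where
  "moser_free A \<longleftrightarrow> (\<forall>u a b v c d w. \<not> (
    A u a \<and> A u b \<and> A a b \<and> A v a \<and> A v b \<and> A u c \<and>
    A u d \<and> A c d \<and> A w c \<and> A w d \<and> A v w))"

lemmas moser_freeD = moser_free_def[THEN iffD1, rule_format]

definition T0_free :: "('a \<Rightarrow> 'a \<Rightarrow> bool) \<Rightarrow> bool" where
  "T0_free A \<longleftrightarrow> (\<forall>v0 v1 v2 v3 v4 v5 v6 u w t. \<not> (
    A v0 v1 \<and> A v1 v2 \<and> A v2 v3 \<and> A v3 v4 \<and> A v4 v5 \<and> A v5 v6 \<and>
    A v6 v0 \<and> A u v0 \<and> A u v2 \<and> A u v3 \<and> A u v4 \<and> A u v5 \<and>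
    A u v6 \<and> A w v0 \<and> A w v1 \<and> A w v2 \<and> A w v3 \<and> A w v4 \<and>
    A w v5 \<and> A t v0 \<and> A t u \<and> A t w))"

lemmas T0_freeD = T0_free_def[THEN iffD1, rule_format]

definition T0m_free :: "('a \<Rightarrow> 'a \<Rightarrow> bool) \<Rightarrow> bool" where
  "T0m_free A \<longleftrightarrow> (\<forall>v0 v1 v2 v3 v4 v5 v6 u w. \<not> (
    A v0 v1 \<and> A v1 v2 \<and> A v2 v3 \<and> A v3 v4 \<and> A v4 v5 \<and> A v5 v6 \<and>
    A v6 v0 \<and> A u v0 \<and> A u v2 \<and> A u v3 \<and> A u v4 \<and> A u v5 \<and>
    A u v6 \<and> A w v0 \<and> A w v1 \<and> A w v2 \<and> A w v3 \<and> A w v4 \<and>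
    A w v5))"

lemmas T0m_freeD = T0m_free_def[THEN iffD1, rule_format]

text \<open>In the lemmas below every vertex \<open>p\<close> misses a certain weight of a configuration, whereas a vertex of
  the configuration is missed by at most \<open>m\<close> vertices. The weights are optimal solutions of the linear
  programs given by the sets that \<open>p\<close> cannot be completely joined to.\<close>

lemma (in dense_graph) T0m_miss:
  assumes K4: "K4_free A"
    and W5: "W5_free A"
    and W7: "W7_free A"
    and moser: "moser_free A"
    and adj: "A v0 v1 \<and> A v1 v2 \<and> A v2 v3 \<and> A v3 v4 \<and> A v4 v5 \<and> A v5 v6 \<and>
      A v6 v0 \<and> A u v0 \<and> A u v2 \<and> A u v3 \<and> A u v4 \<and> A u v5 \<and>
      A u v6 \<and> A w v0 \<and> A w v1 \<and> A w v2 \<and> A w v3 \<and> A w v4 \<and>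
      A w v5"
  shows "6 \<le> miss A [(2, v0), (1, v1), (1, v2), (1, v3), (1, v4), (1, v5), (1, v6), (4, u), (1, w)] p"
proof -
  have c0: "\<not> (A p v0 \<and> A p v1 \<and> A p u)"
    using adj moser_freeD[OF moser, of v1 p v0 u w v2 v3] by (auto simp: adj_commute)
  have c1: "\<not> (A p v0 \<and> A p v2 \<and> A p u)"
    using adj W7_freeD[OF W7, of p v0 v6 v5 v4 v3 v2 u] by (auto simp: adj_commute)
  have c2: "\<not> (A p v0 \<and> A p v3 \<and> A p u)"
    using adj moser_freeD[OF moser, of v0 p u v3 v1 w v2] by (auto simp: adj_commute)
  have c3: "\<not> (A p v0 \<and> A p v4 \<and> A p u)"
    using adj W5_freeD[OF W5, of p v0 v6 v5 v4 u] by (auto simp: adj_commute)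
  have c4: "\<not> (A p v0 \<and> A p v5 \<and> A p w)"
    using adj W7_freeD[OF W7, of p v0 v1 v2 v3 v4 v5 w] by (auto simp: adj_commute)
  have c5: "\<not> (A p v0 \<and> A p v6 \<and> A p w)"
    using adj moser_freeD[OF moser, of v6 p v0 w u v5 v4] by (auto simp: adj_commute)
  have c6: "\<not> (A p v1 \<and> A p v2 \<and> A p u)"
    using adj W5_freeD[OF W5, of p u v3 w v1 v2] by (auto simp: adj_commute)
  have c7: "\<not> (A p v1 \<and> A p v4 \<and> A p u)"
    using adj moser_freeD[OF moser, of v3 u v4 p w v2 v1] by (auto simp: adj_commute)
  have c8: "\<not> (A p v1 \<and> A p v5 \<and> A p w)"
    using adj moser_freeD[OF moser, of v0 u v6 v5 v1 w p] by (auto simp: adj_commute)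
  have c9: "\<not> (A p v2 \<and> A p v5 \<and> A p u)"
    using adj W5_freeD[OF W5, of p v2 v3 v4 v5 u] by (auto simp: adj_commute)
  have c10: "\<not> (A p v2 \<and> A p v6 \<and> A p u)"
    using adj moser_freeD[OF moser, of v0 u v6 p v1 w v2] by (auto simp: adj_commute)
  have c11: "\<not> (A p v3 \<and> A p v4 \<and> A p w)"
    using adj K4_freeD[OF K4, of v3 p w v4] by (auto simp: adj_commute)
  have c12: "\<not> (A p v3 \<and> A p v6 \<and> A p w)"
    using adj moser_freeD[OF moser, of v4 u v5 v6 w v3 p] by (auto simp: adj_commute)
  have c13: "\<not> (A p v5 \<and> A p v6 \<and> A p u)"
    using adj K4_freeD[OF K4, of v5 p u v6] by (auto simp: adj_commute)
  have c14: "\<not> (A p v0 \<and> A p v1 \<and> A p v2 \<and> A p v3 \<and> A p v4 \<and> A p v5 \<and> A p v6)"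
    using adj W7_freeD[OF W7, of v0 v1 v2 v3 v4 v5 v6 p] by (auto simp: adj_commute)
  \<comment> \<open>What remains is finite: every pattern of adjacencies of \<open>p\<close> that
    respects the constraints leaves weight at least 6 unseen.\<close>
  show ?thesis
    using c0 c1 c2 c3 c4 c5 c6 c7 c8 c9 c10 c11 c12 c13 c14 unfolding miss_Cons miss_Nil by (simp split: if_split; satx)
qed

text \<open>The ratio \<open>7/3\<close> is \<open>2 + c_const 3\<close>. The ratios
  \<open>9/4\<close>, \<open>11/5\<close>, \<open>15/7\<close> and \<open>13/6\<close> in the lemmas
  for \<open>H2p\<close>, \<open>H2\<close>, \<open>H1\<close> and \<open>T0m\<close> are likewise
  \<open>2 + c_const i\<close> for \<open>i\<close> = 5, 7, 11 and 9.\<close>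

lemma (in dense_graph) C7c_free_if_dense:
  assumes W5: "W5_free A" and dense: "7 * m < 3 * card V"
  shows "C7c_free A"
  unfolding C7c_free_def
proof (intro allI notI)
  fix v0 v1 v2 v3 v4 v5 v6
  assume adj: "A v0 v1 \<and> A v0 v2 \<and> A v1 v2 \<and> A v1 v3 \<and> A v2 v3 \<and> A v2 v4 \<and>
    A v3 v4 \<and> A v3 v5 \<and> A v4 v5 \<and> A v4 v6 \<and> A v5 v6 \<and> A v5 v0 \<and>
    A v6 v0 \<and> A v6 v1"
  let ?ws = "[(1, v0), (1, v1), (1, v2), (1, v3), (1, v4), (1, v5), (1, v6)]"
  have miss: "3 \<le> miss A ?ws p" for p
  proof -
    have c0: "\<not> (A p v0 \<and> A p v2 \<and> A p v4)"
      using adj W5_freeD[OF W5, of p v0 v1 v3 v4 v2] by (auto simp: adj_commute)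
    have c1: "\<not> (A p v0 \<and> A p v2 \<and> A p v5)"
      using adj W5_freeD[OF W5, of p v2 v1 v6 v5 v0] by (auto simp: adj_commute)
    have c2: "\<not> (A p v0 \<and> A p v3 \<and> A p v5)"
      using adj W5_freeD[OF W5, of p v0 v6 v4 v3 v5] by (auto simp: adj_commute)
    have c3: "\<not> (A p v1 \<and> A p v3 \<and> A p v5)"
      using adj W5_freeD[OF W5, of p v1 v2 v4 v5 v3] by (auto simp: adj_commute)
    have c4: "\<not> (A p v1 \<and> A p v3 \<and> A p v6)"
      using adj W5_freeD[OF W5, of p v3 v2 v0 v6 v1] by (auto simp: adj_commute)
    have c5: "\<not> (A p v1 \<and> A p v4 \<and> A p v6)"
      using adj W5_freeD[OF W5, of p v1 v0 v5 v4 v6] by (auto simp: adj_commute)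
    have c6: "\<not> (A p v2 \<and> A p v4 \<and> A p v6)"
      using adj W5_freeD[OF W5, of p v2 v3 v5 v6 v4] by (auto simp: adj_commute)
    show ?thesis
      using c0 c1 c2 c3 c4 c5 c6 unfolding miss_Cons miss_Nil by (simp split: if_split; satx)
  qed
  have "3 * card V \<le> sum_list (map fst ?ws) * m"
    by (intro weight_bound_all miss) (use adj in_V in_V2 in auto)
  then show False using dense by simp
qed

lemma (in dense_graph) H2p_free_if_dense:
  assumes K4: "K4_free A" and W5: "W5_free A" and dense: "9 * m < 4 * card V"
  shows "H2p_free A"
  unfolding H2p_free_def
proof (intro allI notI)
  fix v0 v1 v2 v3 v4 v5 v6 u
  assume adj: "A v0 v1 \<and> A v0 v2 \<and> A v1 v2 \<and> A v1 v3 \<and> A v2 v3 \<and> A v2 v4 \<and>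
    A v3 v4 \<and> A v3 v5 \<and> A v4 v5 \<and> A v4 v6 \<and> A v5 v6 \<and> A v5 v0 \<and>
    A v6 v0 \<and> A u v0 \<and> A u v2 \<and> A u v5"
  let ?ws = "[(2, v0), (1, v1), (2, v2), (1, v3), (1, v4), (1, v5), (1, v6)]"
  have miss: "4 \<le> miss A ?ws p" for p
  proof -
    have c0: "\<not> (A p v0 \<and> A p v1 \<and> A p v5)"
      using adj W5_freeD[OF W5, of p v1 v2 u v5 v0] by (auto simp: adj_commute)
    have c1: "\<not> (A p v0 \<and> A p v2 \<and> A p v4)"
      using adj W5_freeD[OF W5, of p v0 v1 v3 v4 v2] by (auto simp: adj_commute)
    have c2: "\<not> (A p v0 \<and> A p v2 \<and> A p v6)"
      using adj W5_freeD[OF W5, of p v2 u v5 v6 v0] by (auto simp: adj_commute)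
    have c3: "\<not> (A p v0 \<and> A p v3 \<and> A p v5)"
      using adj W5_freeD[OF W5, of p v0 v6 v4 v3 v5] by (auto simp: adj_commute)
    have c4: "\<not> (A p v1 \<and> A p v2 \<and> A p v3)"
      using adj K4_freeD[OF K4, of v1 p v2 v3] by (auto simp: adj_commute)
    have c5: "\<not> (A p v2 \<and> A p v4 \<and> A p v6)"
      using adj W5_freeD[OF W5, of p v2 v3 v5 v6 v4] by (auto simp: adj_commute)
    have c6: "\<not> (A p v0 \<and> A p v1 \<and> A p v3 \<and> A p v4 \<and> A p v6)"
      using adj W5_freeD[OF W5, of v0 v1 v3 v4 v6 p] by (auto simp: adj_commute)
    show ?thesis
      using c0 c1 c2 c3 c4 c5 c6 unfolding miss_Cons miss_Nil by (simp split: if_split; satx)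
  qed
  have "4 * card V \<le> sum_list (map fst ?ws) * m"
    by (intro weight_bound_all miss) (use adj in_V in_V2 in auto)
  then show False using dense by simp
qed

lemma (in dense_graph) H2_free_if_dense:
  assumes K4: "K4_free A" and W5: "W5_free A" and C7c: "C7c_free A" and H2p: "H2p_free A"
    and dense: "11 * m < 5 * card V"
  shows "H2_free A"
  unfolding H2_free_def
proof (intro allI notI)
  fix v0 v1 v2 v3 v4 v5 v6
  assume adj: "A v0 v1 \<and> A v0 v2 \<and> A v1 v2 \<and> A v1 v3 \<and> A v2 v3 \<and> A v2 v4 \<and>
    A v3 v4 \<and> A v3 v5 \<and> A v4 v5 \<and> A v4 v6 \<and> A v5 v6 \<and> A v5 v0 \<and>
    A v6 v0"
  let ?ws = "[(3, v0), (1, v1), (2, v2), (1, v3), (1, v4), (2, v5), (1, v6)]"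
  have miss: "5 \<le> miss A ?ws p" for p
  proof -
    have c0: "\<not> (A p v0 \<and> A p v1 \<and> A p v2)"
      using adj K4_freeD[OF K4, of v0 p v1 v2] by (auto simp: adj_commute)
    have c1: "\<not> (A p v0 \<and> A p v2 \<and> A p v4)"
      using adj W5_freeD[OF W5, of p v0 v1 v3 v4 v2] by (auto simp: adj_commute)
    have c2: "\<not> (A p v0 \<and> A p v2 \<and> A p v5)"
      using adj H2p_freeD[OF H2p, of v0 v1 v2 v3 v4 v5 v6 p] by (auto simp: adj_commute)
    have c3: "\<not> (A p v0 \<and> A p v3 \<and> A p v5)"
      using adj W5_freeD[OF W5, of p v0 v6 v4 v3 v5] by (auto simp: adj_commute)
    have c4: "\<not> (A p v0 \<and> A p v5 \<and> A p v6)"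
      using adj K4_freeD[OF K4, of v0 p v5 v6] by (auto simp: adj_commute)
    have c5: "\<not> (A p v1 \<and> A p v3 \<and> A p v5)"
      using adj W5_freeD[OF W5, of p v1 v2 v4 v5 v3] by (auto simp: adj_commute)
    have c6: "\<not> (A p v2 \<and> A p v4 \<and> A p v6)"
      using adj W5_freeD[OF W5, of p v2 v3 v5 v6 v4] by (auto simp: adj_commute)
    \<comment> \<open>Here \<open>p\<close> takes the place of \<open>v6\<close> and supplies the
      edge to \<open>v1\<close> that \<open>H2\<close> lacks; in \<open>c8\<close> it takes the
      place of \<open>v1\<close> and supplies the edge to \<open>v6\<close>.\<close>
    have c7: "\<not> (A p v0 \<and> A p v1 \<and> A p v4 \<and> A p v5)"
      using adj C7c_freeD[OF C7c, of p v0 v1 v2 v3 v4 v5] by (auto simp: adj_commute)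
    have c8: "\<not> (A p v0 \<and> A p v2 \<and> A p v3 \<and> A p v6)"
      using adj C7c_freeD[OF C7c, of p v0 v6 v5 v4 v3 v2] by (auto simp: adj_commute)
    have c9: "\<not> (A p v0 \<and> A p v1 \<and> A p v3 \<and> A p v4 \<and> A p v6)"
      using adj W5_freeD[OF W5, of v0 v1 v3 v4 v6 p] by (auto simp: adj_commute)
    show ?thesis
      using c0 c1 c2 c3 c4 c5 c6 c7 c8 c9 unfolding miss_Cons miss_Nil by (simp split: if_split; satx)
  qed
  have "5 * card V \<le> sum_list (map fst ?ws) * m"
    by (intro weight_bound_all miss) (use adj in_V in_V2 in auto)
  then show False using dense by simp
qed

lemma (in dense_graph) H1_free_if_dense:
  assumes K4: "K4_free A" and W5: "W5_free A" and H2: "H2_free A"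
    and dense: "15 * m < 7 * card V"
  shows "H1_free A"
  unfolding H1_free_def
proof (intro allI notI)
  fix v0 v1 v2 v3 v4 v5 v6
  assume adj: "A v0 v1 \<and> A v1 v2 \<and> A v2 v3 \<and> A v3 v4 \<and> A v4 v5 \<and> A v5 v6 \<and>
    A v6 v0 \<and> A v3 v5 \<and> A v5 v0 \<and> A v0 v2 \<and> A v2 v4 \<and> A v6 v1"
  let ?ws = "[(3, v0), (1, v1), (3, v2), (2, v3), (2, v4), (3, v5), (1, v6)]"
  have miss: "7 \<le> miss A ?ws p" for p
  proof -
    have c0: "\<not> (A p v0 \<and> A p v1 \<and> A p v2)"
      using adj K4_freeD[OF K4, of v0 p v1 v2] by (auto simp: adj_commute)
    have c1: "\<not> (A p v0 \<and> A p v1 \<and> A p v6)"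
      using adj K4_freeD[OF K4, of v0 p v1 v6] by (auto simp: adj_commute)
    have c2: "\<not> (A p v0 \<and> A p v2 \<and> A p v5)"
      using adj W5_freeD[OF W5, of p v2 v1 v6 v5 v0] by (auto simp: adj_commute)
    have c3: "\<not> (A p v0 \<and> A p v5 \<and> A p v6)"
      using adj K4_freeD[OF K4, of v0 p v5 v6] by (auto simp: adj_commute)
    have c4: "\<not> (A p v2 \<and> A p v3 \<and> A p v4)"
      using adj K4_freeD[OF K4, of v2 p v3 v4] by (auto simp: adj_commute)
    have c5: "\<not> (A p v3 \<and> A p v4 \<and> A p v5)"
      using adj K4_freeD[OF K4, of v3 p v4 v5] by (auto simp: adj_commute)
    have c6: "\<not> (A p v0 \<and> A p v1 \<and> A p v3 \<and> A p v5)"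
      using adj H2_freeD[OF H2, of v2 v1 v0 p v5 v3 v4] by (auto simp: adj_commute)
    have c7: "\<not> (A p v0 \<and> A p v1 \<and> A p v4 \<and> A p v5)"
      using adj H2_freeD[OF H2, of v2 v1 v0 p v5 v4 v3] by (auto simp: adj_commute)
    have c8: "\<not> (A p v0 \<and> A p v2 \<and> A p v3 \<and> A p v6)"
      using adj H2_freeD[OF H2, of v5 v6 v0 p v2 v3 v4] by (auto simp: adj_commute)
    have c9: "\<not> (A p v0 \<and> A p v2 \<and> A p v4 \<and> A p v6)"
      using adj H2_freeD[OF H2, of v5 v6 v0 p v2 v4 v3] by (auto simp: adj_commute)
    have c10: "\<not> (A p v1 \<and> A p v2 \<and> A p v3 \<and> A p v5)"
      using adj H2_freeD[OF H2, of v5 v3 p v2 v1 v0 v6] by (auto simp: adj_commute)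
    have c11: "\<not> (A p v1 \<and> A p v2 \<and> A p v4 \<and> A p v5)"
      using adj H2_freeD[OF H2, of v5 v4 p v2 v1 v0 v6] by (auto simp: adj_commute)
    have c12: "\<not> (A p v2 \<and> A p v3 \<and> A p v5 \<and> A p v6)"
      using adj H2_freeD[OF H2, of v2 v3 p v5 v6 v0 v1] by (auto simp: adj_commute)
    have c13: "\<not> (A p v2 \<and> A p v4 \<and> A p v5 \<and> A p v6)"
      using adj H2_freeD[OF H2, of v2 v4 p v5 v6 v0 v1] by (auto simp: adj_commute)
    show ?thesis
      using c0 c1 c2 c3 c4 c5 c6 c7 c8 c9 c10 c11 c12 c13 unfolding miss_Cons miss_Nil by (simp split: if_split; satx)
  qed
  have "7 * card V \<le> sum_list (map fst ?ws) * m"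
    by (intro weight_bound_all miss) (use adj in_V in_V2 in auto)
  then show False using dense by simp
qed

lemma (in dense_graph) moser_free_if_dense:
  assumes K4: "K4_free A" and H1: "H1_free A" and dense: "15 * m < 7 * card V"
  shows "moser_free A"
  unfolding moser_free_def
proof (intro allI notI)
  fix u a b v c d w
  assume adj: "A u a \<and> A u b \<and> A a b \<and> A v a \<and> A v b \<and> A u c \<and>
    A u d \<and> A c d \<and> A w c \<and> A w d \<and> A v w"
  \<comment> \<open>A common neighbour \<open>q\<close> of the adjacent tips exists because
    \<open>2 * m < card V\<close>. With it, every vertex misses weight 9 out of 19, and
    \<open>19/9\<close> is just below \<open>15/7\<close>.\<close>
  have "{v, w} \<subseteq> V" using adj in_V in_V2 by blast
  then have "card V \<le> card (N {v, w}) + card {v, w} * m" by (rule card_N)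
  moreover have "card {v, w} * m \<le> 2 * m" by (intro mult_le_mono1) (simp add: card_insert_if)
  ultimately have "card (N {v, w}) \<noteq> 0" using dense by linarith
  then have "N {v, w} \<noteq> {}" by auto
  then obtain q where q: "q \<in> V" "A q v" "A q w" by (auto simp: N_def)
  let ?ws = "[(3, u), (2, a), (2, b), (3, v), (2, c), (2, d), (3, w), (2, q)]"
  have miss: "9 \<le> miss A ?ws p" for p
  proof -
    have c0: "\<not> (A p u \<and> A p a \<and> A p b)"
      using adj q K4_freeD[OF K4, of b p u a] by (auto simp: adj_commute)
    have c1: "\<not> (A p a \<and> A p b \<and> A p v)"
      using adj q K4_freeD[OF K4, of v p b a] by (auto simp: adj_commute)
    have c2: "\<not> (A p u \<and> A p c \<and> A p d)"
      using adj q K4_freeD[OF K4, of u p d c] by (auto simp: adj_commute)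
    have c3: "\<not> (A p c \<and> A p d \<and> A p w)"
      using adj q K4_freeD[OF K4, of w p d c] by (auto simp: adj_commute)
    have c4: "\<not> (A p v \<and> A p w \<and> A p q)"
      using adj q K4_freeD[OF K4, of q p v w] by (auto simp: adj_commute)
    have c5: "\<not> (A p a \<and> A p b \<and> A p c \<and> A p w)"
      using adj q H1_freeD[OF H1, of c w p b a u d] by (auto simp: adj_commute)
    have c6: "\<not> (A p a \<and> A p b \<and> A p d \<and> A p w)"
      using adj q H1_freeD[OF H1, of d w p b a u c] by (auto simp: adj_commute)
    have c7: "\<not> (A p a \<and> A p v \<and> A p c \<and> A p d)"
      using adj q H1_freeD[OF H1, of a v p d c u b] by (auto simp: adj_commute)
    have c8: "\<not> (A p u \<and> A p a \<and> A p w \<and> A p q)"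
      using adj q H1_freeD[OF H1, of a u p q w v b] by (auto simp: adj_commute)
    have c9: "\<not> (A p u \<and> A p a \<and> A p v \<and> A p w)"
      using adj q H1_freeD[OF H1, of p a u d c w v] by (auto simp: adj_commute)
    have c10: "\<not> (A p b \<and> A p v \<and> A p c \<and> A p d)"
      using adj q H1_freeD[OF H1, of b v p d c u a] by (auto simp: adj_commute)
    have c11: "\<not> (A p u \<and> A p b \<and> A p w \<and> A p q)"
      using adj q H1_freeD[OF H1, of b u p q w v a] by (auto simp: adj_commute)
    have c12: "\<not> (A p u \<and> A p b \<and> A p v \<and> A p w)"
      using adj q H1_freeD[OF H1, of p b u d c w v] by (auto simp: adj_commute)
    have c13: "\<not> (A p u \<and> A p v \<and> A p c \<and> A p q)"
      using adj q H1_freeD[OF H1, of c u p q v w d] by (auto simp: adj_commute)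
    have c14: "\<not> (A p u \<and> A p v \<and> A p c \<and> A p w)"
      using adj q H1_freeD[OF H1, of p w v b a u c] by (auto simp: adj_commute)
    have c15: "\<not> (A p u \<and> A p v \<and> A p d \<and> A p q)"
      using adj q H1_freeD[OF H1, of d u p q v w c] by (auto simp: adj_commute)
    have c16: "\<not> (A p u \<and> A p v \<and> A p d \<and> A p w)"
      using adj q H1_freeD[OF H1, of p w v b a u d] by (auto simp: adj_commute)
    show ?thesis
      using c0 c1 c2 c3 c4 c5 c6 c7 c8 c9 c10 c11 c12 c13 c14 c15 c16 unfolding miss_Cons miss_Nil by (simp split: if_split; satx)
  qed
  have "9 * card V \<le> sum_list (map fst ?ws) * m"
    by (intro weight_bound_all miss) (use adj q in_V in_V2 in auto)
  then show False using dense by simp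
qed

lemma (in dense_graph) T0m_free_if_dense:
  assumes "K4_free A" "W5_free A" "W7_free A" "moser_free A" and "13 * m < 6 * card V"
  shows "T0m_free A"
  unfolding T0m_free_def
proof (intro allI notI)
  fix v0 v1 v2 v3 v4 v5 v6 u w
  assume adj: "A v0 v1 \<and> A v1 v2 \<and> A v2 v3 \<and> A v3 v4 \<and> A v4 v5 \<and> A v5 v6 \<and>
    A v6 v0 \<and> A u v0 \<and> A u v2 \<and> A u v3 \<and> A u v4 \<and> A u v5 \<and>
    A u v6 \<and> A w v0 \<and> A w v1 \<and> A w v2 \<and> A w v3 \<and> A w v4 \<and>
    A w v5"
  have "6 * card V \<le> sum_list (map fst [(2, v0), (1, v1), (1, v2), (1, v3), (1, v4), (1, v5), (1, v6), (4, u), (1, w)]) * m"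
    by (rule weight_bound_all) (use T0m_miss[OF assms(1-4) adj] adj in_V in_V2 in auto)
  then show False using assms(5) by simp
qed

text \<open>Between the densities \<open>15/7\<close> and \<open>13/6\<close> the weights of
  \<open>T0m_miss\<close> do not suffice. That \<open>T_0\<close> is excluded means that no vertex
  sees \<open>v0\<close>, \<open>u\<close> and \<open>w\<close> at once; with this additional
  constraint the weights can be shifted to these three so that every vertex misses 9 out of 19, and
  \<open>19/9 < 15/7\<close>.\<close>

lemma (in dense_graph) T0m_free_if_T0_free:
  assumes K4: "K4_free A" and W5: "W5_free A" and W7: "W7_free A" and moser: "moser_free A"
    and T0: "T0_free A" and dense: "15 * m < 7 * card V"
  shows "T0m_free A"
  unfolding T0m_free_def
proof (intro allI notI)
  fix v0 v1 v2 v3 v4 v5 v6 u w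
  assume adj: "A v0 v1 \<and> A v1 v2 \<and> A v2 v3 \<and> A v3 v4 \<and> A v4 v5 \<and> A v5 v6 \<and>
    A v6 v0 \<and> A u v0 \<and> A u v2 \<and> A u v3 \<and> A u v4 \<and> A u v5 \<and>
    A u v6 \<and> A w v0 \<and> A w v1 \<and> A w v2 \<and> A w v3 \<and> A w v4 \<and>
    A w v5"
  have ex: "\<not> (A p v0 \<and> A p u \<and> A p w)" for p
    using adj T0_freeD[OF T0, of v0 v1 v2 v3 v4 v5 v6 u w p] by auto
  let ?ws = "[(5, v0), (1, v1), (1, v2), (1, v3), (1, v4), (1, v5), (1, v6), (4, u), (4, w)]"
  have miss: "9 \<le> miss A ?ws p" for p
  proof -
    have c0: "\<not> (A p v0 \<and> A p v1 \<and> A p u)"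
      using adj moser_freeD[OF moser, of v1 p v0 u w v2 v3] by (auto simp: adj_commute)
    have c1: "\<not> (A p v0 \<and> A p v2 \<and> A p u)"
      using adj W7_freeD[OF W7, of p v0 v6 v5 v4 v3 v2 u] by (auto simp: adj_commute)
    have c2: "\<not> (A p v0 \<and> A p v3 \<and> A p u)"
      using adj moser_freeD[OF moser, of v0 p u v3 v1 w v2] by (auto simp: adj_commute)
    have c3: "\<not> (A p v0 \<and> A p v3 \<and> A p w)"
      using adj W5_freeD[OF W5, of p v0 v1 v2 v3 w] by (auto simp: adj_commute)
    have c4: "\<not> (A p v0 \<and> A p v4 \<and> A p u)"
      using adj W5_freeD[OF W5, of p v0 v6 v5 v4 u] by (auto simp: adj_commute)
    have c5: "\<not> (A p v0 \<and> A p v4 \<and> A p w)"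
      using adj moser_freeD[OF moser, of v0 p w v4 u v6 v5] by (auto simp: adj_commute)
    have c6: "\<not> (A p v0 \<and> A p v6 \<and> A p w)"
      using adj moser_freeD[OF moser, of v6 p v0 w u v5 v4] by (auto simp: adj_commute)
    have c7: "\<not> (A p v1 \<and> A p v2 \<and> A p w)"
      using adj K4_freeD[OF K4, of v1 p w v2] by (auto simp: adj_commute)
    have c8: "\<not> (A p v1 \<and> A p v4 \<and> A p u)"
      using adj moser_freeD[OF moser, of v3 u v4 p w v2 v1] by (auto simp: adj_commute)
    have c9: "\<not> (A p v1 \<and> A p v5 \<and> A p w)"
      using adj moser_freeD[OF moser, of v0 u v6 v5 v1 w p] by (auto simp: adj_commute)
    have c10: "\<not> (A p v2 \<and> A p v5 \<and> A p w)"
      using adj W5_freeD[OF W5, of p v2 v3 v4 v5 w] by (auto simp: adj_commute)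
    have c11: "\<not> (A p v2 \<and> A p v6 \<and> A p u)"
      using adj moser_freeD[OF moser, of v0 u v6 p v1 w v2] by (auto simp: adj_commute)
    have c12: "\<not> (A p v3 \<and> A p v4 \<and> A p w)"
      using adj K4_freeD[OF K4, of v3 p w v4] by (auto simp: adj_commute)
    have c13: "\<not> (A p v3 \<and> A p v6 \<and> A p w)"
      using adj moser_freeD[OF moser, of v4 u v5 v6 w v3 p] by (auto simp: adj_commute)
    have c14: "\<not> (A p v5 \<and> A p v6 \<and> A p u)"
      using adj K4_freeD[OF K4, of v5 p u v6] by (auto simp: adj_commute)
    have c15: "\<not> (A p v0 \<and> A p v1 \<and> A p v2 \<and> A p v3 \<and> A p v4 \<and> A p v5 \<and> A p v6)"
      using adj W7_freeD[OF W7, of v0 v1 v2 v3 v4 v5 v6 p] by (auto simp: adj_commute)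
    show ?thesis
      using c0 c1 c2 c3 c4 c5 c6 c7 c8 c9 c10 c11 c12 c13 c14 c15 ex[of p] unfolding miss_Cons miss_Nil by (simp split: if_split; satx)
  qed
  have "9 * card V \<le> sum_list (map fst ?ws) * m"
    by (intro weight_bound_all miss) (use adj in_V in_V2 in auto)
  then show False using dense by simp
qed

section \<open>Deleting an independent set that meets all triangles\<close>

definition odd_wheel_free :: "('a \<Rightarrow> 'a \<Rightarrow> bool) \<Rightarrow> bool" where
  "odd_wheel_free A \<longleftrightarrow> (\<forall>v. no_odd_walk (\<lambda>x y. A x y \<and> A v x \<and> A v y))"

context dense_graph
begin

lemma odd_wheel_free_iff:
  "odd_wheel_free A \<longleftrightarrow>
    (\<forall>v n c. odd n \<longrightarrow> closed_walk A n c \<longrightarrow> (\<exists>i. \<not> A v (c i)))"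
  unfolding odd_wheel_free_def no_odd_walk_def closed_walk_def by blast

lemma K4_free_if_odd_wheel_free:
  assumes "odd_wheel_free A"
  shows "K4_free A"
  unfolding K4_free_def
proof (intro allI notI)
  fix v0 v1 v2 v3
  assume adj: "A v1 v0 \<and> A v2 v0 \<and> A v2 v1 \<and> A v3 v0 \<and> A v3 v1 \<and> A v3 v2"
  define f where "f i = [v0, v1, v2] ! i" for i
  have "closed_walk A 3 (\<lambda>i. f (i mod 3))"
  proof (rule closed_walk_mod)
    fix i :: nat assume "i < 3"
    then consider "i = 0" | "i = 1" | "i = 2" by linarith
    then show "A (f i) (f (Suc i mod 3))" using adj by cases (auto simp: f_def adj_commute)
  qed simp
  moreover have "A v3 (f (i mod 3))" for i
  proof -
    have "i mod 3 < 3" by simp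
    then consider "i mod 3 = 0" | "i mod 3 = 1" | "i mod 3 = 2" by linarith
    then show ?thesis using adj by cases (auto simp: f_def)
  qed
  ultimately show False using assms unfolding odd_wheel_free_iff by (metis odd_numeral)
qed

lemma W5_free_if_odd_wheel_free:
  assumes "odd_wheel_free A"
  shows "W5_free A"
  unfolding W5_free_def
proof (intro allI notI)
  fix v0 v1 v2 v3 v4 h
  assume adj: "A v0 v1 \<and> A v1 v2 \<and> A v2 v3 \<and> A v3 v4 \<and> A v4 v0 \<and>
    A h v0 \<and> A h v1 \<and> A h v2 \<and> A h v3 \<and> A h v4"
  define f where "f i = [v0, v1, v2, v3, v4] ! i" for i
  have cases5: "i < 5 \<Longrightarrow> i = 0 \<or> i = 1 \<or> i = 2 \<or> i = 3 \<or> i = 4" for i :: nat by linarith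
  have "closed_walk A 5 (\<lambda>i. f (i mod 5))"
    by (rule closed_walk_mod) (use adj in \<open>auto simp: f_def dest!: cases5\<close>)
  moreover have "A h (f (i mod 5))" for i
    using cases5[of "i mod 5"] adj by (auto simp: f_def)
  ultimately show False using assms unfolding odd_wheel_free_iff by (metis odd_numeral)
qed

lemma W7_free_if_odd_wheel_free:
  assumes "odd_wheel_free A"
  shows "W7_free A"
  unfolding W7_free_def
proof (intro allI notI)
  fix v0 v1 v2 v3 v4 v5 v6 h
  assume adj: "A v0 v1 \<and> A v1 v2 \<and> A v2 v3 \<and> A v3 v4 \<and> A v4 v5 \<and> A v5 v6 \<and> A v6 v0 \<and>
    A h v0 \<and> A h v1 \<and> A h v2 \<and> A h v3 \<and> A h v4 \<and> A h v5 \<and> A h v6"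
  define f where "f i = [v0, v1, v2, v3, v4, v5, v6] ! i" for i
  have cases7: "i < 7 \<Longrightarrow> i = 0 \<or> i = 1 \<or> i = 2 \<or> i = 3 \<or> i = 4 \<or> i = 5 \<or> i = 6" for i :: nat
    by linarith
  have "closed_walk A 7 (\<lambda>i. f (i mod 7))"
    by (rule closed_walk_mod) (use adj in \<open>auto simp: f_def dest!: cases7\<close>)
  moreover have "A h (f (i mod 7))" for i
    using cases7[of "i mod 7"] adj by (auto simp: f_def)
  ultimately show False using assms unfolding odd_wheel_free_iff by (metis odd_numeral)
qed

text \<open>A form of \<open>weight_bound\<close> with three levels. The sizes of the levels stay
  separate, so that several such counts can be added afterwards.\<close>

lemma sum_le_miss:
  assumes "snd ` set ws \<subseteq> V" and "E \<subseteq> I" "I \<subseteq> V"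
    and "\<And>p. p \<in> V \<Longrightarrow> p \<notin> I \<Longrightarrow> a \<le> miss A ws p"
    and "\<And>p. p \<in> I \<Longrightarrow> p \<notin> E \<Longrightarrow> b \<le> miss A ws p"
    and "\<And>p. p \<in> E \<Longrightarrow> d \<le> miss A ws p"
  shows "a * (card V - card I) + b * (card I - card E) + d * card E \<le> sum_list (map fst ws) * m"
proof -
  have f: "finite I" "finite E" using assms finite_V finite_subset by metis+
  have "(\<Sum>p\<in>V. miss A ws p) =
      (\<Sum>p\<in>V - I. miss A ws p) + ((\<Sum>p\<in>I - E. miss A ws p) + (\<Sum>p\<in>E. miss A ws p))"
    using sum.subset_diff[OF assms(3) finite_V, of "miss A ws"]
      sum.subset_diff[OF assms(2) f(1), of "miss A ws"] by simp
  moreover have "a * card (V - I) \<le> (\<Sum>p\<in>V - I. miss A ws p)"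
    using sum_mono[of "V - I" "\<lambda>_. a" "miss A ws"] assms by (simp add: mult.commute)
  moreover have "b * card (I - E) \<le> (\<Sum>p\<in>I - E. miss A ws p)"
    using sum_mono[of "I - E" "\<lambda>_. b" "miss A ws"] assms by (simp add: mult.commute)
  moreover have "d * card E \<le> (\<Sum>p\<in>E. miss A ws p)"
    using sum_mono[of E "\<lambda>_. d" "miss A ws"] assms by (simp add: mult.commute)
  moreover have "card (V - I) = card V - card I" "card (I - E) = card I - card E"
    using f assms by (simp_all add: card_Diff_subset)
  ultimately show ?thesis using sum_miss[OF assms(1)] by simp
qed

end

text \<open>The situation in the link of an \<open>(r - 3)\<close>-clique when \<open>I\<close> has
  been chosen as the class of one colour; the aim is that the remaining vertices induce a bipartite
  graph. The ratio \<open>15/7\<close> is \<open>2 + c_const 11\<close>.\<close>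

locale independent_cover = dense_graph +
  fixes I
  assumes I_subset: "I \<subseteq> V"
    and I_independent: "\<And>x y. x \<in> I \<Longrightarrow> y \<in> I \<Longrightarrow> \<not> A x y"
    and no_triangle: "\<And>x y z. x \<notin> I \<Longrightarrow> y \<notin> I \<Longrightarrow> z \<notin> I \<Longrightarrow> A x y \<Longrightarrow> A x z \<Longrightarrow> \<not> A y z"
    and odd_wheel_free: "odd_wheel_free A"
    and moser_free: "moser_free A"
    and T0m_free: "T0m_free A"
    and dense: "15 * m < 7 * card V"
begin

lemma card_I: "card I \<le> m"
  using card_independent[of I] I_subset I_independent by blast

text \<open>Since \<open>2 * m < card V\<close>, the two ends have a common neighbour; outside
  \<open>I\<close> it would form a triangle with them.\<close>

lemma common_neighbour_in_I:
  assumes "A x y" "x \<notin> I" "y \<notin> I"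
  obtains p where "p \<in> I" "A p x" "A p y"
proof -
  have "{x, y} \<subseteq> V" using assms in_V in_V2 by blast
  then have "card V \<le> card (N {x, y}) + card {x, y} * m" by (rule card_N)
  moreover have "card {x, y} * m \<le> 2 * m" by (intro mult_le_mono1) (simp add: card_insert_if)
  ultimately have "card (N {x, y}) \<noteq> 0" using dense by linarith
  then have "N {x, y} \<noteq> {}" by auto
  then obtain p where "A p x" "A p y" by (auto simp: N_def)
  then show thesis using that no_triangle[of p x y] assms by blast
qed

text \<open>The vertex \<open>p0\<close> sees all of the pentagon but \<open>c0\<close>, and the two
  edges at \<open>c0\<close> receive common neighbours \<open>p1\<close>, \<open>p4\<close> in
  \<open>I\<close>. Of the total weight 13, vertices outside \<open>I\<close> miss 7 by the spindle.
  Vertices of \<open>I\<close> miss 5: the three chosen ones by independence and a pentagon vertex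
  since there is no 5-wheel. With \<open>card I \<le> m\<close> this gives exactly
  \<open>7 * card V \<le> 15 * m\<close>.\<close>

lemma no_pentagon_aux:
  assumes out: "c0 \<notin> I" "c1 \<notin> I" "c2 \<notin> I" "c3 \<notin> I" "c4 \<notin> I"
    and cyc: "A c0 c1" "A c1 c2" "A c2 c3" "A c3 c4" "A c4 c0"
    and p0: "p0 \<in> I" "A p0 c1" "A p0 c2" "A p0 c3" "A p0 c4"
  shows False
proof -
  obtain p1 where p1: "p1 \<in> I" "A p1 c0" "A p1 c1"
    using common_neighbour_in_I[of c0 c1] cyc out by blast
  obtain p4 where p4: "p4 \<in> I" "A p4 c0" "A p4 c4"
    using common_neighbour_in_I[of c4 c0] cyc out by blast
  note adj = cyc p0(2-) p1(2-) p4(2-)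
  let ?ws = "[(2, c0), (2, c1), (2, c2), (2, c3), (2, c4), (1, p0), (1, p1), (1, p4)]"
  have W5: "W5_free A" using W5_free_if_odd_wheel_free odd_wheel_free by blast
  have "7 * card V \<le> sum_list (map fst ?ws) * m + (7 - 5) * card I"
  proof (rule weight_bound[OF I_subset])
    show "snd ` set ?ws \<subseteq> V" using adj in_V in_V2 by auto
    show "5 \<le> miss A ?ws p" if "p \<in> I" for p
    proof -
      have "\<not> A p p0" "\<not> A p p1" "\<not> A p p4" using I_independent that p0 p1 p4 by blast+
      moreover have "\<not> (A p c0 \<and> A p c1 \<and> A p c2 \<and> A p c3 \<and> A p c4)"
        using W5_freeD[OF W5, of c0 c1 c2 c3 c4 p] cyc by blast
      ultimately show ?thesis by (auto simp: miss_def)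
    qed
    show "7 \<le> miss A ?ws p" if "p \<in> V" "p \<notin> I" for p
    proof -
      have "\<not> (A p c0 \<and> A p c1)" "\<not> (A p c1 \<and> A p c2)" "\<not> (A p c2 \<and> A p c3)"
        "\<not> (A p c3 \<and> A p c4)" "\<not> (A p c4 \<and> A p c0)"
        using no_triangle[of p] that out cyc by blast+
      moreover have "\<not> (A p c0 \<and> A p c2 \<and> A p p4)"
        using moser_freeD[OF moser_free, of c4 c0 p4 p p0 c3 c2] adj by (auto simp: adj_commute)
      moreover have "\<not> (A p c0 \<and> A p c3 \<and> A p p1)"
        using moser_freeD[OF moser_free, of c1 c0 p1 p p0 c2 c3] adj by (auto simp: adj_commute)
      moreover have "\<not> (A p c1 \<and> A p c3 \<and> A p p0 \<and> A p p1)"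
        using moser_freeD[OF moser_free, of p c1 p1 c0 c3 p0 c4] adj by (auto simp: adj_commute)
      moreover have "\<not> (A p c2 \<and> A p c4 \<and> A p p0 \<and> A p p4)"
        using moser_freeD[OF moser_free, of p c4 p4 c0 c2 p0 c1] adj by (auto simp: adj_commute)
      moreover have "\<not> (A p c1 \<and> A p c4 \<and> A p p0)"
        using moser_freeD[OF moser_free, of p c1 p0 c2 c4 p0 c3] adj by (auto simp: adj_commute)
      ultimately show ?thesis unfolding miss_Cons miss_Nil by (simp split: if_split; satx)
    qed
  qed simp
  then show False using card_I dense by simp
qed

text \<open>If each vertex of \<open>I\<close> missed two vertices of the pentagon, unit weights
  would give \<open>3 * card V \<le> 6 * m\<close>. So some vertex of \<open>I\<close> sees four of
  the five, and a rotation of the pentagon brings \<open>no_pentagon_aux\<close> into play.\<close>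

lemma no_pentagon:
  assumes out: "c0 \<notin> I" "c1 \<notin> I" "c2 \<notin> I" "c3 \<notin> I" "c4 \<notin> I"
    and cyc: "A c0 c1" "A c1 c2" "A c2 c3" "A c3 c4" "A c4 c0"
  shows False
proof -
  let ?ws = "[(1, c0), (1, c1), (1, c2), (1, c3), (1, c4)]"
  have "\<exists>p\<in>I. miss A ?ws p < 2"
  proof (rule ccontr)
    assume *: "\<not> ?thesis"
    have "3 * card V \<le> sum_list (map fst ?ws) * m + (3 - 2) * card I"
    proof (rule weight_bound[OF I_subset])
      show "snd ` set ?ws \<subseteq> V" using cyc in_V in_V2 by auto
      show "2 \<le> miss A ?ws p" if "p \<in> I" for p
      proof -
        have "\<not> miss A ?ws p < 2" using * that by blast
        then show ?thesis by linarith
      qed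
      show "3 \<le> miss A ?ws p" if "p \<in> V" "p \<notin> I" for p
      proof -
        have "\<not> (A p c0 \<and> A p c1)" "\<not> (A p c1 \<and> A p c2)" "\<not> (A p c2 \<and> A p c3)"
          "\<not> (A p c3 \<and> A p c4)" "\<not> (A p c4 \<and> A p c0)"
          using no_triangle[of p] that out cyc by blast+
        then show ?thesis unfolding miss_Cons miss_Nil by (simp split: if_split; satx)
      qed
    qed simp
    then show False using card_I dense by simp
  qed
  then obtain p where p: "p \<in> I" "miss A ?ws p < 2" by blast
  have "(A p c1 \<and> A p c2 \<and> A p c3 \<and> A p c4) \<or> (A p c2 \<and> A p c3 \<and> A p c4 \<and> A p c0) \<or>
    (A p c3 \<and> A p c4 \<and> A p c0 \<and> A p c1) \<or> (A p c4 \<and> A p c0 \<and> A p c1 \<and> A p c2) \<or>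
    (A p c0 \<and> A p c1 \<and> A p c2 \<and> A p c3)"
    using p(2) by (auto split: if_splits)
  then show False
    using no_pentagon_aux[of c0 c1 c2 c3 c4 p] no_pentagon_aux[of c1 c2 c3 c4 c0 p]
      no_pentagon_aux[of c2 c3 c4 c0 c1 p] no_pentagon_aux[of c3 c4 c0 c1 c2 p]
      no_pentagon_aux[of c4 c0 c1 c2 c3 p] out cyc p(1) by blast
qed

end

text \<open>Steps of two arrange the residues modulo 7 in a 7-cycle, in which the selected indices
  are independent. The maximal independent sets of this cycle are the seven rotations of
  \<open>{0, 3, 4}\<close>.\<close>

lemma two_apart_free_index:
  fixes e :: "nat \<Rightarrow> bool"
  assumes "\<And>i. i < 7 \<Longrightarrow> \<not> (e i \<and> e ((i + 2) mod 7))"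
  shows "\<exists>i<7. \<forall>k<7. e k \<longrightarrow> k = i \<or> k = (i + 3) mod 7 \<or> k = (i + 4) mod 7"
proof -
  have bools: "\<lbrakk>\<not> (b0 \<and> b2); \<not> (b1 \<and> b3); \<not> (b2 \<and> b4); \<not> (b3 \<and> b5); \<not> (b4 \<and> b6); \<not> (b5 \<and> b0);
      \<not> (b6 \<and> b1)\<rbrakk> \<Longrightarrow>
    (\<not> b1 \<and> \<not> b2 \<and> \<not> b5 \<and> \<not> b6) \<or> (\<not> b2 \<and> \<not> b3 \<and> \<not> b6 \<and> \<not> b0) \<or> (\<not> b3 \<and> \<not> b4 \<and> \<not> b0 \<and> \<not> b1) \<or>
    (\<not> b4 \<and> \<not> b5 \<and> \<not> b1 \<and> \<not> b2) \<or> (\<not> b5 \<and> \<not> b6 \<and> \<not> b2 \<and> \<not> b3) \<or> (\<not> b6 \<and> \<not> b0 \<and> \<not> b3 \<and> \<not> b4) \<or>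
    (\<not> b0 \<and> \<not> b1 \<and> \<not> b4 \<and> \<not> b5)" for b0 b1 b2 b3 b4 b5 b6
    by satx
  have apart: "\<not> (e k \<and> e l)" if "k < 7" "l = (k + 2) mod 7" for k l
    using assms[OF that(1)] that(2) by simp
  have D: "\<not> (e 0 \<and> e 2)" "\<not> (e 1 \<and> e 3)" "\<not> (e 2 \<and> e 4)" "\<not> (e 3 \<and> e 5)" "\<not> (e 4 \<and> e 6)"
    "\<not> (e 5 \<and> e 0)" "\<not> (e 6 \<and> e 1)"
    by (rule apart; presburger)+
  have fin: "\<exists>i<7. \<forall>k<7. e k \<longrightarrow> k = i \<or> k = (i + 3) mod 7 \<or> k = (i + 4) mod 7"
    if "\<not> e a" "\<not> e b" "\<not> e c" "\<not> e d" "i < 7"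
      and all: "\<forall>k<7. k = a \<or> k = b \<or> k = c \<or> k = d \<or> k = i \<or> k = (i + 3) mod 7 \<or> k = (i + 4) mod 7"
    for a b c d i
    using that(1-5) all by blast
  show ?thesis using bools[OF D]
  proof (elim disjE conjE, goal_cases)
    case 1 then show ?case by (intro fin[of 1 2 5 6 0]; (assumption | presburger))
  next
    case 2 then show ?case by (intro fin[of 2 3 6 0 1]; (assumption | presburger))
  next
    case 3 then show ?case by (intro fin[of 3 4 0 1 2]; (assumption | presburger))
  next
    case 4 then show ?case by (intro fin[of 4 5 1 2 3]; (assumption | presburger))
  next
    case 5 then show ?case by (intro fin[of 5 6 2 3 4]; (assumption | presburger))
  next
    case 6 then show ?case by (intro fin[of 6 0 3 4 5]; (assumption | presburger))
  next
    case 7 then show ?case by (intro fin[of 0 1 4 5 6]; (assumption | presburger))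
  qed
qed

context independent_cover
begin

text \<open>Two counts are combined. On the whole cycle only the set \<open>E\<close> of vertices of
  \<open>I\<close> missing a single \<open>c k\<close> is cheap, and the exclusion of
  \<open>T_0\<close> without \<open>t\<close> confines these \<open>k\<close> to \<open>i\<close>,
  \<open>i + 3\<close>, \<open>i + 4\<close> for some \<open>i\<close>. On these three vertices only
  the set \<open>F\<close> of vertices of \<open>I\<close> seeing all of them is cheap, and
  \<open>F\<close> is disjoint from \<open>E\<close>.\<close>

lemma shortest_walk_7_impossible:
  assumes sh: "shortest_odd_walk (induced (V - I) A) 7 c"
  shows False
proof -
  let ?B = "induced (V - I) A"
  have walk: "closed_walk ?B 7 c" and min: "\<And>k c'. odd k \<Longrightarrow> closed_walk ?B k c' \<Longrightarrow> 7 \<le> k"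
    using sh by (auto simp: shortest_odd_walk_def)
  have step: "A (c i) (c (Suc i))" and out: "c i \<in> V" "c i \<notin> I" and per: "c (i + 7) = c i" for i
    using walk by (auto simp: closed_walk_def induced_def)
  have Bsym: "?B x y \<Longrightarrow> ?B y x" for x y using adj_sym by (auto simp: induced_def)
  have cmod: "c (i mod 7) = c i" for i using closed_walk_mod_eq[OF walk] .
  have B: "?B p (c i) \<longleftrightarrow> p \<in> V - I \<and> A p (c i)" for p i using out by (auto simp: induced_def)
  define ws where "ws = map (\<lambda>i. (1::nat, c i)) [0..<7]"
  have ws_V: "snd ` set ws \<subseteq> V" using out by (auto simp: ws_def)
  have ws_sum: "sum_list (map fst ws) = 7" unfolding ws_def One_nat_def by (rule sum_list_walk)
  have miss_out: "5 \<le> miss A ws p" if "p \<in> V" "p \<notin> I" for p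
  proof -
    have "card {i \<in> {..<7}. A p (c i)} \<le> 2"
      using shortest_odd_walk_card[OF sh Bsym, of p] that by (simp add: B)
    then show ?thesis unfolding ws_def miss_walk_eq by simp
  qed
  define M where "M i = {p \<in> I. \<forall>j<7. A p (c j) \<longleftrightarrow> j \<noteq> i}" for i
  define E where "E = (\<Union>i<7. M i)"
  have E_sub: "E \<subseteq> I" by (auto simp: E_def M_def)
  have wheel: "\<exists>j<7. \<not> A p (c j)" for p
  proof -
    have "closed_walk A 7 c" using walk by (rule closed_walk_mono) (simp add: induced_def)
    then obtain i where "\<not> A p (c i)" using odd_wheel_free odd_wheel_free_iff by (metis odd_numeral)
    then show ?thesis using cmod[of i] by (metis mod_less_divisor zero_less_numeral)
  qed
  have miss_card: "miss A ws p = card {i \<in> {..<7}. \<not> A p (c i)}" for p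
    unfolding ws_def miss_walk ..
  have miss_in: "1 \<le> miss A ws p" for p
  proof -
    have "{i \<in> {..<7}. \<not> A p (c i)} \<noteq> {}" using wheel[of p] by auto
    then have "card {i \<in> {..<7}. \<not> A p (c i)} \<noteq> 0" by (subst card_0_eq) auto
    then show ?thesis unfolding miss_card by linarith
  qed
  have miss_two: "2 \<le> miss A ws p" if "p \<in> I" "p \<notin> E" for p
  proof (rule ccontr)
    assume "\<not> ?thesis"
    then have "card {i \<in> {..<7}. \<not> A p (c i)} = 1" using miss_in[of p] unfolding miss_card by linarith
    then obtain i where i: "{i \<in> {..<7}. \<not> A p (c i)} = {i}" by (auto simp: card_1_singleton_iff)
    then have "i < 7" by auto
    moreover have "p \<in> M i" using i that by (auto simp: M_def)
    ultimately show False using that by (auto simp: E_def)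
  qed
  have card_le: "card I \<le> card V" "card E \<le> card I"
    using I_subset E_sub finite_V by (meson card_mono finite_subset)+
  have 1: "5 * (card V - card I) + 2 * (card I - card E) + 1 * card E \<le> 7 * m"
    using sum_le_miss[OF ws_V E_sub I_subset, of 5 2 1] miss_out miss_two miss_in ws_sum by auto
  have "\<not> (M i \<noteq> {} \<and> M ((i + 2) mod 7) \<noteq> {})" if "i < 7" for i
  proof
    assume "M i \<noteq> {} \<and> M ((i + 2) mod 7) \<noteq> {}"
    then obtain w u where w: "w \<in> M i" and u: "u \<in> M ((i + 2) mod 7)" by blast
    have "\<forall>l<7. A w (c l) \<longleftrightarrow> l \<noteq> i" using w by (simp add: M_def)
    then have "A w (c (j mod 7)) \<longleftrightarrow> j mod 7 \<noteq> i" for j by simp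
    then have wA: "A w (c j) \<longleftrightarrow> j mod 7 \<noteq> i" for j by (simp only: cmod)
    have "\<forall>l<7. A u (c l) \<longleftrightarrow> l \<noteq> (i + 2) mod 7" using u by (simp add: M_def)
    then have "A u (c (j mod 7)) \<longleftrightarrow> j mod 7 \<noteq> (i + 2) mod 7" for j by simp
    then have uA: "A u (c j) \<longleftrightarrow> j mod 7 \<noteq> (i + 2) mod 7" for j by (simp only: cmod)
    have e: "A (c (i + 1)) (c (i + 2))" "A (c (i + 2)) (c (i + 3))" "A (c (i + 3)) (c (i + 4))"
      "A (c (i + 4)) (c (i + 5))" "A (c (i + 5)) (c (i + 6))" "A (c (i + 6)) (c (i + 7))"
      "A (c (i + 7)) (c (i + 1))"
      using step[of "i + 1"] step[of "i + 2"] step[of "i + 3"] step[of "i + 4"] step[of "i + 5"]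
        step[of "i + 6"] step[of i] per[of i] by (simp_all add: eval_nat_numeral)
    have m: "(i + 1) mod 7 \<noteq> i" "(i + 2) mod 7 \<noteq> i" "(i + 3) mod 7 \<noteq> i" "(i + 4) mod 7 \<noteq> i"
      "(i + 5) mod 7 \<noteq> i" "(i + 6) mod 7 \<noteq> i" "(i + 1) mod 7 \<noteq> (i + 2) mod 7"
      "(i + 3) mod 7 \<noteq> (i + 2) mod 7" "(i + 4) mod 7 \<noteq> (i + 2) mod 7"
      "(i + 5) mod 7 \<noteq> (i + 2) mod 7" "(i + 6) mod 7 \<noteq> (i + 2) mod 7" "(i + 7) mod 7 \<noteq> (i + 2) mod 7"
      using \<open>i < 7\<close> by presburger+
    \<comment> \<open>Read the cycle from \<open>v0 = c (i + 1)\<close>: then \<open>u\<close>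
      misses \<open>v1 = c (i + 2)\<close>, and \<open>w\<close> misses
      \<open>v6 = c (i + 7) = c i\<close>.\<close>
    show False
      using T0m_freeD[OF T0m_free, of "c (i + 1)" "c (i + 2)" "c (i + 3)" "c (i + 4)" "c (i + 5)"
          "c (i + 6)" "c (i + 7)" u w] e m wA uA by simp
  qed
  then obtain i where i: "i < 7"
    "\<forall>k<7. M k \<noteq> {} \<longrightarrow> k = i \<or> k = (i + 3) mod 7 \<or> k = (i + 4) mod 7"
    using two_apart_free_index[of "\<lambda>k. M k \<noteq> {}"] by blast
  define F where "F = {p \<in> I. A p (c i) \<and> A p (c (i + 3)) \<and> A p (c (i + 4))}"
  have F_sub: "F \<subseteq> I" by (auto simp: F_def)
  let ?us = "[(1, c i), (1, c (i + 3)), (1, c (i + 4))]"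
  \<comment> \<open>A vertex outside \<open>I\<close> that sees \<open>c j\<close> and
    \<open>c (j + 1)\<close> or \<open>c (j + 3)\<close> would give a closed walk of length 3 or
    5.\<close>
  have short: "\<not> (?B p (c j) \<and> ?B p (c (j + d)))" if "d = 1 \<or> d = 3" for p j d
  proof
    assume "?B p (c j) \<and> ?B p (c (j + d))"
    then have "\<exists>c'. closed_walk ?B (d + 2) c'" by (intro walk_shortcut[OF walk]) (auto intro: Bsym)
    then show False using min[of "d + 2"] that by auto
  qed
  have "2 \<le> miss A ?us p" if "p \<in> V" "p \<notin> I" for p
  proof -
    have "\<not> (A p (c i) \<and> A p (c (i + 3)))" "\<not> (A p (c (i + 3)) \<and> A p (c (i + 4)))"
      "\<not> (A p (c i) \<and> A p (c (i + 4)))"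
      using short[of 3 p i] short[of 1 p "i + 3", unfolded add.assoc]
        short[of 3 p "i + 4", unfolded add.assoc] per[of i] that by (auto simp: B)
    then show ?thesis by auto
  qed
  moreover have "1 \<le> miss A ?us p" if "p \<in> I" "p \<notin> F" for p
    using that by (auto simp: F_def)
  ultimately have "2 * (card V - card I) + 1 * (card I - card F) + 0 * card F \<le>
      sum_list (map fst ?us) * m"
    using out F_sub I_subset by (intro sum_le_miss) auto
  then have 2: "2 * (card V - card I) + (card I - card F) \<le> 3 * m" by simp
  have "E \<inter> F = {}"
  proof (rule ccontr)
    assume "E \<inter> F \<noteq> {}"
    then obtain p k where p: "p \<in> F" "k < 7" "p \<in> M k" by (auto simp: E_def)
    then have "k = i \<or> k = (i + 3) mod 7 \<or> k = (i + 4) mod 7" using i by blast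
    then have "c k = c i \<or> c k = c (i + 3) \<or> c k = c (i + 4)" using cmod by metis
    moreover have "\<not> A p (c k)" using p by (auto simp: M_def)
    ultimately show False using p(1) by (auto simp: F_def)
  qed
  then have "card E + card F = card (E \<union> F)"
    using E_sub F_sub I_subset finite_V by (metis card_Un_disjoint finite_subset)
  also have "\<dots> \<le> card I"
    using E_sub F_sub I_subset finite_V by (meson Un_least card_mono finite_subset)
  finally have 3: "card E + card F \<le> card I" .
  have "card F \<le> card I" using 3 by linarith
  \<comment> \<open>Adding the first two bounds and inserting the third gives
    \<open>7 * card V \<le> 10 * m + 5 * card I\<close>, hence at most
    \<open>15 * m\<close>.\<close>
  show False using 1 2 3 card_le card_I dense by linarith
qed

text \<open>Vertices outside \<open>I\<close> miss all but two positions of a shortest walk,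
  vertices of \<open>I\<close> miss at least one as there are no odd wheels. The resulting ratio
  \<open>(2n - 3)/(n - 2)\<close> decreases in \<open>n\<close> and equals \<open>15/7\<close> at
  \<open>n = 9\<close>.\<close>

theorem no_odd_walk_outside: "no_odd_walk (induced (V - I) A)"
proof (rule ccontr)
  let ?B = "induced (V - I) A"
  assume "\<not> no_odd_walk ?B"
  then obtain n c where sh: "shortest_odd_walk ?B n c" using shortest_odd_walk_exists by blast
  then have walk: "closed_walk ?B n c" and "odd n" by (auto simp: shortest_odd_walk_def)
  have step: "A (c i) (c (Suc i))" and out: "c i \<in> V" "c i \<notin> I" and per: "c (i + n) = c i" for i
    using walk by (auto simp: closed_walk_def induced_def)
  have Bsym: "?B x y \<Longrightarrow> ?B y x" for x y using adj_sym by (auto simp: induced_def)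
  have "n \<noteq> 1" using step[of 0] per[of 0] irrefl by auto
  moreover have "n \<noteq> 3"
    using step[of 0] step[of 1] step[of 2] per[of 0] no_triangle[of "c 0" "c 1" "c 2"] out adj_sym
    by (auto simp: eval_nat_numeral)
  moreover have "n \<noteq> 5"
    using step[of 0] step[of 1] step[of 2] step[of 3] step[of 4] per[of 0]
      no_pentagon[of "c 0" "c 1" "c 2" "c 3" "c 4"] out
    by (auto simp: eval_nat_numeral)
  moreover have "n \<noteq> 7" using shortest_walk_7_impossible sh by blast
  ultimately have n: "n \<ge> 9" using \<open>odd n\<close> by presburger
  have "card I \<le> card V" using I_subset finite_V by (simp add: card_mono)
  define ws where "ws = map (\<lambda>i. (1::nat, c i)) [0..<n]"
  have "(n - 2) * card V \<le> sum_list (map fst ws) * m + (n - 2 - 1) * card I"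
  proof (rule weight_bound[OF I_subset])
    show "snd ` set ws \<subseteq> V" using out by (auto simp: ws_def)
    show "n - 2 \<le> miss A ws p" if "p \<in> V" "p \<notin> I" for p
    proof -
      have "?B p (c i) \<longleftrightarrow> A p (c i)" for i using out that by (auto simp: induced_def)
      then have "card {i \<in> {..<n}. A p (c i)} \<le> 2"
        using shortest_odd_walk_card[OF sh Bsym, of p] n by simp
      then show ?thesis unfolding ws_def miss_walk_eq by simp
    qed
    show "1 \<le> miss A ws p" if "p \<in> I" for p
    proof -
      have "closed_walk A n c" using walk by (rule closed_walk_mono) (simp add: induced_def)
      then obtain i where "\<not> A p (c i)" using odd_wheel_free odd_wheel_free_iff \<open>odd n\<close> by metis
      then have "i mod n \<in> {i \<in> {..<n}. \<not> A p (c i)}" using n closed_walk_mod_eq[OF walk, of i] by simp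
      then have "card {i \<in> {..<n}. \<not> A p (c i)} \<noteq> 0" by (subst card_0_eq) auto
      then show ?thesis unfolding ws_def miss_walk by linarith
    qed
    show "1 \<le> n - 2" using n by simp
  qed
  also have "sum_list (map fst ws) = n" unfolding ws_def One_nat_def by (rule sum_list_walk)
  finally have "(n - 2) * card V \<le> n * m + (n - 2 - 1) * card I" .
  moreover have "(n - 2 - 1) * card I \<le> (n - 3) * m" by (rule mult_le_mono) (use card_I in auto)
  ultimately have "(n - 2) * card V \<le> n * m + (n - 3) * m" by linarith
  moreover obtain k where k: "n = k + 9" using n le_Suc_ex by (metis add.commute)
  ultimately have "(k + 7) * card V \<le> (2 * k + 15) * m" by (simp add: algebra_simps)
  then have "7 * ((k + 7) * card V) \<le> (14 * k + 105) * m" by (simp add: algebra_simps)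
  also have "\<dots> \<le> (15 * k + 105) * m" by (intro mult_le_mono1) simp
  also have "\<dots> = (k + 7) * (15 * m)" by (simp add: algebra_simps)
  also have "\<dots> < (k + 7) * (7 * card V)" using dense by (intro mult_strict_left_mono) auto
  finally show False by simp
qed

end

section \<open>Links of cliques and the induction on the number of colours\<close>

definition nbhd :: "('a \<Rightarrow> 'a \<Rightarrow> bool) \<Rightarrow> 'a set \<Rightarrow> 'a set" where
  "nbhd A Z = {x. \<forall>z\<in>Z. A x z}"

text \<open>A relation on the same type, so that every predicate on adjacency applies to links and a
  link inside a link is a link again.\<close>

definition link :: "('a \<Rightarrow> 'a \<Rightarrow> bool) \<Rightarrow> 'a set \<Rightarrow> 'a \<Rightarrow> 'a \<Rightarrow> bool" where
  "link A Z = induced (nbhd A Z) A"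

lemma link_iff: "link A Z x y \<longleftrightarrow> A x y \<and> (\<forall>z\<in>Z. A x z \<and> A y z)"
  by (auto simp: link_def induced_def nbhd_def)

lemma link_empty [simp]: "link A {} = A"
  by (simp add: link_iff fun_eq_iff)

lemma link_link:
  assumes "Y \<subseteq> nbhd A Z"
  shows "link (link A Z) Y = link A (Z \<union> Y)"
  using assms by (auto simp: link_iff fun_eq_iff nbhd_def)

definition K_free :: "('a \<Rightarrow> 'a \<Rightarrow> bool) \<Rightarrow> nat \<Rightarrow> bool" where
  "K_free A n \<longleftrightarrow> (\<forall>K. clique A K \<longrightarrow> card K \<noteq> n)"

text \<open>In a proper colouring with \<open>s + 1\<close> colours the clique \<open>Q\<close> uses
  \<open>s\<close> of them, so \<open>u\<close> and \<open>v\<close> both receive the remaining one.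
  Hence \<open>RR_free A s\<close> is necessary for colourability with \<open>s + 1\<close>
  colours.\<close>

definition linked :: "('a \<Rightarrow> 'a \<Rightarrow> bool) \<Rightarrow> nat \<Rightarrow> 'a \<Rightarrow> 'a \<Rightarrow> bool" where
  "linked A s u v \<longleftrightarrow>
     (\<exists>Q. finite Q \<and> clique A Q \<and> card Q = s \<and> (\<forall>q\<in>Q. A u q \<and> A v q))"

text \<open>For \<open>s = 2\<close> the forbidden configuration is a homomorphic image of the Moser spindle,
  for \<open>s = 1\<close> a closed walk of length five.\<close>

definition RR_free :: "('a \<Rightarrow> 'a \<Rightarrow> bool) \<Rightarrow> nat \<Rightarrow> bool" where
  "RR_free A s \<longleftrightarrow> (\<forall>u v w. linked A s u v \<longrightarrow> linked A s u w \<longrightarrow> \<not> A v w)"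

section \<open>Cliques, common neighbourhoods and linked vertices\<close>

lemma clique_insert:
  assumes "clique A Q" and "\<And>q. q \<in> Q \<Longrightarrow> A x q \<and> A q x"
  shows "clique A (insert x Q)"
  using assms by (auto simp: clique_def)

lemma clique_subset: "clique A Q \<Longrightarrow> P \<subseteq> Q \<Longrightarrow> clique A P"
  by (auto simp: clique_def)

lemma card_clique_insert:
  assumes "finite Q" and "\<And>q. q \<in> Q \<Longrightarrow> A x q" and "\<And>x. \<not> A x x"
  shows "card (insert x Q) = Suc (card Q)"
  using assms by (metis card_insert_disjoint)

lemma ex_max_nat:
  fixes f :: "'b \<Rightarrow> nat"
  assumes "finite S" "S \<noteq> {}"
  shows "\<exists>p\<in>S. \<forall>q\<in>S. f q \<le> f p"
proof -
  have "Max (f ` S) \<in> f ` S" using assms by simp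
  then obtain p where "p \<in> S" "f p = Max (f ` S)" by auto
  then show ?thesis using assms by (metis Max_ge finite_imageI imageI)
qed

context dense_graph
begin

text \<open>In a clique on \<open>s + 2\<close> vertices, \<open>u\<close> is linked to
  \<open>v\<close> and to itself through the other \<open>s\<close> vertices, although
  \<open>u\<close> and \<open>v\<close> are adjacent.\<close>

lemma K_free_if_RR_free:
  assumes "RR_free A s"
  shows "K_free A (s + 2)"
  unfolding K_free_def
proof (intro allI impI notI)
  fix K assume K: "clique A K" "card K = s + 2"
  then obtain u where u: "u \<in> K" by fastforce
  have fK: "finite K" using K by (metis add_2_eq_Suc' card.infinite nat.distinct(1))
  have "card (K - {u}) = s + 1" using K u fK by simp
  then obtain v where v: "v \<in> K" "v \<noteq> u" by (metis Diff_iff add_gr_0 card_gt_0_iff ex_in_conv insertI1 less_one)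
  define Q where "Q = K - {u, v}"
  have Q: "finite Q" "clique A Q" "card Q = s" "\<forall>q\<in>Q. A u q \<and> A v q"
    using K u v fK by (auto simp: Q_def clique_def card_Diff_subset)
  then have "linked A s u v" "linked A s u u" unfolding linked_def by blast+
  then have "\<not> A v u" using assms by (auto simp: RR_free_def)
  then show False using K u v by (auto simp: clique_def)
qed

lemma link_dense_graph:
  "dense_graph (N Z) (link A Z) m"
proof -
  have "link A Z = induced (N Z) A"
    using in_V in_V2 by (auto simp: link_iff induced_def N_def fun_eq_iff)
  then show ?thesis using dense_graph_induced[OF N_subset] by simp
qed

lemma N_eq_nbhd: "N Z = V \<inter> nbhd A Z"
  by (auto simp: N_def nbhd_def)

lemma card_N_union:
  assumes "Z \<subseteq> V"
  shows "card (N Y) \<le> card (N (Y \<union> Z)) + card Z * m"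
proof -
  have fZ: "finite Z" using assms finite_V finite_subset by blast
  then show ?thesis using assms
  proof (induction Z)
    case (insert z Z)
    have "N (Y \<union> Z) \<subseteq> N (Y \<union> insert z Z) \<union> {p \<in> V. \<not> A p z}" by (auto simp: N_def)
    then have "card (N (Y \<union> Z)) \<le> card (N (Y \<union> insert z Z) \<union> {p \<in> V. \<not> A p z})"
      by (rule card_mono[rotated]) (simp add: finite_V)
    also have "\<dots> \<le> card (N (Y \<union> insert z Z)) + card {p \<in> V. \<not> A p z}" by (rule card_Un_le)
    also have "\<dots> \<le> card (N (Y \<union> insert z Z)) + m" using insert.prems missed[of z] by simp
    finally show ?case using insert by simp
  qed simp
qed

text \<open>A clique on fewer than \<open>card V / m\<close> vertices has a common neighbour. The
  last vertex is added to a clique on \<open>card Y + t - 1\<close> vertices, whence the summand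
  \<open>m\<close> on the right.\<close>

lemma extend_clique:
  assumes "Y \<subseteq> V" "clique A Y" and "(card Y + t) * m < card V + m"
  shows "\<exists>Z. Y \<subseteq> Z \<and> Z \<subseteq> V \<and> clique A Z \<and> card Z = card Y + t"
  using assms(3)
proof (induction t)
  case (Suc t)
  then obtain Z where Z: "Y \<subseteq> Z" "Z \<subseteq> V" "clique A Z" "card Z = card Y + t" by auto
  have "card V \<le> card (N Z) + card Z * m" by (rule card_N) fact
  moreover have "card Z * m < card V" using Suc.prems Z(4) by simp
  ultimately have "N Z \<noteq> {}" by auto
  then obtain p where p: "p \<in> V" "\<And>z. z \<in> Z \<Longrightarrow> A p z" by (auto simp: N_def)
  have fZ: "finite Z" using Z(2) finite_V finite_subset by blast
  have "clique A (insert p Z)" by (rule clique_insert[OF Z(3)]) (use p adj_sym in blast)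
  moreover have "card (insert p Z) = Suc (card Z)"
    by (rule card_clique_insert[where A = A]) (use p irrefl fZ in blast)+
  ultimately show ?case using Z p(1) by (intro exI[of _ "insert p Z"]) auto
qed (use assms in auto)

lemma clique_Un_link:
  assumes "clique A Z" "clique (link A Z) Y" "Y \<subseteq> N Z"
  shows "clique A (Z \<union> Y)"
  unfolding clique_def
proof (intro ballI impI)
  fix x y assume xy: "x \<in> Z \<union> Y" "y \<in> Z \<union> Y" "x \<noteq> y"
  have Y: "A x y" if "x \<in> Y" "y \<in> Z" for x y using that assms(3) by (auto simp: N_def)
  show "A x y"
    using xy Y adj_sym assms(1,2) unfolding clique_def link_iff by blast
qed

lemma card_Un_link:
  assumes "Z \<subseteq> V" "Y \<subseteq> N Z"
  shows "card (Z \<union> Y) = card Z + card Y"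
proof (rule card_Un_disjoint)
  show "finite Z" "finite Y" using assms finite_V finite_subset finite_N by metis+
  show "Z \<inter> Y = {}" using assms N_disjoint by blast
qed

text \<open>Joining \<open>Z\<close> to a clique of its link raises its size by
  \<open>card Z\<close>. Positivity of \<open>s\<close> supplies an element of that clique, and
  adjacency to it in the link shows that the two linked vertices are joined to
  \<open>Z\<close>.\<close>

lemma RR_free_link:
  assumes "RR_free A (s + card Z)" "clique A Z" "finite Z" "s > 0"
  shows "RR_free (link A Z) s"
  unfolding RR_free_def
proof (intro allI impI notI)
  fix u v w
  assume uv: "linked (link A Z) s u v" and uw: "linked (link A Z) s u w" and vw: "link A Z v w"
  have *: "linked A (s + card Z) x y" if xy: "linked (link A Z) s x y" for x y
  proof -
    obtain Q where Q: "finite Q" "clique (link A Z) Q" "card Q = s"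
      "\<forall>q\<in>Q. link A Z x q \<and> link A Z y q" using xy by (auto simp: linked_def)
    have "Q \<noteq> {}" using Q \<open>s > 0\<close> by auto
    then have xyZ: "\<forall>z\<in>Z. A x z \<and> A y z" using Q(4) by (auto simp: link_iff)
    have sub: "Q \<subseteq> N Z" using Q(4) in_V2 by (auto simp: link_iff N_def)
    have "clique A (Z \<union> Q)" by (rule clique_Un_link) fact+
    moreover have "Z \<inter> Q = {}" using sub N_disjoint by blast
    then have "card (Z \<union> Q) = s + card Z"
      using card_Un_disjoint[OF \<open>finite Z\<close> Q(1)] Q(3) by simp
    moreover have "\<forall>q\<in>Z \<union> Q. A x q \<and> A y q" using xyZ Q(4) by (auto simp: link_iff)
    ultimately show ?thesis unfolding linked_def using Q(1) \<open>finite Z\<close> by (meson finite_UnI)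
  qed
  have "A v w" using vw by (simp add: link_iff)
  then show False using assms(1) *[OF uv] *[OF uw] unfolding RR_free_def by blast
qed

lemma moser_free_if_RR_free:
  assumes "RR_free A 2"
  shows "moser_free A"
  unfolding moser_free_def
proof (intro allI notI)
  fix u a b v c d w
  assume adj: "A u a \<and> A u b \<and> A a b \<and> A v a \<and> A v b \<and> A u c \<and> A u d \<and> A c d \<and>
    A w c \<and> A w d \<and> A v w"
  have "linked A 2 x y" if "A p q" "A x p" "A x q" "A y p" "A y q" for x y p q
  proof -
    have "p \<noteq> q" using that irrefl by blast
    then show ?thesis unfolding linked_def
      by (intro exI[of _ "{p, q}"]) (use that adj_sym in \<open>auto simp: clique_def\<close>)
  qed
  then have "linked A 2 u v" "linked A 2 u w" using adj by blast+
  then show False using assms adj unfolding RR_free_def by blast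
qed

lemma RR_free_if_moser_free:
  assumes "moser_free A"
  shows "RR_free A 2"
  unfolding RR_free_def
proof (intro allI impI notI)
  fix u v w assume l: "linked A 2 u v" "linked A 2 u w" "A v w"
  obtain Q where Q: "clique A Q" "card Q = 2" "\<forall>q\<in>Q. A u q \<and> A v q"
    using l(1) by (auto simp: linked_def)
  obtain a b where ab: "Q = {a, b}" "a \<noteq> b" using Q(2) by (auto simp: card_2_iff)
  obtain P where P: "clique A P" "card P = 2" "\<forall>q\<in>P. A u q \<and> A w q"
    using l(2) by (auto simp: linked_def)
  obtain c d where cd: "P = {c, d}" "c \<noteq> d" using P(2) by (auto simp: card_2_iff)
  show False
    using moser_freeD[OF assms, of u a b v c d w] Q P ab cd l(3) by (auto simp: clique_def)
qed

lemma RR_free_1_if_no_odd_walk: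
  assumes "no_odd_walk A"
  shows "RR_free A 1"
  unfolding RR_free_def
proof (intro allI impI notI)
  fix u v w assume l: "linked A 1 u v" "linked A 1 u w" "A v w"
  obtain a where a: "A u a" "A v a" using l(1) by (auto simp: linked_def card_1_singleton_iff)
  obtain b where b: "A u b" "A w b" using l(2) by (auto simp: linked_def card_1_singleton_iff)
  define f where "f i = [u, a, v, w, b] ! i" for i
  have cases5: "i < 5 \<Longrightarrow> i = 0 \<or> i = 1 \<or> i = 2 \<or> i = 3 \<or> i = 4" for i :: nat by linarith
  have "closed_walk A 5 (\<lambda>i. f (i mod 5))"
    by (rule closed_walk_mod) (use a b l adj_sym in \<open>auto simp: f_def dest!: cases5\<close>)
  then show False using assms by (auto simp: no_odd_walk_def)
qed

text \<open>One step of the induction on \<open>s\<close>: a vertex with at most two non-neighbours in a forbidden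
  configuration for \<open>s\<close> sees one for \<open>s - 1\<close>.\<close>

lemma RR_free_step:
  assumes "I \<subseteq> V" and "s \<ge> 1"
    and K: "K_free (induced (V - I) A) (Suc s + 2)"
    and ind: "\<And>p. p \<in> V - I \<Longrightarrow> RR_free (link (induced (V - I) A) {p}) s"
    and out: "I = {} \<or> RR_free A (Suc (Suc s))"
    and dense: "(2 * s + 5) * m + 2 * card I < 3 * card V"
  shows "RR_free (induced (V - I) A) (Suc s)"
  unfolding RR_free_def
proof (intro allI impI notI)
  let ?B = "induced (V - I) A"
  fix u v w assume l: "linked ?B (Suc s) u v" "linked ?B (Suc s) u w" "?B v w"
  obtain Q where Q: "finite Q" "clique ?B Q" "card Q = Suc s" "\<forall>q\<in>Q. ?B u q \<and> ?B v q"
    using l(1) by (auto simp: linked_def)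
  obtain P where P: "finite P" "clique ?B P" "card P = Suc s" "\<forall>q\<in>P. ?B u q \<and> ?B w q"
    using l(2) by (auto simp: linked_def)
  have Bsym: "?B x y \<Longrightarrow> ?B y x" for x y using adj_sym by (auto simp: induced_def)
  obtain qs where qs: "set qs = Q" "distinct qs" using Q(1) finite_distinct_list by blast
  obtain ps where ps: "set ps = P" "distinct ps" using P(1) finite_distinct_list by blast
  define ws where "ws = map (Pair (1::nat)) qs @ map (Pair 1) ps @ [(1, u), (1, v), (1, w)]"
  have miss: "miss A ws p = card {x \<in> Q. \<not> A p x} + card {x \<in> P. \<not> A p x} +
      ((if A p u then 0 else 1) + (if A p v then 0 else 1) + (if A p w then 0 else 1))" for p
    using qs ps miss_map_const[of qs A 1 p] miss_map_const[of ps A 1 p] by (simp add: ws_def)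
  have "Q \<noteq> {}" using Q by auto
  then have mem: "u \<in> V - I" "v \<in> V - I" "w \<in> V - I" "Q \<subseteq> V - I" "P \<subseteq> V - I"
    using Q(4) P(4) l(3) by (auto simp: induced_def)
  have "sum_list (map fst ws) = length qs + length ps + 3" by (simp add: ws_def o_def sum_list_triv)
  then have sum: "sum_list (map fst ws) = 2 * s + 5"
    using qs(1) ps(1) Q(3) P(3) distinct_card[OF qs(2)] distinct_card[OF ps(2)] by simp
  have no_K: "\<not> ?B p x" if "p \<in> V - I" "{x \<in> R. \<not> A p x} = {}" "clique ?B R" "finite R"
    "card R = Suc s" "R \<subseteq> V - I" "\<forall>q\<in>R. ?B x q" for p x R
  proof
    assume px: "?B p x"
    have "clique ?B (insert x R)" by (rule clique_insert) (use that Bsym in blast)+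
    then have "clique ?B (insert p (insert x R))"
      by (rule clique_insert) (use that px Bsym in \<open>auto simp: induced_def\<close>)
    moreover have "card (insert x R) = Suc (Suc s)"
      using card_clique_insert[of R ?B x] that irrefl by (auto simp: induced_def)
    moreover have "card (insert p (insert x R)) = Suc (card (insert x R))"
      by (rule card_clique_insert[where A = ?B]) (use that px irrefl in \<open>auto simp: induced_def\<close>)
    ultimately show False using K unfolding K_free_def by (metis add_2_eq_Suc')
  qed
  have "3 * card V \<le> sum_list (map fst ws) * m + (3 - 1) * card I"
  proof (rule weight_bound[OF \<open>I \<subseteq> V\<close>])
    show "snd ` set ws \<subseteq> V" using mem qs ps by (auto simp: ws_def)
    show "1 \<le> miss A ws p" if "p \<in> I" for p
    proof (rule ccontr)
      assume "\<not> ?thesis"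
      then have "card {x \<in> Q. \<not> A p x} = 0" "card {x \<in> P. \<not> A p x} = 0" and pu: "A p u" "A p v" "A p w"
        unfolding miss by (auto split: if_splits)
      then have all: "\<forall>x\<in>Q. A p x" "\<forall>x\<in>P. A p x" using Q(1) P(1) by auto
      \<comment> \<open>A vertex of \<open>I\<close> joined to the whole configuration can be added
        to both cliques, which yields the forbidden configuration one size larger in
        \<open>A\<close>.\<close>
      have *: "linked A (Suc (Suc s)) u x" if "clique ?B R" "finite R" "card R = Suc s"
        "\<forall>q\<in>R. ?B u q \<and> ?B x q" "A p x" "\<forall>x\<in>R. A p x" for x R
        unfolding linked_def
      proof (intro exI[of _ "insert p R"] conjI)
        show "clique A (insert p R)"
          by (rule clique_insert) (use that adj_sym in \<open>auto simp: clique_def induced_def\<close>)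
        have "card (insert p R) = Suc (card R)"
          by (rule card_clique_insert[where A = A]) (use that irrefl in auto)
        then show "card (insert p R) = Suc (Suc s)" using that(3) by simp
        show "\<forall>q\<in>insert p R. A u q \<and> A x q" using that pu adj_sym by (auto simp: induced_def)
      qed (use that in simp)
      have "RR_free A (Suc (Suc s))" using out \<open>p \<in> I\<close> by blast
      moreover have "A v w" using l(3) by (simp add: induced_def)
      ultimately show False
        using *[OF Q(2,1,3) Q(4)] *[OF P(2,1,3) P(4)] pu all unfolding RR_free_def by blast
    qed
    show "3 \<le> miss A ws p" if "p \<in> V" "p \<notin> I" for p
    proof (rule ccontr)
      assume less: "\<not> ?thesis"
      have pV: "p \<in> V - I" using that by blast
      have Bp: "?B p x \<longleftrightarrow> A p x" if "x \<in> V - I" for x using that pV by (auto simp: induced_def)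
      \<comment> \<open>A vertex outside \<open>I\<close> that sees all of \<open>Q\<close> misses
        both \<open>u\<close> and \<open>v\<close>, otherwise there would be a clique on
        \<open>s + 3\<close> vertices; similarly for \<open>P\<close>. So a vertex missing at most
        two entries misses exactly one in each clique and sees \<open>u\<close>, \<open>v\<close>,
        \<open>w\<close>.\<close>
      have Q0: "\<not> A p u \<and> \<not> A p v" if "{x \<in> Q. \<not> A p x} = {}"
        using no_K[OF pV that Q(2,1,3) mem(4)] Q(4) Bp mem by blast
      have P0: "\<not> A p u \<and> \<not> A p w" if "{x \<in> P. \<not> A p x} = {}"
        using no_K[OF pV that P(2,1,3) mem(5)] P(4) Bp mem by blast
      have Qc: "card {x \<in> Q. \<not> A p x} = 0 \<Longrightarrow> {x \<in> Q. \<not> A p x} = {}"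
        and Pc: "card {x \<in> P. \<not> A p x} = 0 \<Longrightarrow> {x \<in> P. \<not> A p x} = {}" using Q(1) P(1) by auto
      have "card {x \<in> Q. \<not> A p x} \<noteq> 0" "card {x \<in> P. \<not> A p x} \<noteq> 0"
        using less Q0[OF Qc] P0[OF Pc] unfolding miss by (auto split: if_splits)
      then have c1: "card {x \<in> Q. \<not> A p x} = 1" "card {x \<in> P. \<not> A p x} = 1"
        and pu: "A p u" "A p v" "A p w"
        using less unfolding miss by (auto split: if_splits)
      have *: "linked (link ?B {p}) s u x" if "clique ?B R" "finite R" "card R = Suc s"
        "\<forall>q\<in>R. ?B u q \<and> ?B x q" "A p x" "x \<in> V - I" "R \<subseteq> V - I" "card {x \<in> R. \<not> A p x} = 1" for x R
        unfolding linked_def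
      proof (intro exI[of _ "{x \<in> R. A p x}"] conjI)
        have "card R = card {x \<in> R. A p x} + card {x \<in> R. \<not> A p x}"
          using that(2) by (subst card_Un_disjoint[symmetric]) (auto intro: arg_cong[where f = card])
        then show "card {x \<in> R. A p x} = s" using that by simp
        show "clique (link ?B {p}) {x \<in> R. A p x}"
          using that Bp Bsym by (auto simp: clique_def link_iff)
        show "\<forall>q\<in>{x \<in> R. A p x}. link ?B {p} u q \<and> link ?B {p} x q"
          using that Bp Bsym pu mem by (auto simp: link_iff)
      qed (use that in simp)
      have "link ?B {p} v w" using l(3) pu Bp Bsym mem by (auto simp: link_iff)
      then show False
        using ind[OF pV] *[OF Q(2,1,3,4) pu(2) mem(2,4) c1(1)] *[OF P(2,1,3,4) pu(3) mem(3,5) c1(2)]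
        unfolding RR_free_def by blast
    qed
  qed simp
  then show False using dense sum by simp
qed

end

context dense_graph
begin

lemma clique_link_subset:
  assumes "clique (link A Z) K" "card K \<ge> 2"
  shows "K \<subseteq> N Z"
proof
  fix x assume "x \<in> K"
  have "K \<noteq> {x}" using assms(2) by auto
  then obtain y where "y \<in> K" "y \<noteq> x" using \<open>x \<in> K\<close> by blast
  then have "link A Z x y" using assms(1) \<open>x \<in> K\<close> by (auto simp: clique_def)
  then show "x \<in> N Z" using in_V by (auto simp: link_iff N_def)
qed

lemma K_free_link:
  assumes "K_free A (n + card Z)" "clique A Z" "Z \<subseteq> V" "n \<ge> 2"
  shows "K_free (link A Z) n"
  unfolding K_free_def
proof (intro allI impI notI)
  fix K assume K: "clique (link A Z) K" "card K = n"
  then have sub: "K \<subseteq> N Z" using clique_link_subset assms(4) by blast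
  then have "clique A (Z \<union> K)" "card (Z \<union> K) = n + card Z"
    using clique_Un_link[OF assms(2) K(1)] card_Un_link[OF assms(3)] K(2) by auto
  then show False using assms(1) by (auto simp: K_free_def)
qed

lemma induced_V: "induced V A = A"
  using in_V in_V2 by (auto simp: induced_def fun_eq_iff)

lemma singleton_clique: "clique A {p}"
  by (simp add: clique_def)

end

text \<open>Induction through links of single vertices, where \<open>k\<close> drops by one and at
  most \<open>m\<close> vertices are lost. The step is \<open>RR_free_step\<close> with
  \<open>I\<close> empty.\<close>

lemma RR_free_if_links_moser_free:
  assumes "dense_graph V A m" and "K_free A (k + 4)"
    and "\<And>Z. Z \<subseteq> V \<Longrightarrow> clique A Z \<Longrightarrow> card Z = k \<Longrightarrow> moser_free (link A Z)"
    and "(7 * k + 15) * m < 7 * card V"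
  shows "RR_free A (k + 2)"
  using assms
proof (induction k arbitrary: V A)
  case 0
  then show ?case
    using dense_graph.RR_free_if_moser_free[OF 0(1)] 0(3)[of "{}"] by (simp add: clique_def numeral_2_eq_2)
next
  case (Suc k)
  interpret dense_graph V A m by fact
  have "RR_free (induced (V - {}) A) (Suc (k + 2))"
  proof (rule RR_free_step)
    show "K_free (induced (V - {}) A) (Suc (k + 2) + 2)"
      using Suc.prems(2) by (simp add: induced_V eval_nat_numeral)
    show "(2 * (k + 2) + 5) * m + 2 * card {} < 3 * card V"
      using Suc.prems(4) by (simp add: algebra_simps)
    fix p assume "p \<in> V - {}"
    then have p: "{p} \<subseteq> V" by simp
    have "RR_free (link A {p}) (k + 2)"
    proof (rule Suc.IH[OF link_dense_graph[of "{p}"]])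
      show "K_free (link A {p}) (k + 4)"
        by (rule K_free_link) (use Suc.prems(2) p singleton_clique in auto)
      show "(7 * k + 15) * m < 7 * card (N {p})"
        using card_N[OF p] Suc.prems(4) by (simp add: algebra_simps)
      fix Z assume Z: "Z \<subseteq> N {p}" "clique (link A {p}) Z" "card Z = k"
      have "clique A ({p} \<union> Z)" using clique_Un_link[OF singleton_clique Z(2,1)] .
      moreover have "card ({p} \<union> Z) = Suc k" using card_Un_link[OF p Z(1)] Z(3) by simp
      moreover have "{p} \<union> Z \<subseteq> V" using p Z(1) N_subset by blast
      ultimately have "moser_free (link A ({p} \<union> Z))" using Suc.prems(3) by blast
      then show "moser_free (link (link A {p}) Z)"
        using link_link[of Z A "{p}"] Z(1) by (simp add: N_eq_nbhd)
    qed
    then show "RR_free (link (induced (V - {}) A) {p}) (k + 2)" by (simp add: induced_V)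
  qed auto
  then show ?case by (simp add: induced_V)
qed

text \<open>The induction takes links at vertices \<open>p\<close> outside \<open>I\<close>; the
  part of \<open>I\<close> in the neighbourhood of \<open>p\<close> is again independent, and
  \<open>RR_free A\<close> passes to the link with \<open>k\<close> lowered. At the bottom, the
  configuration for one colour less than the spindle is a closed walk of length five.\<close>

lemma RR_free_outside:
  assumes "dense_graph V A m" and "I \<subseteq> V" and "\<And>x y. x \<in> I \<Longrightarrow> y \<in> I \<Longrightarrow> \<not> A x y"
    and "K_free (induced (V - I) A) (k + 3)" and "RR_free A (k + 2)"
    and "\<And>Z. Z \<subseteq> V - I \<Longrightarrow> clique (induced (V - I) A) Z \<Longrightarrow> card Z = k \<Longrightarrow>
      no_odd_walk (link (induced (V - I) A) Z)"
    and "(7 * k + 15) * m < 7 * card V"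
  shows "RR_free (induced (V - I) A) (k + 1)"
  using assms
proof (induction k arbitrary: V A I)
  case 0
  interpret dense_graph V A m by fact
  have "dense_graph (V - I) (induced (V - I) A) m" by (rule dense_graph_induced) auto
  then show ?case
    using dense_graph.RR_free_1_if_no_odd_walk 0(6)[of "{}"] by (fastforce simp: clique_def)
next
  case (Suc k)
  interpret dense_graph V A m by fact
  let ?B = "induced (V - I) A"
  interpret B: dense_graph "V - I" ?B m by (rule dense_graph_induced) auto
  have "RR_free ?B (Suc (k + 1))"
  proof (rule RR_free_step[OF \<open>I \<subseteq> V\<close>])
    show "K_free ?B (Suc (k + 1) + 2)" using Suc.prems(4) by (simp add: eval_nat_numeral)
    show "I = {} \<or> RR_free A (Suc (Suc (k + 1)))" using Suc.prems(5) by simp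
    have "card I \<le> m" using card_independent Suc.prems(2,3) by blast
    then show "(2 * (k + 1) + 5) * m + 2 * card I < 3 * card V"
      using Suc.prems(7) by (simp add: algebra_simps)
    fix p assume p: "p \<in> V - I"
    then have pV: "{p} \<subseteq> V" by simp
    \<comment> \<open>Deleting \<open>I\<close> and passing to the link of \<open>p\<close>
      commute.\<close>
    have eq: "induced (N {p} - I \<inter> N {p}) (link A {p}) = link ?B {p}"
      using p in_V in_V2 by (auto simp: link_iff induced_def N_def fun_eq_iff)
    have BN: "B.N {p} \<subseteq> N {p}" using p by (auto simp: B.N_def N_def induced_def)
    have "RR_free (induced (N {p} - I \<inter> N {p}) (link A {p})) (k + 1)"
    proof (rule Suc.IH[OF link_dense_graph[of "{p}"]])
      show "\<not> link A {p} x y" if "x \<in> I \<inter> N {p}" "y \<in> I \<inter> N {p}" for x y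
        using Suc.prems(3) that by (auto simp: link_iff)
      show "K_free (induced (N {p} - I \<inter> N {p}) (link A {p})) (k + 3)"
        unfolding eq by (rule B.K_free_link) (use Suc.prems(4) p B.singleton_clique in auto)
      show "RR_free (link A {p}) (k + 2)"
        by (rule RR_free_link) (use Suc.prems(5) singleton_clique in auto)
      show "(7 * k + 15) * m < 7 * card (N {p})"
        using card_N[OF pV] Suc.prems(7) by (simp add: algebra_simps)
      fix Z assume Z: "Z \<subseteq> N {p} - I \<inter> N {p}"
        "clique (induced (N {p} - I \<inter> N {p}) (link A {p})) Z" "card Z = k"
      have sub: "Z \<subseteq> B.N {p}" using Z(1) p by (auto simp: B.N_def N_def induced_def)
      have "clique ?B ({p} \<union> Z)"
        using B.clique_Un_link[OF B.singleton_clique _ sub] Z(2) unfolding eq by blast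
      moreover have "card ({p} \<union> Z) = Suc k" using B.card_Un_link[OF _ sub] p Z(3) by simp
      moreover have "{p} \<union> Z \<subseteq> V - I" using p sub B.N_subset by blast
      ultimately have "no_odd_walk (link ?B ({p} \<union> Z))" using Suc.prems(6) by blast
      then show "no_odd_walk (link (induced (N {p} - I \<inter> N {p}) (link A {p})) Z)"
        unfolding eq using link_link[of Z ?B "{p}"] sub by (simp add: B.N_eq_nbhd)
    qed auto
    then show "RR_free (link ?B {p}) (k + 1)" unfolding eq .
  qed auto
  then show ?case by simp
qed

text \<open>Let \<open>X\<close> be a largest common neighbourhood of a clique on \<open>s\<close> vertices. The vertices without a
  neighbour in \<open>X\<close> are the desired set: a clique on \<open>s + 1\<close> vertices avoiding it, chosen with as many
  neighbours of some \<open>x \<in> X\<close> as possible, leads to too many non-neighbours of \<open>x\<close>.\<close>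

lemma (in dense_graph) independent_cover_exists:
  assumes RR: "RR_free A s" and "s \<ge> 2" and dense: "(7 * s + 1) * m < 7 * card V"
  shows "\<exists>I\<subseteq>V. (\<forall>x\<in>I. \<forall>y\<in>I. \<not> A x y) \<and> K_free (induced (V - I) A) (s + 1)"
proof -
  have K_free: "K_free A (s + 2)" using K_free_if_RR_free[OF RR] .
  obtain t where t: "s = t + 2" using \<open>s \<ge> 2\<close> by (auto simp: nat_le_iff_add)
  have dense': "s * m < card V" using dense by (simp add: algebra_simps)
  have finC: "finite {Q. Q \<subseteq> V \<and> P Q}" for P
    by (rule finite_subset[of _ "Pow V"]) (use finite_V in auto)
  have "\<exists>Z. {} \<subseteq> Z \<and> Z \<subseteq> V \<and> clique A Z \<and> card Z = card ({} :: 'a set) + s"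
    by (rule extend_clique) (use dense' in \<open>auto simp: clique_def\<close>)
  then have "{Q. Q \<subseteq> V \<and> clique A Q \<and> card Q = s} \<noteq> {}" by auto
  from ex_max_nat[OF finC this, of "\<lambda>Q. card (N Q)"]
  obtain Q where Q: "Q \<subseteq> V" "clique A Q" "card Q = s"
    and Qmax: "\<And>P. P \<subseteq> V \<Longrightarrow> clique A P \<Longrightarrow> card P = s \<Longrightarrow> card (N P) \<le> card (N Q)" by blast
  define X where "X = N Q"
  have fQ: "finite Q" using Q(1) finite_V finite_subset by blast
  have no_clique: "\<not> (clique A R \<and> card R = s + 2)" for R using K_free by (auto simp: K_free_def)
  have ext: "\<not> A x y" if "R \<subseteq> V" "clique A R" "card R = s" "x \<in> N R" "y \<in> N R" for R x y
  proof
    assume xy: "A x y"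
    have fR: "finite R" using that finite_V finite_subset by blast
    have "clique A (insert y R)" by (rule clique_insert) (use that adj_sym in \<open>auto simp: N_def\<close>)
    then have "clique A (insert x (insert y R))"
      by (rule clique_insert) (use that xy adj_sym in \<open>auto simp: N_def\<close>)
    moreover have "card (insert y R) = Suc s"
      using card_clique_insert[of R A y] fR that irrefl by (auto simp: N_def)
    then have "card (insert x (insert y R)) = s + 2"
      using card_clique_insert[of "insert y R" A x] fR that xy irrefl by (auto simp: N_def)
    ultimately show False using no_clique by blast
  qed
  have X_ind: "\<not> A x y" if "x \<in> X" "y \<in> X" for x y using ext[OF Q] that by (simp add: X_def)
  have X_V: "X \<subseteq> V" using N_subset by (simp add: X_def)
  have cardX: "card X \<le> m" using card_independent X_ind X_V by blast
  have "card V \<le> card X + s * m" using card_N[OF Q(1)] Q(3) by (simp add: X_def)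
  then have "X \<noteq> {}" using dense' by auto
  define I where "I = {w \<in> V. \<forall>x\<in>X. \<not> A w x}"
  have X_I: "X \<subseteq> I" using X_ind X_V by (auto simp: I_def)
  \<comment> \<open>Extend an edge \<open>w w'\<close> inside \<open>I\<close> to a clique on
    \<open>s\<close> vertices. By maximality its common neighbourhood is no larger than
    \<open>X\<close>, so \<open>w\<close> and \<open>w'\<close> have at most
    \<open>card X + (s - 2) * m\<close> common neighbours. As both miss all of \<open>X\<close>,
    together they miss at most \<open>2 * m - card X\<close> vertices. The sum \<open>s * m\<close>
    is less than \<open>card V\<close>.\<close>
  have I_ind: "\<not> A w w'" if "w \<in> I" "w' \<in> I" for w w'
  proof
    assume ww: "A w w'"
    have W: "{w, w'} \<subseteq> V" "clique A {w, w'}" "card {w, w'} = 2"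
      using that ww adj_sym irrefl by (auto simp: I_def clique_def card_insert_if)
    have "(card {w, w'} + t) * m < card V + m"
      using dense' by (simp add: W(3) t algebra_simps)
    then have "\<exists>Z. {w, w'} \<subseteq> Z \<and> Z \<subseteq> V \<and> clique A Z \<and> card Z = card {w, w'} + t"
      by (rule extend_clique[OF W(1,2)])
    then obtain Z where Z: "{w, w'} \<subseteq> Z" "Z \<subseteq> V" "clique A Z" "card Z = s"
      unfolding W(3) t by auto
    let ?Y = "Z - {w, w'}"
    have "card ?Y = card Z - card {w, w'}" by (rule card_Diff_subset) (use Z in auto)
    then have "card ?Y = t" unfolding W(3) Z(4) t by simp
    moreover have "?Y \<subseteq> V" using Z by blast
    moreover have "{w, w'} \<union> ?Y = Z" using Z by blast
    ultimately have 1: "card (N {w, w'}) \<le> card (N Z) + t * m"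
      using card_N_union[of ?Y "{w, w'}"] by simp
    have sm: "t * m + 2 * m = s * m" by (simp add: t algebra_simps)
    let ?U = "{p \<in> V. \<not> A p w}" and ?U' = "{p \<in> V. \<not> A p w'}"
    have fU: "finite ?U" "finite ?U'" using finite_V by auto
    have "V = N {w, w'} \<union> (?U \<union> ?U')" by (auto simp: N_def)
    then have "card V \<le> card (N {w, w'}) + card (?U \<union> ?U')" using card_Un_le by metis
    moreover have "X \<subseteq> ?U \<inter> ?U'" using that X_V adj_sym by (auto simp: I_def)
    then have "card X \<le> card (?U \<inter> ?U')" by (rule card_mono[rotated]) (use fU in simp)
    moreover have "card ?U + card ?U' = card (?U \<union> ?U') + card (?U \<inter> ?U')"
      by (rule card_Un_Int) (use fU in auto)
    moreover have "card ?U \<le> m" "card ?U' \<le> m" using missed W(1) by auto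
    moreover have "card (N Z) \<le> card X" using Qmax[OF Z(2-4)] by (simp add: X_def)
    ultimately show False using 1 sm dense' by linarith
  qed
  have I_V: "I \<subseteq> V" by (auto simp: I_def)
  let ?B = "induced (V - I) A"
  have "K_free ?B (s + 1)"
    unfolding K_free_def
  proof (intro allI impI notI)
    fix K0 assume K0: "clique ?B K0" "card K0 = s + 1"
    have outside: "K \<subseteq> V - I \<and> clique A K" if "clique ?B K" "card K = s + 1" for K
    proof -
      have "x \<in> V - I" if "x \<in> K" for x
      proof -
        have "K \<noteq> {x}" using \<open>card K = s + 1\<close> \<open>s \<ge> 2\<close> by auto
        then obtain y where "y \<in> K" "y \<noteq> x" using \<open>x \<in> K\<close> by blast
        then show ?thesis using \<open>clique ?B K\<close> \<open>x \<in> K\<close> by (auto simp: clique_def induced_def)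
      qed
      then show ?thesis using that by (auto simp: clique_def induced_def)
    qed
    \<comment> \<open>Vertex and clique are optimised simultaneously: both replacing
      \<open>x\<close> within \<open>X\<close> and exchanging a vertex of \<open>K\<close> will be
      compared with the optimum.\<close>
    define S where "S = {(x, K). x \<in> X \<and> K \<subseteq> V - I \<and> clique A K \<and> card K = s + 1}"
    define f where "f = (\<lambda>(x, K). card {a \<in> K. A x a})"
    have finS: "finite S"
      by (rule finite_subset[of _ "X \<times> Pow V"]) (use finite_V X_V finite_subset in \<open>auto simp: S_def\<close>)
    have "K0 \<noteq> {}" using K0(2) by auto
    then obtain a0 where a0: "a0 \<in> K0" by blast
    have "a0 \<in> V - I" using a0 outside[OF K0] by blast
    then obtain x0 where x0: "x0 \<in> X" "A a0 x0" by (auto simp: I_def)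
    have S0: "(x0, K0) \<in> S" using x0 outside[OF K0] K0 by (auto simp: S_def)
    have "finite K0" using K0 by (metis add_is_0 card.infinite zero_neq_one)
    then have f0: "f (x0, K0) \<ge> 1"
      using a0 x0 adj_sym by (auto simp: f_def Suc_le_eq card_gt_0_iff)
    obtain xK where xK: "xK \<in> S" "\<And>q. q \<in> S \<Longrightarrow> f q \<le> f xK"
      using ex_max_nat[OF finS, of f] S0 by blast
    obtain x K where "xK = (x, K)" by force
    then have x: "x \<in> X" and K: "K \<subseteq> V - I" "clique A K" "card K = s + 1"
      and fmax: "\<And>x' K'. x' \<in> X \<Longrightarrow> K' \<subseteq> V - I \<Longrightarrow> clique A K' \<Longrightarrow> card K' = s + 1 \<Longrightarrow>
        card {a \<in> K'. A x' a} \<le> card {a \<in> K. A x a}"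
      and j1: "card {a \<in> K. A x a} \<ge> 1"
      using xK xK(2)[OF S0] f0 by (auto simp: S_def f_def)
    define J where "J = {a \<in> K. A x a}"
    have fK: "finite K" using K(1) finite_V finite_subset by (metis finite_Diff)
    have JK: "J \<subseteq> K" by (auto simp: J_def)
    have clK: "A a b" if "a \<in> K" "b \<in> K" "a \<noteq> b" for a b using K(2) that by (auto simp: clique_def)
    have "card J \<noteq> s + 1"
    proof
      assume "card J = s + 1"
      then have "J = K" using JK K(3) fK by (metis card_subset_eq)
      then have ax: "\<forall>a\<in>K. A x a" by (auto simp: J_def)
      have "clique A (insert x K)" by (rule clique_insert[OF K(2)]) (use ax adj_sym in blast)
      moreover have "card (insert x K) = s + 2"
        using card_clique_insert[of K A x] fK ax irrefl K(3) by simp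
      ultimately show False using no_clique by blast
    qed
    \<comment> \<open>If \<open>x\<close> misses only \<open>a\<close> in \<open>K\<close>, then
      \<open>x\<close> is linked to \<open>a\<close> through \<open>J\<close> and to any
      \<open>x'\<close> in \<open>X\<close> through \<open>Q\<close>. As \<open>a\<close> is not in
      \<open>I\<close>, some such \<open>x'\<close> is adjacent to it.\<close>
    moreover have "card J \<noteq> s"
    proof
      assume cJ: "card J = s"
      then have "card (K - J) = 1" using JK fK K(3) by (simp add: card_Diff_subset finite_subset)
      then obtain a where a: "K - J = {a}" by (auto simp: card_1_singleton_iff)
      then have "a \<in> V - I" using K(1) by blast
      then obtain x' where x': "x' \<in> X" "A a x'" by (auto simp: I_def)
      have "A a b" if "b \<in> J" for b using clK[of a b] a that JK by blast
      moreover have "finite J" "clique A J" using JK fK K(2) finite_subset clique_subset by blast+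
      ultimately have "linked A s x a"
        unfolding linked_def using cJ by (intro exI[of _ J]) (auto simp: J_def)
      moreover have "linked A s x x'"
        unfolding linked_def using Q fQ x x'(1) by (intro exI[of _ Q]) (auto simp: X_def N_def)
      ultimately show False using RR x'(2) unfolding RR_free_def by blast
    qed
    moreover have "card J \<le> s + 1" using card_mono[OF fK JK] K(3) by simp
    ultimately have js: "card J + 1 \<le> s" by linarith
    \<comment> \<open>Every vertex misses some vertex of \<open>K\<close>, and those missing exactly
      one make up the sets \<open>P a\<close>. Each \<open>P a\<close> is the common neighbourhood
      of a clique on \<open>s\<close> vertices, hence no larger than \<open>X\<close>.\<close>
    define P where "P a = N (K - {a})" for a
    have cK: "K - {a} \<subseteq> V" "clique A (K - {a})" "card (K - {a}) = s" if "a \<in> K" for a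
      using K that fK clique_subset[OF K(2)] by auto
    have cardP: "card (P a) \<le> card X" if "a \<in> K" for a
      using Qmax[OF cK[OF that]] by (simp add: P_def X_def)
    define U where "U = (\<Union>a\<in>K. P a)"
    define U2 where "U2 = (\<Union>a\<in>K - J. P a)"
    have UV: "U \<subseteq> V" using N_subset by (auto simp: U_def P_def)
    obtain ks where ks: "set ks = K" "distinct ks" using fK finite_distinct_list by blast
    have missK: "miss A (map (Pair 1) ks) p = card {a \<in> K. \<not> A p a}" for p
      using miss_map_const[OF ks(2), of A 1 p] ks(1) by simp
    have "2 * (card V - card U) + 1 * (card U - card U) + 1 * card U \<le>
        sum_list (map fst (map (Pair 1) ks)) * m"
    proof (rule sum_le_miss)
      show "snd ` set (map (Pair 1) ks) \<subseteq> V" using ks(1) K(1) by auto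
      have m1: "1 \<le> card {a \<in> K. \<not> A p a}" for p
      proof (rule ccontr)
        assume "\<not> ?thesis"
        then have "{a \<in> K. \<not> A p a} = {}" using fK by (simp add: not_le)
        then have all: "\<forall>a\<in>K. A p a" by blast
        have "clique A (insert p K)" by (rule clique_insert[OF K(2)]) (use all adj_sym in blast)
        moreover have "card (insert p K) = s + 2"
          using card_clique_insert[of K A p] fK all irrefl K(3) by simp
        ultimately show False using no_clique by blast
      qed
      then have m2: "1 \<le> miss A (map (Pair 1) ks) p" for p unfolding missK .
      show "1 \<le> miss A (map (Pair 1) ks) p" "1 \<le> miss A (map (Pair 1) ks) p" for p by (rule m2)+
      show "2 \<le> miss A (map (Pair 1) ks) p" if p: "p \<in> V" "p \<notin> U" for p
      proof (rule ccontr)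
        assume "\<not> ?thesis"
        then have "card {a \<in> K. \<not> A p a} = 1" using m1[of p] unfolding missK by linarith
        then obtain a where "{a \<in> K. \<not> A p a} = {a}" by (auto simp: card_1_singleton_iff)
        then have "a \<in> K" "\<forall>b\<in>K - {a}. A p b" by blast+
        then have "p \<in> U" using p(1) by (auto simp: U_def P_def N_def)
        then show False using p(2) by blast
      qed
    qed (use UV in auto)
    moreover have "length ks = s + 1" using ks K(3) distinct_card by metis
    then have "sum_list (map fst (map (Pair (1::nat)) ks)) = s + 1" by (simp add: o_def sum_list_triv)
    moreover have "card U \<le> card V" using UV finite_V by (rule card_mono[rotated])
    ultimately have 1: "2 * card V \<le> (s + 1) * m + card U" by simp
    have "U = (\<Union>a\<in>J. P a) \<union> U2" using JK by (auto simp: U_def U2_def)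
    then have "card U \<le> card (\<Union>a\<in>J. P a) + card U2" using card_Un_le by metis
    moreover have "card (\<Union>a\<in>J. P a) \<le> (\<Sum>a\<in>J. card (P a))"
      using JK fK finite_subset by (intro card_UN_le) blast
    moreover have "\<dots> \<le> card J * card X"
      using sum_bounded_above[of J "\<lambda>a. card (P a)" "card X"] cardP JK by auto
    ultimately have 2: "card U \<le> card J * card X + card U2" by linarith
    \<comment> \<open>A vertex \<open>p\<close> of \<open>P a\<close> in \<open>X\<close> would
      itself see \<open>s\<close> vertices of \<open>K\<close>, more than \<open>x\<close> does. A
      neighbour \<open>p\<close> of \<open>x\<close> in \<open>P a\<close> lies outside
      \<open>I\<close>, and exchanging \<open>a\<close> for \<open>p\<close> in \<open>K\<close>
      would give \<open>x\<close> another neighbour.\<close>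
    have notP: "\<not> A x p \<and> p \<notin> X" if "p \<in> P a" "a \<in> K" "a \<notin> J" for p a
    proof -
      have p: "p \<in> V" "\<forall>b\<in>K - {a}. A p b" using that(1) by (auto simp: P_def N_def)
      have "p \<notin> X"
      proof
        assume "p \<in> X"
        then have "card {b \<in> K. A p b} \<le> card J" using fmax[of p K] K by (simp add: J_def)
        moreover have "card (K - {a}) \<le> card {b \<in> K. A p b}" using p fK by (intro card_mono) auto
        ultimately show False using cK(3)[OF that(2)] js by linarith
      qed
      moreover have "\<not> A x p"
      proof
        assume xp: "A x p"
        let ?K = "insert p (K - {a})"
        have "p \<notin> I" using xp x adj_sym by (auto simp: I_def)
        then have "?K \<subseteq> V - I" using p(1) K(1) by blast
        moreover have "clique A ?K"
          by (rule clique_insert[OF cK(2)[OF that(2)]]) (use p(2) adj_sym in blast)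
        moreover have "card ?K = s + 1"
          using card_clique_insert[of "K - {a}" A p] fK p(2) irrefl cK(3)[OF that(2)] by simp
        ultimately have "card {b \<in> ?K. A x b} \<le> card J"
          unfolding J_def using fmax[OF x, of ?K] by blast
        moreover have "insert p J \<subseteq> {b \<in> ?K. A x b}" using xp that by (auto simp: J_def)
        then have "card (insert p J) \<le> card {b \<in> ?K. A x b}"
          by (rule card_mono[rotated]) (use fK in simp)
        moreover have "p \<notin> J" using p(2) irrefl that JK by (metis Diff_iff singletonD subsetD)
        then have "card (insert p J) = Suc (card J)" using JK fK finite_subset by (metis card_insert_disjoint)
        ultimately show False by linarith
      qed
      ultimately show ?thesis by blast
    qed
    have U2_V: "U2 \<subseteq> V" using N_subset by (auto simp: U2_def P_def)
    have "X \<inter> U2 = {}" using notP by (auto simp: U2_def)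
    then have "card X + card U2 = card (X \<union> U2)"
      using X_V U2_V finite_V by (metis card_Un_disjoint finite_subset)
    also have "X \<union> U2 \<subseteq> {p \<in> V. \<not> A p x}"
    proof -
      have "\<not> A p x" if "p \<in> U2" for p using that notP adj_sym[of p x] by (auto simp: U2_def)
      then show ?thesis using X_V U2_V X_ind x by blast
    qed
    then have "card (X \<union> U2) \<le> card {p \<in> V. \<not> A p x}"
      by (rule card_mono[rotated]) (use finite_V in simp)
    also have "\<dots> \<le> m" using missed x X_V by blast
    finally have 3: "card X + card U2 \<le> m" .
    obtain j where j: "card J = Suc j" using j1 unfolding J_def[symmetric] by (cases "card J") auto
    \<comment> \<open>All of \<open>X\<close> and \<open>U2\<close> is missed by \<open>x\<close>,
      so one of the \<open>card J\<close> copies of \<open>card X\<close> fits together with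
      \<open>card U2\<close> into \<open>m\<close>. The others number at most \<open>s - 2\<close>,
      hence \<open>card U \<le> (s - 1) * m\<close> and
      \<open>2 * card V \<le> 2 * s * m\<close>.\<close>
    have arith: False
      if "2 * v \<le> sm + m + u" "u \<le> jx + x + u2" "x + u2 \<le> m" "jx \<le> tm" "tm + 2 * m = sm" "7 * sm + m < 7 * v"
      for v sm u jx x u2 tm :: nat
      using that by linarith
    show False
    proof (rule arith)
      show "2 * card V \<le> s * m + m + card U" using 1 by simp
      show "card U \<le> j * card X + card X + card U2" using 2 j by simp
      show "card X + card U2 \<le> m" by (rule 3)
      show "j * card X \<le> t * m" by (rule mult_le_mono) (use js j cardX t in auto)
      show "t * m + 2 * m = s * m" by (simp add: t algebra_simps)
      show "7 * (s * m) + m < 7 * card V" using dense by (simp add: algebra_simps)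
    qed
  qed
  then show ?thesis using I_V I_ind by blast
qed

text \<open>Each of the three conditions is necessary for \<open>r\<close>-colourability: vertices
  linked through an \<open>(r - 1)\<close>-clique share a colour, links of
  \<open>(r - 2)\<close>-cliques must be bipartite, and links of \<open>(r - 3)\<close>-cliques must
  be 3-colourable, which \<open>T_0\<close> without \<open>t\<close> is not. Under the density
  condition they are also sufficient.\<close>

definition locally_sparse :: "nat \<Rightarrow> 'a set \<Rightarrow> ('a \<Rightarrow> 'a \<Rightarrow> bool) \<Rightarrow> bool" where
  "locally_sparse r V A \<longleftrightarrow> RR_free A (r - 1) \<and>
     (\<forall>Z\<subseteq>V. clique A Z \<longrightarrow> card Z = r - 2 \<longrightarrow> no_odd_walk (link A Z)) \<and>
     (\<forall>Z\<subseteq>V. clique A Z \<longrightarrow> card Z = r - 3 \<longrightarrow> T0m_free (link A Z))"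

section \<open>Local sparsity after the deletion of an independent set\<close>

context dense_graph
begin

lemma odd_wheel_free_link:
  assumes "\<And>Y. Y \<subseteq> V \<Longrightarrow> clique A Y \<Longrightarrow> card Y = Suc (card Z) \<Longrightarrow> no_odd_walk (link A Y)"
    and "Z \<subseteq> V" "clique A Z"
  shows "odd_wheel_free (link A Z)"
  unfolding odd_wheel_free_def
proof
  fix v
  let ?R = "\<lambda>x y. link A Z x y \<and> link A Z v x \<and> link A Z v y"
  have fZ: "finite Z" using assms(2) finite_V finite_subset by blast
  show "no_odd_walk ?R"
  proof (cases "v \<in> N Z")
    case True
    have "clique A (insert v Z)"
      by (rule clique_insert) (use True assms(3) adj_sym in \<open>auto simp: N_def\<close>)
    moreover have "card (insert v Z) = Suc (card Z)"
      by (rule card_clique_insert[where A = A]) (use True fZ irrefl in \<open>auto simp: N_def\<close>)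
    moreover have "insert v Z \<subseteq> V" using True assms(2) N_subset by blast
    ultimately have "no_odd_walk (link A (insert v Z))" using assms(1) by blast
    then show ?thesis by (rule no_odd_walk_mono) (use adj_sym in \<open>auto simp: link_iff\<close>)
  next
    case False
    then have "\<not> link A Z v x" for x using in_V by (auto simp: N_def link_iff)
    then show ?thesis by (auto simp: no_odd_walk_def closed_walk_def)
  qed
qed

lemma clique_induced_iff:
  assumes "Z \<subseteq> S"
  shows "clique (induced S A) Z \<longleftrightarrow> clique A Z"
  using assms by (auto simp: clique_def induced_def)

text \<open>A vertex of \<open>I\<close> that sees the whole configuration would have it in its own
  link. So vertices of \<open>I\<close> miss at least 1 and the others at least 6 of the total
  weight 13, which gives \<open>6 * card V \<le> 13 * m + 5 * card I\<close>.\<close>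

lemma T0m_free_outside:
  assumes I: "I \<subseteq> V" and ind: "\<And>x y. x \<in> I \<Longrightarrow> y \<in> I \<Longrightarrow> \<not> A x y"
    and free: "odd_wheel_free (induced (V - I) A)" "moser_free (induced (V - I) A)"
    and T: "\<And>p. p \<in> I \<Longrightarrow> T0m_free (link A {p})"
    and dense: "18 * m < 6 * card V"
  shows "T0m_free (induced (V - I) A)"
  unfolding T0m_free_def
proof (intro allI notI)
  let ?B = "induced (V - I) A"
  interpret B: dense_graph "V - I" ?B m by (rule dense_graph_induced) auto
  note free' = B.K4_free_if_odd_wheel_free[OF free(1)] B.W5_free_if_odd_wheel_free[OF free(1)]
    B.W7_free_if_odd_wheel_free[OF free(1)] free(2)
  fix v0 v1 v2 v3 v4 v5 v6 u w
  let ?R = "\<lambda>A :: 'a \<Rightarrow> 'a \<Rightarrow> bool. A v0 v1 \<and> A v1 v2 \<and> A v2 v3 \<and> A v3 v4 \<and> A v4 v5 \<and> A v5 v6 \<and> A v6 v0 \<and>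
    A u v0 \<and> A u v2 \<and> A u v3 \<and> A u v4 \<and> A u v5 \<and> A u v6 \<and>
    A w v0 \<and> A w v1 \<and> A w v2 \<and> A w v3 \<and> A w v4 \<and> A w v5"
  assume adj: "?R ?B"
  let ?ws = "[(2, v0), (1, v1), (1, v2), (1, v3), (1, v4), (1, v5), (1, v6), (4, u), (1, w)]"
  have mem: "x \<in> V - I" if "x \<in> {v0, v1, v2, v3, v4, v5, v6, u, w}" for x
    using adj that B.in_V B.in_V2 by blast
  have "6 * card V \<le> sum_list (map fst ?ws) * m + (6 - 1) * card I"
  proof (rule weight_bound[OF I])
    show "snd ` set ?ws \<subseteq> V" using mem by auto
    show "6 \<le> miss A ?ws p" if "p \<in> V" "p \<notin> I" for p
    proof -
      have "?B p x \<longleftrightarrow> A p x" if "x \<in> {v0, v1, v2, v3, v4, v5, v6, u, w}" for x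
        using mem[OF that] \<open>p \<in> V\<close> \<open>p \<notin> I\<close> by (auto simp: induced_def)
      then have "miss A ?ws p = miss ?B ?ws p" by (simp add: miss_def)
      then show ?thesis using B.T0m_miss[OF free' adj, of p] by simp
    qed
    show "1 \<le> miss A ?ws p" if "p \<in> I" for p
    proof (rule ccontr)
      assume "\<not> ?thesis"
      then have "A p x" if "x \<in> {v0, v1, v2, v3, v4, v5, v6, u, w}" for x
        using that by (auto split: if_splits)
      moreover have "?R A" using adj by (simp add: induced_def)
      ultimately have "?R (link A {p})" using adj_sym by (simp add: link_iff)
      then show False using T0m_freeD[OF T[OF that]] by blast
    qed
  qed simp
  then show False using card_independent[OF I ind] dense by simp
qed

text \<open>Inside the link of \<open>Z\<close> the trace of \<open>I\<close> satisfies
  \<open>independent_cover\<close>: a triangle avoiding it would, together with \<open>Z\<close>,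
  form an \<open>r\<close>-clique outside \<open>I\<close>.\<close>

lemma no_odd_walk_link_outside:
  assumes sparse: "locally_sparse r V A" and r: "r \<ge> 3" and dense: "7 * card V > (7 * r - 6) * m"
    and I: "I \<subseteq> V" and ind: "\<And>x y. x \<in> I \<Longrightarrow> y \<in> I \<Longrightarrow> \<not> A x y"
    and K: "K_free (induced (V - I) A) r"
    and Z: "Z \<subseteq> V - I" "clique A Z" "card Z = r - 3"
  shows "no_odd_walk (link (induced (V - I) A) Z)"
proof -
  let ?B = "induced (V - I) A"
  have ZV: "Z \<subseteq> V" using Z by blast
  have fZ: "finite Z" using ZV finite_V finite_subset by blast
  interpret L: dense_graph "N Z" "link A Z" m by (rule link_dense_graph)
  interpret independent_cover "N Z" "link A Z" m "I \<inter> N Z"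
  proof
    show "\<not> link A Z x y" if "x \<in> I \<inter> N Z" "y \<in> I \<inter> N Z" for x y
      using ind that by (auto simp: link_iff)
    show "odd_wheel_free (link A Z)"
      by (rule odd_wheel_free_link) (use sparse r Z ZV in \<open>auto simp: locally_sparse_def\<close>)
    show "moser_free (link A Z)"
    proof (rule L.moser_free_if_RR_free, rule RR_free_link)
      have "r - 1 = 2 + card Z" using r Z by simp
      then show "RR_free A (2 + card Z)" using sparse by (simp add: locally_sparse_def)
    qed (use Z fZ in auto)
    show "T0m_free (link A Z)" using sparse Z ZV by (auto simp: locally_sparse_def)
    show "15 * m < 7 * card (N Z)"
    proof -
      obtain t where "r = t + 3" using r by (auto simp: nat_le_iff_add)
      then show ?thesis using card_N[OF ZV] dense Z(3) by (simp add: algebra_simps)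
    qed
    fix x y z
    assume out: "x \<notin> I \<inter> N Z" "y \<notin> I \<inter> N Z" "z \<notin> I \<inter> N Z" and xyz: "link A Z x y" "link A Z x z"
    show "\<not> link A Z y z"
    proof
      assume yz: "link A Z y z"
      have mem: "x \<in> N Z" "y \<in> N Z" "z \<in> N Z" using xyz yz L.in_V L.in_V2 by blast+
      have T: "clique (link A Z) {x, y, z}" using xyz yz L.adj_sym by (auto simp: clique_def)
      have "clique A (Z \<union> {x, y, z})" by (rule clique_Un_link[OF Z(2) T]) (use mem in auto)
      moreover have sub: "Z \<union> {x, y, z} \<subseteq> V - I" using Z(1) mem out N_subset by blast
      ultimately have "clique ?B (Z \<union> {x, y, z})" using clique_induced_iff by blast
      moreover have "card {x, y, z} = 3" using xyz yz irrefl by (auto simp: link_iff card_insert_if)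
      then have "card (Z \<union> {x, y, z}) = r" using card_Un_link[OF ZV, of "{x, y, z}"] mem Z(3) r by simp
      ultimately show False using K by (auto simp: K_free_def)
    qed
  qed auto
  have "link ?B Z x y \<Longrightarrow> induced (N Z - I \<inter> N Z) (link A Z) x y" for x y
    using in_V by (auto simp: link_iff induced_def N_def)
  then show ?thesis using no_odd_walk_mono[OF no_odd_walk_outside] by blast
qed

end

text \<open>The independent set from \<open>independent_cover_exists\<close> gets a colour of its
  own. Its deletion costs at most \<open>m\<close> vertices, which is what the density condition
  yields when \<open>r\<close> drops by one. At \<open>r = 3\<close> the rest is bipartite.\<close>

theorem colourable_if_locally_sparse:
  assumes "dense_graph V A m" and "locally_sparse r V A" and "r \<ge> 3" and "7 * card V > (7 * r - 6) * m"
  shows "\<exists>f :: 'a \<Rightarrow> nat. f ` V \<subseteq> {..<r} \<and> (\<forall>x y. A x y \<longrightarrow> f x \<noteq> f y)"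
  using assms(3,1,2,4)
proof (induction r arbitrary: V A rule: nat_induct_at_least)
  case (base V A)
  interpret dense_graph V A m by fact
  have RR: "RR_free A 2" using base(2) by (simp add: locally_sparse_def)
  obtain I where I: "I \<subseteq> V" "\<forall>x\<in>I. \<forall>y\<in>I. \<not> A x y" "K_free (induced (V - I) A) 3"
    using independent_cover_exists[OF RR] base(3) by auto
  have "no_odd_walk (link (induced (V - I) A) {})"
    by (rule no_odd_walk_link_outside[OF base(2)]) (use I base(3) in \<open>auto simp: clique_def\<close>)
  then have "no_odd_walk (induced (V - I) A)" by simp
  moreover have "induced (V - I) A y x" if "induced (V - I) A x y" for x y
    using that adj_sym by (simp add: induced_def)
  ultimately obtain f :: "'a \<Rightarrow> bool" where f: "\<forall>x y. induced (V - I) A x y \<longrightarrow> f x \<noteq> f y"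
    using two_colourable_if_no_odd_walk[of "induced (V - I) A"] by blast
  have "g x \<noteq> g y" if "A x y" "g = (\<lambda>x. if x \<in> I then 2 else if f x then 1 else 0 :: nat)" for x y g
    using that f I(2) in_V[OF that(1)] in_V2[OF that(1)] by (auto simp: induced_def)
  then show ?case
    by (intro exI[of _ "\<lambda>x. if x \<in> I then 2 else if f x then 1 else 0"]) auto
next
  case (Suc r V A)
  interpret dense_graph V A m by fact
  have sparse: "locally_sparse (Suc r) V A" and r: "r \<ge> 3" by fact+
  have RR: "RR_free A r" using sparse by (simp add: locally_sparse_def)
  have dense: "(7 * r + 1) * m < 7 * card V" using Suc.prems(3) by simp
  obtain I where I: "I \<subseteq> V" "\<forall>x\<in>I. \<forall>y\<in>I. \<not> A x y" and K: "K_free (induced (V - I) A) (Suc r)"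
    using independent_cover_exists[OF RR] r dense by auto
  let ?B = "induced (V - I) A"
  interpret B: dense_graph "V - I" ?B m by (rule dense_graph_induced) auto
  have fI: "finite I" using I(1) finite_V finite_subset by blast
  have cI: "card I \<le> m" using card_independent[OF I(1)] I(2) by blast
  \<comment> \<open>This condition comes first, since it is used to re-establish both the linked
    condition and the exclusion of \<open>T0m\<close> after the deletion.\<close>
  have noodd: "no_odd_walk (link ?B Z)" if "Z \<subseteq> V - I" "clique ?B Z" "card Z = r - 2" for Z
  proof (rule no_odd_walk_link_outside[OF sparse])
    show "(7 * Suc r - 6) * m < 7 * card V" using dense by simp
    show "clique A Z" using that clique_induced_iff by blast
  qed (use I K r that in auto)
  obtain k where k: "r = k + 2" using r by (auto simp: nat_le_iff_add)
  have RRB: "RR_free ?B (r - 1)"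
  proof -
    have "RR_free ?B (k + 1)"
    proof (rule RR_free_outside[OF Suc.prems(1) I(1)])
      show "K_free ?B (k + 3)" using K k by (simp add: eval_nat_numeral)
      show "RR_free A (k + 2)" using RR k by simp
      show "(7 * k + 15) * m < 7 * card V" using dense k by (simp add: add.commute)
    qed (use I(2) noodd k in auto)
    then show ?thesis using k by simp
  qed
  have "T0m_free (link ?B Z)" if Z: "Z \<subseteq> V - I" "clique ?B Z" "card Z = r - 3" for Z
  proof -
    have ZV: "Z \<subseteq> V" and cZ: "clique A Z" using Z clique_induced_iff by blast+
    have fZ: "finite Z" using ZV finite_V finite_subset by blast
    interpret L: dense_graph "N Z" "link A Z" m by (rule link_dense_graph)
    have eq: "induced (N Z - I \<inter> N Z) (link A Z) = link ?B Z"
    proof (cases "Z = {}")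
      case True then show ?thesis by (auto simp: link_iff induced_def N_def fun_eq_iff)
    next
      case False then show ?thesis using Z(1) in_V by (auto simp: link_iff induced_def N_def fun_eq_iff)
    qed
    interpret LB: dense_graph "B.N Z" "link ?B Z" m by (rule B.link_dense_graph)
    have "T0m_free (induced (N Z - I \<inter> N Z) (link A Z))"
    proof (rule L.T0m_free_outside)
      show "odd_wheel_free (induced (N Z - I \<inter> N Z) (link A Z))"
        unfolding eq by (rule B.odd_wheel_free_link) (use noodd Z r in auto)
      show "moser_free (induced (N Z - I \<inter> N Z) (link A Z))"
        unfolding eq
      proof (rule LB.moser_free_if_RR_free, rule B.RR_free_link)
        have "r - 1 = 2 + card Z" using r Z by simp
        then show "RR_free ?B (2 + card Z)" using RRB by simp
      qed (use Z fZ in auto)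
      show "\<not> link A Z x y" if "x \<in> I \<inter> N Z" "y \<in> I \<inter> N Z" for x y
        using I that by (auto simp: link_iff)
      show "18 * m < 6 * card (N Z)"
      proof -
        obtain t where "r = t + 3" using r by (auto simp: nat_le_iff_add)
        then show ?thesis using card_N[OF ZV] dense Z(3) by (simp add: algebra_simps)
      qed
      fix p assume p: "p \<in> I \<inter> N Z"
      have "clique A (insert p Z)"
        by (rule clique_insert[OF cZ]) (use p adj_sym in \<open>auto simp: N_def\<close>)
      moreover have "card (insert p Z) = Suc r - 3"
        using card_clique_insert[of Z A p] fZ p irrefl Z(3) r by (auto simp: N_def)
      moreover have "insert p Z \<subseteq> V" using p ZV N_subset by blast
      ultimately have "T0m_free (link A (insert p Z))" using sparse by (auto simp: locally_sparse_def)
      then show "T0m_free (link (link A Z) {p})"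
        using link_link[of "{p}" A Z] p by (simp add: N_eq_nbhd)
    qed auto
    then show ?thesis unfolding eq .
  qed
  then have "locally_sparse r (V - I) ?B" using RRB noodd by (auto simp: locally_sparse_def)
  moreover have "(7 * r - 6) * m < 7 * card (V - I)"
  proof -
    have "card (V - I) = card V - card I" using fI I(1) by (rule card_Diff_subset)
    moreover obtain t where "r = t + 3" using r by (auto simp: nat_le_iff_add)
    ultimately show ?thesis using dense cI by (simp add: algebra_simps)
  qed
  ultimately obtain f where f: "f ` (V - I) \<subseteq> {..<r}" "\<forall>x y. ?B x y \<longrightarrow> f x \<noteq> f y"
    using Suc.IH[OF B.dense_graph_axioms] by blast
  have "g x \<noteq> g y" if "A x y" "g = (\<lambda>x. if x \<in> I then r else f x)" for x y g
  proof -
    have xy: "x \<in> V" "y \<in> V" using in_V[OF that(1)] in_V2[OF that(1)] by blast+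
    have lt: "f z \<noteq> r" if "z \<in> V" "z \<notin> I" for z using f(1) that by (auto simp: image_subset_iff)
    note Axy = that(1) and g = that(2)
    consider "x \<in> I" "y \<notin> I" | "y \<in> I" "x \<notin> I" | "x \<notin> I" "y \<notin> I" using I(2) Axy by blast
    then show ?thesis
    proof cases
      case 1 then show ?thesis using lt[of y] xy by (simp add: g eq_commute)
    next
      case 2 then show ?thesis using lt[of x] xy by (simp add: g)
    next
      case 3 then show ?thesis using f(2) Axy xy by (simp add: g induced_def)
    qed
  qed
  then show ?case using f(1)
    by (intro exI[of _ "\<lambda>x. if x \<in> I then r else f x"]) (auto simp: less_Suc_eq image_subset_iff)
qed

section \<open>Dense graphs without homomorphic copies of the forbidden graphs\<close>

text \<open>The target is a vertex set with a relation, the form in which links and samples are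
  given.\<close>

definition maps_to :: "'b graph \<Rightarrow> 'a set \<Rightarrow> ('a \<Rightarrow> 'a \<Rightarrow> bool) \<Rightarrow> bool" where
  "maps_to F V A \<longleftrightarrow>
     (\<exists>\<phi>. \<phi> ` verts F \<subseteq> V \<and> (\<forall>u v. {u, v} \<in> edges F \<longrightarrow> A (\<phi> u) (\<phi> v)))"

lemma less_7_cases: "i < 7 \<Longrightarrow> i = 0 \<or> i = 1 \<or> i = 2 \<or> i = 3 \<or> i = 4 \<or> i = 5 \<or> i = (6::nat)"
  by linarith

lemma edges_C7_complement:
  "edges C7_complement = (\<lambda>(i, j). {i, j}) ` {(0, 1), (0, 2), (1, 2), (1, 3), (2, 3), (2, 4), (3, 4),
    (3, 5), (4, 5), (4, 6), (5, 6), (5, 0), (6, 0), (6, 1)}"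
  (is "?L = _ ` ?E")
proof -
  let ?P = "\<lambda>i j :: nat. \<exists>d\<in>{1, -1, 2, -2}. 7 dvd int j - int i - d"
  define E where "E = ?E"
  define P where "P = ?P"
  have "\<forall>i\<in>set [0..<7]. \<forall>j\<in>set [0..<7]. P i j \<longrightarrow> (i, j) \<in> E \<or> (j, i) \<in> E"
    unfolding E_def P_def by code_simp
  then have 1: "(i, j) \<in> E \<or> (j, i) \<in> E" if "i < 7" "j < 7" "P i j" for i j
    using that unfolding set_upt by (meson atLeastLessThan_iff le0)
  have "\<forall>(i, j)\<in>E. i < 7 \<and> j < 7 \<and> P i j" unfolding E_def P_def by code_simp
  then have 2: "i < 7 \<and> j < 7 \<and> P i j" if "(i, j) \<in> E" for i j using that by blast
  have L: "?L = {{i, j} | i j. i < 7 \<and> j < 7 \<and> P i j}" by (simp add: C7_complement_def P_def)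
  show ?thesis unfolding L E_def[symmetric]
  proof (intro equalityI subsetI)
    fix e assume "e \<in> {{i, j} | i j. i < 7 \<and> j < 7 \<and> P i j}"
    then obtain i j where "e = {i, j}" "(i, j) \<in> E \<or> (j, i) \<in> E" using 1 by blast
    then show "e \<in> (\<lambda>(i, j). {i, j}) ` E" by (force simp: insert_commute)
  next
    fix e assume "e \<in> (\<lambda>(i, j). {i, j}) ` E"
    then show "e \<in> {{i, j} | i j. i < 7 \<and> j < 7 \<and> P i j}" using 2 by force
  qed
qed

lemma edges_H2:
  "edges H2 = (\<lambda>(i, j). {i, j}) ` {(0, 1), (0, 2), (1, 2), (1, 3), (2, 3), (2, 4), (3, 4),
    (3, 5), (4, 5), (4, 6), (5, 6), (5, 0), (6, 0)}"
  unfolding H2_def delete_edges_def edges_C7_complement graph.sel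
  by (simp add: doubleton_eq_iff insert_Diff_if)

lemma edges_star: "{{k, i} | i. i \<in> S} = (\<lambda>(i, j). {i, j}) ` ({k} \<times> S)"
  by auto

lemma edges_H2_plus:
  "edges H2_plus = (\<lambda>(i, j). {i, j}) ` ({(0, 1), (0, 2), (1, 2), (1, 3), (2, 3), (2, 4), (3, 4),
    (3, 5), (4, 5), (4, 6), (5, 6), (5, 0), (6, 0)} \<union> {7} \<times> {0, 2, 5})"
  unfolding H2_plus_def edges_H2 edges_star graph.sel image_Un ..

lemma cycle_edges_eq: "cycle_edges n = (\<lambda>(i, j). {i, j}) ` ((\<lambda>i. (i, Suc i mod n)) ` {..<n})"
  by (auto simp: cycle_edges_def image_image)

lemma edges_T0:
  "edges T0 = (\<lambda>(i, j). {i, j}) ` ((\<lambda>i. (i, Suc i mod 7)) ` {..<7} \<union>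
    {8} \<times> {0, 2, 3, 4, 5, 6} \<union> {9} \<times> {0, 1, 2, 3, 4, 5} \<union> {7} \<times> {0, 8, 9})"
  unfolding T0_def cycle_edges_eq edges_star graph.sel image_Un ..

context dense_graph
begin

lemma maps_toI:
  assumes "\<And>i. i \<in> verts F \<Longrightarrow> \<phi> i \<in> V" and "edges F = (\<lambda>(i, j). {i, j}) ` E"
    and "\<And>i j. (i, j) \<in> E \<Longrightarrow> A (\<phi> i) (\<phi> j)"
  shows "maps_to F V A"
  unfolding maps_to_def
proof (intro exI[of _ \<phi>] conjI allI impI)
  fix u v assume "{u, v} \<in> edges F"
  then obtain i j where "(i, j) \<in> E" "{u, v} = {i, j}" using assms(2) by auto
  then show "A (\<phi> u) (\<phi> v)" using assms(3)[of i j] adj_sym by (auto simp: doubleton_eq_iff)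
qed (use assms(1) in blast)

lemma C7c_free_if_not_maps_to:
  assumes "\<not> maps_to C7_complement V A"
  shows "C7c_free A"
  unfolding C7c_free_def
proof (intro allI notI)
  fix v0 v1 v2 v3 v4 v5 v6
  assume adj: "A v0 v1 \<and> A v0 v2 \<and> A v1 v2 \<and> A v1 v3 \<and> A v2 v3 \<and> A v2 v4 \<and> A v3 v4 \<and> A v3 v5 \<and>
    A v4 v5 \<and> A v4 v6 \<and> A v5 v6 \<and> A v5 v0 \<and> A v6 v0 \<and> A v6 v1"
  have "maps_to C7_complement V A"
  proof (rule maps_toI[OF _ edges_C7_complement])
    show "[v0, v1, v2, v3, v4, v5, v6] ! i \<in> V" if "i \<in> verts C7_complement" for i
      using that adj in_V in_V2 by (auto simp: C7_complement_def dest!: less_7_cases)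
  qed (use adj in auto)
  then show False using assms by blast
qed

lemma H2_free_if_not_maps_to:
  assumes "\<not> maps_to H2 V A"
  shows "H2_free A"
  unfolding H2_free_def
proof (intro allI notI)
  fix v0 v1 v2 v3 v4 v5 v6
  assume adj: "A v0 v1 \<and> A v0 v2 \<and> A v1 v2 \<and> A v1 v3 \<and> A v2 v3 \<and> A v2 v4 \<and> A v3 v4 \<and> A v3 v5 \<and>
    A v4 v5 \<and> A v4 v6 \<and> A v5 v6 \<and> A v5 v0 \<and> A v6 v0"
  have "maps_to H2 V A"
  proof (rule maps_toI[OF _ edges_H2])
    show "[v0, v1, v2, v3, v4, v5, v6] ! i \<in> V" if "i \<in> verts H2" for i
      using that adj in_V in_V2
      by (auto simp: H2_def delete_edges_def C7_complement_def dest!: less_7_cases)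
  qed (use adj in auto)
  then show False using assms by blast
qed

lemma H2p_free_if_not_maps_to:
  assumes "\<not> maps_to H2_plus V A"
  shows "H2p_free A"
  unfolding H2p_free_def
proof (intro allI notI)
  fix v0 v1 v2 v3 v4 v5 v6 u
  assume adj: "A v0 v1 \<and> A v0 v2 \<and> A v1 v2 \<and> A v1 v3 \<and> A v2 v3 \<and> A v2 v4 \<and> A v3 v4 \<and> A v3 v5 \<and>
    A v4 v5 \<and> A v4 v6 \<and> A v5 v6 \<and> A v5 v0 \<and> A v6 v0 \<and> A u v0 \<and> A u v2 \<and> A u v5"
  have "maps_to H2_plus V A"
  proof (rule maps_toI[OF _ edges_H2_plus])
    show "[v0, v1, v2, v3, v4, v5, v6, u] ! i \<in> V" if "i \<in> verts H2_plus" for i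
      using that adj in_V in_V2
      by (auto simp: H2_plus_def H2_def delete_edges_def C7_complement_def dest!: less_7_cases)
  qed (use adj in auto)
  then show False using assms by blast
qed

lemma T0_free_if_not_maps_to:
  assumes "\<not> maps_to T0 V A"
  shows "T0_free A"
  unfolding T0_free_def
proof (intro allI notI)
  fix v0 v1 v2 v3 v4 v5 v6 u w t
  assume adj: "A v0 v1 \<and> A v1 v2 \<and> A v2 v3 \<and> A v3 v4 \<and> A v4 v5 \<and> A v5 v6 \<and> A v6 v0 \<and>
    A u v0 \<and> A u v2 \<and> A u v3 \<and> A u v4 \<and> A u v5 \<and> A u v6 \<and>
    A w v0 \<and> A w v1 \<and> A w v2 \<and> A w v3 \<and> A w v4 \<and> A w v5 \<and> A t v0 \<and> A t u \<and> A t w"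
  define xs where "xs = [v0, v1, v2, v3, v4, v5, v6, t, u, w]"
  have xs: "\<forall>x\<in>set xs. x \<in> V" "length xs = 10"
    unfolding xs_def using adj in_V in_V2 by (simp, blast) simp
  have "maps_to T0 V A"
  proof (rule maps_toI[OF _ edges_T0])
    show "xs ! i \<in> V" if "i \<in> verts T0" for i
      using that xs nth_mem[of i xs] by (auto simp: T0_def)
  qed (use adj in \<open>auto simp: xs_def dest!: less_7_cases\<close>)
  then show False using assms by blast
qed

lemma wheel_maps_to:
  assumes walk: "closed_walk A n c" and hub: "\<And>i. A v (c i)" and "n > 0"
  shows "maps_to (wheel n) V A"
  unfolding maps_to_def
proof (intro exI[of _ "\<lambda>i. if i < n then c i else v"] conjI allI impI)
  show "(\<lambda>i. if i < n then c i else v) ` verts (wheel n) \<subseteq> V"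
    using in_V[OF hub] in_V2[OF hub] by (auto simp: wheel_def)
  fix i j assume "{i, j} \<in> edges (wheel n)"
  then consider k where "k < n" "{i, j} = {k, (k + 1) mod n}" | k where "k < n" "{i, j} = {n, k}"
    by (auto simp: wheel_def cycle_edges_def)
  then show "A (if i < n then c i else v) (if j < n then c j else v)"
  proof cases
    case 1
    have "A (c k) (c ((k + 1) mod n))"
      using walk closed_walk_mod_eq[OF walk, of "k + 1"] by (simp add: closed_walk_def)
    moreover from this have "A (c ((k + 1) mod n)) (c k)" by (rule adj_sym)
    moreover have "(k + 1) mod n < n" using \<open>n > 0\<close> by simp
    ultimately show ?thesis using 1 by (auto simp: doubleton_eq_iff)
  next
    case 2
    have "A v (c k)" "A (c k) v" using hub adj_sym by blast+
    then show ?thesis using 2 by (auto simp: doubleton_eq_iff)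
  qed
qed

lemma clique_maps_to:
  assumes K: "K \<subseteq> V" "clique A K" "card K = n" "finite K"
  shows "maps_to (complete_graph n) V A"
proof -
  obtain f where f: "bij_betw f {..<n} K"
    using ex_bij_betw_nat_finite[OF K(4)] K(3) by (auto simp: atLeast0LessThan)
  have inj: "f i = f j \<longleftrightarrow> i = j" if "i < n" "j < n" for i j
    using f that by (auto simp: bij_betw_def inj_on_def)
  have "A (f i) (f j)" if "{i, j} \<subseteq> {..<n}" "card {i, j} = 2" for i j
  proof -
    have "i \<noteq> j" using that(2) by auto
    then have "f i \<noteq> f j" using inj that(1) by simp
    moreover have "f i \<in> K" "f j \<in> K" using f that(1) by (auto simp: bij_betw_def)
    ultimately show ?thesis using K(2) by (auto simp: clique_def)
  qed
  then show ?thesis unfolding maps_to_def complete_graph_def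
    using f K(1) by (intro exI[of _ f]) (auto simp: bij_betw_def)
qed

lemma maps_to_join_complete:
  assumes Z: "Z \<subseteq> V" "clique A Z" "card Z = n" and F: "maps_to F (N Z) (link A Z)"
  shows "maps_to (join (complete_graph n) F) V A"
proof -
  have fZ: "finite Z" using Z(1) finite_V finite_subset by blast
  interpret Z: dense_graph Z "induced Z A" m by (rule dense_graph_induced) fact
  have "maps_to (complete_graph n) Z (induced Z A)"
    by (rule Z.clique_maps_to) (use Z fZ in \<open>auto simp: clique_def induced_def\<close>)
  then obtain \<phi> where "\<phi> ` verts (complete_graph n) \<subseteq> Z"
    "\<forall>u v. {u, v} \<in> edges (complete_graph n) \<longrightarrow> induced Z A (\<phi> u) (\<phi> v)"
    unfolding maps_to_def by blast
  then have \<phi>: "\<phi> ` verts (complete_graph n) \<subseteq> Z"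
    "\<And>u v. {u, v} \<in> edges (complete_graph n) \<Longrightarrow> A (\<phi> u) (\<phi> v)" by (simp_all add: induced_def)
  obtain \<psi> where \<psi>: "\<psi> ` verts F \<subseteq> N Z" "\<forall>u v. {u, v} \<in> edges F \<longrightarrow> link A Z (\<psi> u) (\<psi> v)"
    using F unfolding maps_to_def by blast
  define \<theta> where "\<theta> = case_sum \<phi> \<psi>"
  have "A (\<theta> u) (\<theta> v)" if uv: "{u, v} \<in> edges (join (complete_graph n) F)" for u v
  proof -
    consider (l) e where "e \<in> edges (complete_graph n)" "{u, v} = Inl ` e"
      | (r) e where "e \<in> edges F" "{u, v} = Inr ` e"
      | (x) a b where "a \<in> verts (complete_graph n)" "b \<in> verts F" "{u, v} = {Inl a, Inr b}"
      using uv unfolding join_def graph.sel by blast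
    then show ?thesis
    proof cases
      case l
      have "u \<in> Inl ` e" "v \<in> Inl ` e" using l(2) by blast+
      then obtain a b where ab: "u = Inl a" "v = Inl b" by blast
      have "e = Inl -` {u, v}" unfolding l(2) by (simp add: inj_vimage_image_eq)
      also have "\<dots> = {a, b}" unfolding ab by auto
      finally show ?thesis using \<phi>(2) l(1) ab by (simp add: \<theta>_def)
    next
      case r
      have "u \<in> Inr ` e" "v \<in> Inr ` e" using r(2) by blast+
      then obtain a b where ab: "u = Inr a" "v = Inr b" by blast
      have "e = Inr -` {u, v}" unfolding r(2) by (simp add: inj_vimage_image_eq)
      also have "\<dots> = {a, b}" unfolding ab by auto
      finally show ?thesis using \<psi>(2) r(1) ab by (simp add: \<theta>_def link_iff)
    next
      case x
      have "A (\<psi> b) (\<phi> a)" using x(1,2) \<phi>(1) \<psi>(1) by (auto simp: N_def)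
      moreover from this have "A (\<phi> a) (\<psi> b)" by (rule adj_sym)
      ultimately show ?thesis using x(3) by (auto simp: doubleton_eq_iff \<theta>_def)
    qed
  qed
  moreover have "\<theta> ` verts (join (complete_graph n) F) \<subseteq> V"
  proof -
    have "\<phi> a \<in> V" if "a \<in> verts (complete_graph n)" for a using that \<phi>(1) Z(1) by blast
    moreover have "\<psi> b \<in> V" if "b \<in> verts F" for b using that \<psi>(1) N_subset by blast
    ultimately show ?thesis by (auto simp: join_def \<theta>_def)
  qed
  ultimately show ?thesis unfolding maps_to_def by blast
qed

text \<open>Every vertex of the link of \<open>v\<close> has at most two neighbours on a shortest odd cycle there.\<close>

lemma odd_wheel_free_if_dense:
  assumes "\<And>n. odd n \<Longrightarrow> n \<ge> 3 \<Longrightarrow> \<not> maps_to (wheel n) V A \<or> (n \<ge> 5 \<and> (2 * n - 2) * m < (n - 2) * card V)"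
  shows "odd_wheel_free A"
  unfolding odd_wheel_free_def
proof
  fix v
  let ?R = "\<lambda>x y. A x y \<and> A v x \<and> A v y"
  show "no_odd_walk ?R"
  proof (rule ccontr)
    assume "\<not> no_odd_walk ?R"
    then obtain n c where sh: "shortest_odd_walk ?R n c" using shortest_odd_walk_exists by blast
    then have walk: "closed_walk ?R n c" and "odd n" by (auto simp: shortest_odd_walk_def)
    then have w: "A (c i) (c (Suc i))" "A v (c i)" "c (i + n) = c i" for i by (auto simp: closed_walk_def)
    have "n \<noteq> 1" using w(1)[of 0] w(3)[of 0] irrefl by auto
    then have "n \<ge> 3" using \<open>odd n\<close> by presburger
    moreover have "maps_to (wheel n) V A"
      by (rule wheel_maps_to[of n c v]) (use w \<open>n \<ge> 3\<close> in \<open>auto simp: closed_walk_def\<close>)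
    ultimately have n: "n \<ge> 5" and less: "(2 * n - 2) * m < (n - 2) * card V"
      using assms \<open>odd n\<close> by blast+
    have vV: "v \<in> V" using w(2) in_V by blast
    interpret L: dense_graph "N {v}" "link A {v}" m by (rule link_dense_graph)
    have R: "?R = link A {v}" using adj_sym by (auto simp: link_iff fun_eq_iff)
    define ws where "ws = map (\<lambda>i. (1::nat, c i)) [0..<n]"
    have "(n - 2) * card (N {v}) \<le> sum_list (map fst ws) * m"
    proof (rule L.weight_bound_all)
      have "c i \<in> N {v}" for i using w(2)[of i] in_V2 adj_sym by (auto simp: N_def)
      then show "snd ` set ws \<subseteq> N {v}" by (auto simp: ws_def)
      fix p
      have "card {i \<in> {..<n}. link A {v} p (c i)} \<le> 2"
        by (rule shortest_odd_walk_card[OF sh[unfolded R] L.adj_sym n])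
      then show "n - 2 \<le> miss (link A {v}) ws p" unfolding ws_def miss_walk_eq by linarith
    qed
    also have "sum_list (map fst ws) = n" unfolding ws_def One_nat_def by (rule sum_list_walk)
    finally have 1: "(n - 2) * card (N {v}) \<le> n * m" .
    \<comment> \<open>In the link of the hub the ratio is \<open>n / (n - 2)\<close>; the vertices
      missed by the hub raise it by one to \<open>(2n - 2)/(n - 2)\<close>.\<close>
    have "card V \<le> card (N {v}) + m" using card_N[of "{v}"] vV by simp
    then have "(n - 2) * card V \<le> (n - 2) * (card (N {v}) + m)" by (rule mult_le_mono2)
    also have "\<dots> \<le> n * m + (n - 2) * m" using 1 by (simp add: add_mult_distrib2)
    also have "\<dots> = (2 * n - 2) * m" using n by (simp add: add_mult_distrib[symmetric] mult_2)
    finally show False using less by simp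
  qed
qed

end

section \<open>The sequences \<open>F_i\<close> and \<open>c_i\<close> against the density
  hypothesis\<close>

lemma c_const_values:
  "c_const 1 = 2/3" "c_const 2 = 2/5" "c_const 3 = 1/3" "c_const 4 = 2/7" "c_const 5 = 1/4"
  "c_const 6 = 2/9" "c_const 7 = 1/5" "c_const 8 = 2/11" "c_const 9 = 1/6" "c_const 10 = 2/13"
  "c_const 11 = 1/7"
  by (simp_all add: c_const_def)

lemma F_graph_values:
  "F_graph 1 = complete_graph 4" "F_graph 2 = wheel 5" "F_graph 3 = wheel 7"
  "F_graph 4 = C7_complement" "F_graph 5 = wheel 9" "F_graph 6 = H2_plus" "F_graph 7 = wheel 11"
  "F_graph 8 = H2" "F_graph 9 = wheel 13" "F_graph 10 = T0" "F_graph 11 = wheel 15"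
  "F_graph 12 = H1_plus_plus"
  by (simp_all add: F_graph_def)

lemma c_const_antimono:
  assumes "1 \<le> g" "g \<le> i" "i \<le> 11"
  shows "c_const i \<le> c_const g"
proof (cases "g = i")
  case False
  let ?l = "[2/3, 2/5, 1/3, 2/7, 1/4, 2/9, 1/5, 2/11, 1/6, 2/13, 1/7] :: real list"
  have "sorted_wrt (\<ge>) ?l" by simp
  moreover have "g - 1 < i - 1" "i - 1 < length ?l" using assms False by auto
  ultimately show ?thesis unfolding c_const_def by (rule sorted_wrt_nth_less)
qed simp

lemma maps_to_wheel_3:
  assumes "maps_to (wheel 3) V A"
  shows "maps_to (complete_graph 4) V A"
proof -
  have "edges (complete_graph 4) \<subseteq> edges (wheel 3)"
  proof
    fix e assume "e \<in> edges (complete_graph 4)"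
    then obtain i j where e: "e = {i, j}" "i \<noteq> j" "i < 4" "j < 4"
      by (auto simp: complete_graph_def card_2_iff)
    have "\<forall>i\<in>set [0..<4]. \<forall>j\<in>set [0..<4]. i \<noteq> j \<longrightarrow>
      (\<exists>k\<in>set [0..<3]. {i, j} = {k, (k + 1) mod 3} \<or> {i, j} = {3, k})" by code_simp
    then have "\<exists>k<3. {i, j} = {k, (k + 1) mod 3} \<or> {i, j} = {3, k}"
      using e(2-) unfolding set_upt by (meson atLeastLessThan_iff le0)
    then show "e \<in> edges (wheel 3)" unfolding wheel_def cycle_edges_def e(1) by auto
  qed
  moreover have "verts (complete_graph 4) = verts (wheel 3)" by (auto simp: complete_graph_def wheel_def)
  ultimately show ?thesis using assms unfolding maps_to_def by (metis subsetD)
qed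

text \<open>Since the constants decrease, each configuration of the chain is excluded in the links
  either by hypothesis, when its graph occurs up to index \<open>g\<close>, or by density. The
  exclusions build on each other: odd wheels, then \<open>C7_complement\<close> and
  \<open>H2_plus\<close>, then \<open>H2\<close>, \<open>H1\<close>, the spindle and finally
  \<open>T0m\<close>.\<close>

theorem colourable_if_hom_free:
  assumes "dense_graph V A m" and r: "r \<ge> 3" and g: "1 \<le> g" "g \<le> 11"
    and hom_free: "\<And>i. 1 \<le> i \<Longrightarrow> i \<le> g \<Longrightarrow> \<not> maps_to (join (complete_graph (r - 3)) (F_graph i)) V A"
    and dense: "(real r - 1 + c_const g) * real m < real (card V)"
  shows "\<exists>f :: 'a \<Rightarrow> nat. f ` V \<subseteq> {..<r} \<and> (\<forall>x y. A x y \<longrightarrow> f x \<noteq> f y)"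
proof -
  interpret dense_graph V A m by fact
  have c7: "c_const g \<ge> 1/7" using c_const_antimono[of g 11] g c_const_values(11) by simp
  \<comment> \<open>For the graph with index \<open>i + 1\<close>: either it is excluded by
    hypothesis, or the density exceeds the threshold \<open>c_const i\<close> at which counting
    excludes it.\<close>
  have below: "i + 1 \<le> g \<or> c_const i \<le> c_const g" if "i \<le> 11" for i
    using c_const_antimono[of g i] g that by linarith
  have link: "odd_wheel_free (link A Z) \<and> moser_free (link A Z) \<and> T0m_free (link A Z)"
    if Z: "Z \<subseteq> V" "clique A Z" "card Z = r - 3" for Z
  proof -
    interpret L: dense_graph "N Z" "link A Z" m by (rule link_dense_graph)
    have free: "\<not> maps_to (F_graph i) (N Z) (link A Z)" if "1 \<le> i" "i \<le> g" for i
      using maps_to_join_complete[OF Z] hom_free[OF that] by blast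
    have "real (card V) \<le> real (card (N Z) + (r - 3) * m)"
      using card_N[OF Z(1)] Z(3) by (simp del: of_nat_add of_nat_mult)
    then have "real (card V) \<le> real (card (N Z)) + (real r - 3) * real m"
      using r by (simp add: of_nat_diff)
    then have dL: "2 * real m + c_const g * real m < real (card (N Z))"
      using dense by (simp add: algebra_simps)
    have dL': "2 * real m + d * real m < real (card (N Z))" if "d \<le> c_const g" for d
      using dL mult_right_mono[OF that, of "real m"] by linarith
    have W: "odd_wheel_free (link A Z)"
    proof (rule L.odd_wheel_free_if_dense)
      fix n :: nat assume "odd n" "n \<ge> 3"
      then have "n = 3 \<or> n = 5 \<or> n = 7 \<or> n = 9 \<or> n = 11 \<or> n = 13 \<or> n = 15 \<or> n \<ge> 17"
        by presburger
      then consider "n = 3" | "n = 5" | "n = 7" | "n = 9" | "n = 11" | "n = 13" | "n = 15" | "n \<ge> 17"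
        by blast
      then show "\<not> maps_to (wheel n) (N Z) (link A Z) \<or>
        (n \<ge> 5 \<and> (2 * n - 2) * m < (n - 2) * card (N Z))"
      proof cases
        case 1 then show ?thesis using free[of 1, unfolded F_graph_values] g maps_to_wheel_3 by auto
      next
        case 2 then show ?thesis using free[of 2] below[of 1, unfolded c_const_values] dL'[of "2/3"]
          by (auto simp: F_graph_values c_const_values)
      next
        case 3 then show ?thesis using free[of 3] below[of 2] dL'[of "2/5"]
          by (auto simp: F_graph_values c_const_values)
      next
        case 4 then show ?thesis using free[of 5] below[of 4] dL'[of "2/7"]
          by (auto simp: F_graph_values c_const_values)
      next
        case 5 then show ?thesis using free[of 7] below[of 6] dL'[of "2/9"]
          by (auto simp: F_graph_values c_const_values)
      next
        case 6 then show ?thesis using free[of 9] below[of 8] dL'[of "2/11"]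
          by (auto simp: F_graph_values c_const_values)
      next
        case 7 then show ?thesis using free[of 11] below[of 10] dL'[of "2/13"]
          by (auto simp: F_graph_values c_const_values)
      next
        \<comment> \<open>From length 17 on, \<open>(2n - 2)/(n - 2)\<close> is at most
          \<open>32/15\<close>, which is below \<open>15/7\<close>.\<close>
        case 8
        then obtain k where k: "n = k + 17" by (auto simp: nat_le_iff_add)
        have "15 * m < 7 * card (N Z)" using dL'[OF c7] by simp
        then have less: "(k + 15) * (15 * m) < (k + 15) * (7 * card (N Z))" by simp
        have "7 * ((2 * k + 32) * m) \<le> (k + 15) * (15 * m)" by (simp add: algebra_simps)
        also note less
        also have "(k + 15) * (7 * card (N Z)) = 7 * ((k + 15) * card (N Z))" by (rule mult.left_commute)
        finally have "(2 * k + 32) * m < (k + 15) * card (N Z)" by (rule mult_less_cancel1[THEN iffD1, THEN conjunct2])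
        then show ?thesis using k by (simp add: add.commute)
      qed
    qed
    note K4 = L.K4_free_if_odd_wheel_free[OF W] and W5 = L.W5_free_if_odd_wheel_free[OF W]
      and W7 = L.W7_free_if_odd_wheel_free[OF W]
    have C7: "C7c_free (link A Z)"
    proof (cases "4 \<le> g")
      case True then show ?thesis using L.C7c_free_if_not_maps_to free[of 4] by (simp add: F_graph_values)
    next
      case False
      then have "7 * m < 3 * card (N Z)" using below[of 3] dL'[of "1/3"] by (simp add: c_const_values)
      then show ?thesis by (rule L.C7c_free_if_dense[OF W5])
    qed
    have H2p: "H2p_free (link A Z)"
    proof (cases "6 \<le> g")
      case True then show ?thesis using L.H2p_free_if_not_maps_to free[of 6] by (simp add: F_graph_values)
    next
      case False
      then have "9 * m < 4 * card (N Z)" using below[of 5] dL'[of "1/4"] by (simp add: c_const_values)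
      then show ?thesis by (rule L.H2p_free_if_dense[OF K4 W5])
    qed
    have H2: "H2_free (link A Z)"
    proof (cases "8 \<le> g")
      case True then show ?thesis using L.H2_free_if_not_maps_to free[of 8] by (simp add: F_graph_values)
    next
      case False
      then have "11 * m < 5 * card (N Z)" using below[of 7] dL'[of "1/5"] by (simp add: c_const_values)
      then show ?thesis by (rule L.H2_free_if_dense[OF K4 W5 C7 H2p])
    qed
    have 157: "15 * m < 7 * card (N Z)" using dL'[OF c7] by simp
    have H1: "H1_free (link A Z)" by (rule L.H1_free_if_dense[OF K4 W5 H2 157])
    have M: "moser_free (link A Z)" by (rule L.moser_free_if_dense[OF K4 H1 157])
    have T: "T0m_free (link A Z)"
    proof (cases "10 \<le> g")
      case True
      then have "T0_free (link A Z)"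
        using L.T0_free_if_not_maps_to free[of 10] by (simp add: F_graph_values)
      then show ?thesis by (rule L.T0m_free_if_T0_free[OF K4 W5 W7 M _ 157])
    next
      case False
      then have "13 * m < 6 * card (N Z)" using below[of 9] dL'[of "1/6"] by (simp add: c_const_values)
      then show ?thesis by (rule L.T0m_free_if_dense[OF K4 W5 W7 M])
    qed
    show ?thesis using W M T by blast
  qed
  have dense7: "(7 * r - 6) * m < 7 * card V"
  proof -
    have "(real r - 1 + 1/7) * real m \<le> (real r - 1 + c_const g) * real m"
      using c7 by (intro mult_right_mono) auto
    then have "(7 * real r - 6) * real m < 7 * real (card V)" using dense by (simp add: algebra_simps)
    moreover have "real (7 * r - 6) = 7 * real r - 6" using r by (simp add: of_nat_diff)
    ultimately have "real ((7 * r - 6) * m) < real (7 * card V)"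
      unfolding of_nat_mult by simp
    then show ?thesis using of_nat_less_iff by blast
  qed
  obtain k where k: "r = k + 3" using r by (auto simp: nat_le_iff_add)
  have "K_free A (r + 1)"
    unfolding K_free_def
  proof (intro allI impI notI)
    fix K assume K: "clique A K" "card K = r + 1"
    have fK: "finite K" using K(2) by (metis add_is_0 card.infinite zero_neq_one)
    have KV: "K \<subseteq> V" using clique_link_subset[of "{}" K] K r N_subset by auto
    obtain Z where Z: "Z \<subseteq> K" "card Z = r - 3" "finite Z"
    proof (rule obtain_subset_with_card_n)
      show "r - 3 \<le> card K" using K(2) by simp
    qed
    interpret L: dense_graph "N Z" "link A Z" m by (rule link_dense_graph)
    have "maps_to (complete_graph 4) (N Z) (link A Z)"
    proof (rule L.clique_maps_to)
      have adj: "A x y" if "x \<in> K" "y \<in> K" "x \<noteq> y" for x y using K(1) that by (auto simp: clique_def)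
      have xz: "A x z" if "x \<in> K - Z" "z \<in> Z" for x z using adj[of x z] that Z(1) by blast
      show "K - Z \<subseteq> N Z" using xz KV by (auto simp: N_def)
      show "clique (link A Z) (K - Z)" using xz adj by (auto simp: clique_def link_iff)
      show "card (K - Z) = 4" using Z K(2) r by (simp add: card_Diff_subset)
    qed (use fK in simp)
    then have "maps_to (join (complete_graph (r - 3)) (complete_graph 4)) V A"
      by (intro maps_to_join_complete[of Z]) (use Z KV clique_subset[OF K(1)] in auto)
    then show False using hom_free[of 1, unfolded F_graph_values] g by simp
  qed
  then have "RR_free A (k + 2)"
    by (intro RR_free_if_links_moser_free[OF assms(1)]) (use k link dense7 in \<open>auto simp: eval_nat_numeral\<close>)
  moreover have "no_odd_walk (link A Y)" if Y: "Y \<subseteq> V" "clique A Y" "card Y = r - 2" for Y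
  proof -
    have "Y \<noteq> {}" using Y(3) r by auto
    then obtain z where z: "z \<in> Y" by blast
    have "card (Y - {z}) = r - 3" using z Y(1,3) finite_V finite_subset by fastforce
    then have "odd_wheel_free (link A (Y - {z}))"
      using link[of "Y - {z}"] Y(1) clique_subset[OF Y(2), of "Y - {z}"] by blast
    then have "no_odd_walk (\<lambda>x y. link A (Y - {z}) x y \<and> link A (Y - {z}) z x \<and> link A (Y - {z}) z y)"
      by (simp add: odd_wheel_free_def)
    then show ?thesis
      by (rule no_odd_walk_mono) (use z Y(2) adj_sym in \<open>auto simp: link_iff clique_def\<close>)
  qed
  ultimately have "locally_sparse r V A" using link k by (simp add: locally_sparse_def)
  then show ?thesis using colourable_if_locally_sparse[OF assms(1)] r dense7 by blast
qed

section \<open>Counting tuples\<close>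

text \<open>Tuples with repetition: their entries are independent uniform choices, which makes the
  deviation bounds elementary.\<close>

definition lists_of :: "'a set \<Rightarrow> nat \<Rightarrow> 'a list set" where
  "lists_of V q = {xs. set xs \<subseteq> V \<and> length xs = q}"

lemma lists_of_0 [simp]: "lists_of V 0 = {[]}"
  by (auto simp: lists_of_def)

lemma lists_of_Suc: "lists_of V (Suc q) = (\<lambda>(v, xs). v # xs) ` (V \<times> lists_of V q)"
  by (auto simp: lists_of_def length_Suc_conv image_iff)

lemma finite_lists_of [simp]: "finite V \<Longrightarrow> finite (lists_of V q)"
  unfolding lists_of_def by (rule finite_lists_length_eq)

lemma card_lists_of: "finite V \<Longrightarrow> card (lists_of V q) = card V ^ q"
  unfolding lists_of_def by (rule card_lists_length_eq)

lemma sum_lists_of_Suc: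
  assumes "finite V"
  shows "(\<Sum>xs\<in>lists_of V (Suc q). f xs) = (\<Sum>v\<in>V. \<Sum>xs\<in>lists_of V q. f (v # xs))"
proof -
  have "inj_on (\<lambda>(v, xs). v # xs) (V \<times> lists_of V q)" by (auto simp: inj_on_def)
  then have "(\<Sum>xs\<in>lists_of V (Suc q). f xs) = (\<Sum>p\<in>V \<times> lists_of V q. f (fst p # snd p))"
    unfolding lists_of_Suc by (subst sum.reindex) (auto simp: case_prod_beta)
  then show ?thesis using assms by (simp add: sum.cartesian_product case_prod_beta)
qed

lemma ex_popular_vertex:
  fixes \<epsilon> :: real
  assumes "finite V" "finite P" "P \<noteq> {}"
    and "\<And>x. x \<in> P \<Longrightarrow> \<epsilon> * card V \<le> card (D x \<inter> (V - X))" and "0 < \<epsilon>" "V \<noteq> {}"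
  shows "\<exists>v\<in>V - X. \<epsilon> * card P \<le> card {x \<in> P. v \<in> D x}"
proof (rule ccontr)
  assume "\<not> ?thesis"
  then have less: "real (card {x \<in> P. v \<in> D x}) < \<epsilon> * card P" if "v \<in> V - X" for v
    using that by (auto simp: not_le)
  have "\<epsilon> * card V * card P \<le> (\<Sum>x\<in>P. real (card (D x \<inter> (V - X))))"
    using sum_mono[of P "\<lambda>_. \<epsilon> * card V" "\<lambda>x. real (card (D x \<inter> (V - X)))"] assms(4)
    by (simp add: mult.commute)
  also have "\<dots> = (\<Sum>x\<in>P. \<Sum>v\<in>V - X. if v \<in> D x then 1 else 0)"
    using assms(1) by (intro sum.cong) (auto simp: sum.If_cases Int_commute)
  also have "\<dots> = (\<Sum>v\<in>V - X. \<Sum>x\<in>P. if v \<in> D x then 1 else 0)" by (rule sum.swap)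
  also have "\<dots> = (\<Sum>v\<in>V - X. real (card {x \<in> P. v \<in> D x}))"
    using assms(2) by (intro sum.cong) (auto simp: sum.If_cases Int_def)
  finally have *: "\<epsilon> * card V * card P \<le> (\<Sum>v\<in>V - X. real (card {x \<in> P. v \<in> D x}))" .
  have pos: "\<epsilon> * card P > 0" using assms by (simp add: card_gt_0_iff)
  show False
  proof (cases "V - X = {}")
    case True
    then have "\<epsilon> * card V * card P \<le> 0" using * unfolding True by simp
    moreover have "\<epsilon> * card V * card P > 0" using assms by (simp add: card_gt_0_iff)
    ultimately show False by linarith
  next
    case False
    have "(\<Sum>v\<in>V - X. real (card {x \<in> P. v \<in> D x})) < (\<Sum>v\<in>V - X. \<epsilon> * card P)"
      using assms(1) False less by (intro sum_strict_mono) auto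
    also have "\<dots> = real (card (V - X)) * (\<epsilon> * card P)" by simp
    also have "\<dots> \<le> real (card V) * (\<epsilon> * card P)"
      using pos card_mono[of V "V - X"] assms(1) by (intro mult_right_mono) auto
    finally show False using * by (simp add: mult.commute mult.left_commute)
  qed
qed

text \<open>Vertices are chosen greedily. The forbidden set and the vertices chosen so far occupy at
  most half of each \<open>D x\<close>, so an average vertex is still popular, and every choice
  keeps a proportion \<open>\<epsilon>\<close> of \<open>P\<close>.\<close>

lemma ex_popular_set:
  fixes \<epsilon> :: real
  assumes "finite V" "finite P" "P \<noteq> {}" "finite X"
    and "\<And>x. x \<in> P \<Longrightarrow> 2 * \<epsilon> * card V \<le> card (D x \<inter> V)"
    and "0 < \<epsilon>" "real (card X + h) \<le> \<epsilon> * card V" "V \<noteq> {}"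
  shows "\<exists>S\<subseteq>V - X. card S = h \<and> finite S \<and> \<epsilon> ^ h * card P \<le> card {x \<in> P. S \<subseteq> D x}"
  using assms(7)
proof (induction h)
  case (Suc h)
  then obtain S where S: "S \<subseteq> V - X" "card S = h" "finite S" "\<epsilon> ^ h * card P \<le> card {x \<in> P. S \<subseteq> D x}"
    by auto
  let ?P = "{x \<in> P. S \<subseteq> D x}"
  have "\<epsilon> ^ h * card P > 0" using assms by (simp add: card_gt_0_iff)
  then have "card ?P > 0" using S(4) by linarith
  then have ne: "?P \<noteq> {}" by (metis card.empty less_irrefl)
  have "\<exists>v\<in>V - (X \<union> S). \<epsilon> * card ?P \<le> card {x \<in> ?P. v \<in> D x}"
  proof (rule ex_popular_vertex[OF assms(1)])
    fix x assume x: "x \<in> ?P"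
    have "D x \<inter> V \<subseteq> (D x \<inter> (V - (X \<union> S))) \<union> (X \<union> S)" by blast
    then have "card (D x \<inter> V) \<le> card ((D x \<inter> (V - (X \<union> S))) \<union> (X \<union> S))"
      using assms(1,4) S(3) by (intro card_mono) auto
    also have "\<dots> \<le> card (D x \<inter> (V - (X \<union> S))) + card (X \<union> S)" by (rule card_Un_le)
    also have "card (X \<union> S) \<le> card X + h" using card_Un_le[of X S] S(2) by simp
    finally have "real (card (D x \<inter> V)) \<le> card (D x \<inter> (V - (X \<union> S))) + real (card X + h)"
      by linarith
    moreover have "2 * \<epsilon> * card V \<le> card (D x \<inter> V)" using assms(5) x by blast
    ultimately show "\<epsilon> * card V \<le> card (D x \<inter> (V - (X \<union> S)))" using Suc.prems by simp
  qed (use assms ne in auto)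
  then obtain v where v: "v \<in> V - (X \<union> S)" "\<epsilon> * card ?P \<le> card {x \<in> ?P. v \<in> D x}" by blast
  have "{x \<in> ?P. v \<in> D x} = {x \<in> P. insert v S \<subseteq> D x}" by auto
  moreover have "\<epsilon> ^ Suc h * card P \<le> \<epsilon> * card ?P"
    using mult_left_mono[OF S(4), of \<epsilon>] assms(6) by (simp add: mult.assoc)
  ultimately show ?case using S v
    by (intro exI[of _ "insert v S"]) auto
next
  case 0
  show ?case by (intro exI[of _ "{}"]) simp
qed

section \<open>Blow-ups in dense families of tuples\<close>

definition has_blow_up :: "'a list set \<Rightarrow> 'a set \<Rightarrow> nat \<Rightarrow> nat \<Rightarrow> bool" where
  "has_blow_up T W q h \<longleftrightarrow> (\<exists>Bs. length Bs = q \<and> (\<forall>B\<in>set Bs. B \<subseteq> W \<and> card B = h) \<and>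
     (\<forall>i<q. \<forall>j<q. i \<noteq> j \<longrightarrow> Bs ! i \<inter> Bs ! j = {}) \<and> listset Bs \<subseteq> T)"

text \<open>Erdos's theorem on complete \<open>q\<close>-partite hypergraphs, for ordered tuples.\<close>

lemma blow_up_exists:
  fixes \<delta> :: real
  assumes "0 < \<delta>"
  shows "\<exists>N. \<forall>V :: 'a set. \<forall>T X. T \<subseteq> lists_of V q \<longrightarrow> finite V \<longrightarrow> N \<le> card V \<longrightarrow> finite X \<longrightarrow>
    card X \<le> K \<longrightarrow> \<delta> * real (card V) ^ q \<le> card T \<longrightarrow> has_blow_up T (V - X) q h"
  using assms
proof (induction q arbitrary: \<delta> K)
  case 0
  show ?case
  proof (intro exI[of _ 0] allI impI)
    fix V :: "'a set" and T :: "'a list set" and X :: "'a set"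
    assume "T \<subseteq> lists_of V 0" "\<delta> * real (card V) ^ 0 \<le> card T"
    then have "T = {[]}" using 0 by (auto simp: subset_singleton_iff)
    then show "has_blow_up T (V - X) 0 h" by (simp add: has_blow_up_def)
  qed
next
  case (Suc q)
  \<comment> \<open>Half of the density is given up for the tails with few extensions, and half of
    the remaining extensions for the forbidden set.\<close>
  define \<epsilon> where "\<epsilon> = \<delta> / 4"
  have \<epsilon>: "0 < \<epsilon>" "2 * \<epsilon> = \<delta> / 2" using Suc.prems by (simp_all add: \<epsilon>_def)
  have "0 < \<epsilon> ^ h * (\<delta> / 2)" using \<epsilon> Suc.prems by simp
  from Suc.IH[OF this, of "K + h"] obtain N where "\<forall>V :: 'a set. \<forall>T X. T \<subseteq> lists_of V q \<longrightarrow>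
      finite V \<longrightarrow> N \<le> card V \<longrightarrow> finite X \<longrightarrow> card X \<le> K + h \<longrightarrow>
      \<epsilon> ^ h * (\<delta> / 2) * real (card V) ^ q \<le> card T \<longrightarrow> has_blow_up T (V - X) q h" ..
  note N = this[rule_format]
  define N' where "N' = N + 1 + nat \<lceil>real (K + h) / \<epsilon>\<rceil>"
  show ?case
  proof (intro exI[of _ N'] allI impI)
    fix V :: "'a set" and T :: "'a list set" and X :: "'a set"
    assume T: "T \<subseteq> lists_of V (Suc q)" and fV: "finite V" and n: "N' \<le> card V" and X: "finite X" "card X \<le> K"
      and dense: "\<delta> * real (card V) ^ Suc q \<le> card T"
    have V: "V \<noteq> {}" using n by (auto simp: N'_def)
    have "real (K + h) / \<epsilon> \<le> real (nat \<lceil>real (K + h) / \<epsilon>\<rceil>)" by linarith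
    also have "nat \<lceil>real (K + h) / \<epsilon>\<rceil> \<le> card V" using n unfolding N'_def by linarith
    finally have "real (K + h) / \<epsilon> \<le> card V" by simp
    then have "real (K + h) \<le> \<epsilon> * card V" using \<epsilon>(1) by (simp add: field_simps)
    then have Xh: "real (card X + h) \<le> \<epsilon> * card V" using X(2) by simp
    define D where "D xs = {v \<in> V. v # xs \<in> T}" for xs
    \<comment> \<open>The tails with many possible first entries. As the other tails account for at
      most half of \<open>T\<close>, there are at least \<open>\<delta> / 2 * card V ^ q\<close> of
      them.\<close>
    define P where "P = {xs \<in> lists_of V q. 2 * \<epsilon> * card V \<le> card (D xs \<inter> V)}"
    have fP: "finite P" using fV by (simp add: P_def)
    have "real (card T) = (\<Sum>xs\<in>lists_of V (Suc q). if xs \<in> T then 1 else 0)"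
      using T fV by (simp add: sum.If_cases Int_absorb1)
    also have "\<dots> = (\<Sum>xs\<in>lists_of V q. \<Sum>v\<in>V. if v # xs \<in> T then 1 else 0)"
      unfolding sum_lists_of_Suc[OF fV] by (rule sum.swap)
    also have "\<dots> = (\<Sum>xs\<in>lists_of V q. real (card (D xs)))"
      using fV by (intro sum.cong) (auto simp: sum.If_cases D_def Int_def)
    also have "\<dots> \<le> (\<Sum>xs\<in>lists_of V q. 2 * \<epsilon> * card V + (if xs \<in> P then card V else 0))"
    proof (rule sum_mono)
      fix xs assume xs: "xs \<in> lists_of V q"
      have D: "D xs \<inter> V = D xs" by (auto simp: D_def)
      have le: "real (card (D xs)) \<le> card V" using fV by (simp add: card_mono D_def)
      have ge: "0 \<le> 2 * \<epsilon> * card V" using \<epsilon>(1) by simp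
      show "real (card (D xs)) \<le> 2 * \<epsilon> * card V + (if xs \<in> P then card V else 0)"
      proof (cases "xs \<in> P")
        case True
        show ?thesis unfolding if_P[OF True] using le ge by linarith
      next
        case False
        then show ?thesis using xs D by (simp add: P_def)
      qed
    qed
    also have "\<dots> = 2 * \<epsilon> * card V * real (card V) ^ q + real (card V) * card P"
    proof -
      have "P \<subseteq> lists_of V q" by (auto simp: P_def)
      then have "(\<Sum>xs\<in>lists_of V q. real (if xs \<in> P then card V else 0)) = (\<Sum>xs\<in>P. real (card V))"
        using fV by (intro sum.mono_neutral_cong_right) auto
      then show ?thesis using fV by (simp add: sum.distrib card_lists_of)
    qed
    finally have "\<delta> * real (card V) ^ Suc q \<le> \<delta> / 2 * real (card V) ^ Suc q + real (card V) * card P"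
      using dense \<epsilon>(2) by (simp add: mult.assoc)
    then have "real (card V) * (\<delta> / 2 * real (card V) ^ q) \<le> real (card V) * card P"
      by (simp add: algebra_simps)
    then have cP: "\<delta> / 2 * real (card V) ^ q \<le> card P" using V fV by (simp add: card_gt_0_iff)
    moreover have "\<delta> / 2 * real (card V) ^ q > 0" using Suc.prems V fV by (simp add: card_gt_0_iff)
    ultimately have "card P > 0" by linarith
    then have Pne: "P \<noteq> {}" by auto
    have big: "2 * \<epsilon> * card V \<le> card (D x \<inter> V)" if "x \<in> P" for x using that by (simp add: P_def)
    obtain S where S: "S \<subseteq> V - X" "card S = h" "finite S" "\<epsilon> ^ h * card P \<le> card {x \<in> P. S \<subseteq> D x}"
      using ex_popular_set[where D = D, OF fV fP Pne X(1) big \<epsilon>(1) Xh V] by blast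
    have "\<epsilon> ^ h * (\<delta> / 2) * real (card V) ^ q \<le> \<epsilon> ^ h * card P"
      using mult_left_mono[OF cP, of "\<epsilon> ^ h"] \<epsilon>(1) by (simp add: mult.assoc)
    also note S(4)
    \<comment> \<open>The common first entries \<open>S\<close> join the forbidden set, which keeps
      the later classes disjoint from this one.\<close>
    finally have "has_blow_up {x \<in> P. S \<subseteq> D x} (V - (X \<union> S)) q h"
      using fV n X S(2,3) card_Un_le[of X S] by (intro N) (auto simp: P_def N'_def)
    then obtain Bs where Bs: "length Bs = q" "\<forall>B\<in>set Bs. B \<subseteq> V - (X \<union> S) \<and> card B = h"
      "\<forall>i<q. \<forall>j<q. i \<noteq> j \<longrightarrow> Bs ! i \<inter> Bs ! j = {}" "listset Bs \<subseteq> {x \<in> P. S \<subseteq> D x}"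
      unfolding has_blow_up_def by blast
    have SB: "S \<inter> Bs ! i = {}" if "i < q" for i
    proof -
      have "Bs ! i \<in> set Bs" using that Bs(1) by simp
      then show ?thesis using Bs(2) by blast
    qed
    have "(S # Bs) ! i \<inter> (S # Bs) ! j = {}" if "i < Suc q" "j < Suc q" "i \<noteq> j" for i j
      using that Bs(3) SB by (cases i; cases j) (auto simp: Int_commute)
    moreover have "listset (S # Bs) \<subseteq> T"
      using Bs(4) by (auto simp: set_Cons_def D_def)
    moreover have "\<forall>B\<in>set (S # Bs). B \<subseteq> V - X \<and> card B = h" using Bs(2) S by auto
    ultimately show "has_blow_up T (V - X) (Suc q) h"
      unfolding has_blow_up_def using Bs(1) by (intro exI[of _ "S # Bs"]) simp
  qed
qed

section \<open>Deviation of random samples\<close>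

definition cnt :: "('a \<Rightarrow> bool) \<Rightarrow> 'a list \<Rightarrow> nat" where
  "cnt P ys = length (filter P ys)"

text \<open>The variance of a sum of independent indicators. The deviations \<open>d v\<close> sum
  to zero, so the mixed term vanishes when an entry is added, and the squares add at most 1 on
  average.\<close>

lemma sum_cnt_deviation_square:
  assumes fV: "finite V" and "V \<noteq> {}" and \<beta>: "\<beta> = card {v \<in> V. P v} / card V"
  shows "(\<Sum>ys\<in>lists_of V s. (real (cnt P ys) - s * \<beta>)\<^sup>2) \<le> s * real (card V) ^ s"
proof (induction s)
  case 0
  then show ?case by (simp add: cnt_def)
next
  case (Suc s)
  let ?n = "real (card V)"
  have n: "?n > 0" using assms by (simp add: card_gt_0_iff)
  define d where "d v = (if P v then 1 else 0) - \<beta>" for v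
  have d0: "(\<Sum>v\<in>V. d v) = 0"
    using fV n by (simp add: d_def sum_subtractf sum.If_cases Int_def \<beta>)
  have b01: "0 \<le> \<beta>" "\<beta> \<le> 1"
    using n fV card_mono[of V "{v \<in> V. P v}"] by (auto simp: \<beta> divide_simps)
  have d1: "(d v)\<^sup>2 \<le> 1" for v
    using b01 by (auto simp: d_def abs_square_le_1)
  define c where "c ys = real (cnt P ys) - s * \<beta>" for ys
  have eq: "real (cnt P (v # ys)) - real (Suc s) * \<beta> = c ys + d v" for v ys
    by (simp add: cnt_def c_def d_def algebra_simps)
  have "(\<Sum>ys\<in>lists_of V (Suc s). (real (cnt P ys) - real (Suc s) * \<beta>)\<^sup>2)
      = (\<Sum>v\<in>V. \<Sum>ys\<in>lists_of V s. (c ys + d v)\<^sup>2)"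
    unfolding sum_lists_of_Suc[OF fV] eq ..
  also have "\<dots> = (\<Sum>v\<in>V. (\<Sum>ys\<in>lists_of V s. (c ys)\<^sup>2) + d v * (2 * (\<Sum>ys\<in>lists_of V s. c ys))
      + ?n ^ s * (d v)\<^sup>2)"
    by (intro sum.cong refl)
      (simp add: power2_sum sum.distrib card_lists_of[OF fV] sum_distrib_left sum_distrib_right algebra_simps)
  also have "\<dots> = ?n * (\<Sum>ys\<in>lists_of V s. (c ys)\<^sup>2) + (\<Sum>v\<in>V. d v) * (2 * (\<Sum>ys\<in>lists_of V s. c ys))
      + ?n ^ s * (\<Sum>v\<in>V. (d v)\<^sup>2)"
    by (simp add: sum.distrib sum_distrib_left[symmetric] sum_distrib_right[symmetric])
  also have "\<dots> \<le> ?n * (s * ?n ^ s) + 0 + ?n ^ s * ?n"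
  proof -
    have "(\<Sum>v\<in>V. (d v)\<^sup>2) \<le> ?n" using sum_mono[of V "\<lambda>v. (d v)\<^sup>2" "\<lambda>_. 1"] d1 by simp
    moreover have "(\<Sum>ys\<in>lists_of V s. (c ys)\<^sup>2) \<le> s * ?n ^ s" using Suc by (simp add: c_def)
    ultimately show ?thesis unfolding d0 by (intro add_mono mult_left_mono) auto
  qed
  also have "\<dots> = real (Suc s) * ?n ^ Suc s" by (simp add: algebra_simps)
  finally show ?case .
qed

text \<open>Chebyshev's inequality; only the upper tail matters, so an upper bound on the proportion
  suffices.\<close>

lemma card_large_deviation:
  fixes a \<mu> :: real
  assumes fV: "finite V" and "V \<noteq> {}" and "card {v \<in> V. P v} \<le> \<mu> * card V" and "0 < a"
  shows "a\<^sup>2 * card {ys \<in> lists_of V s. s * \<mu> + a \<le> cnt P ys} \<le> s * real (card V) ^ s"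
proof -
  define \<beta> where "\<beta> = card {v \<in> V. P v} / card V"
  have \<beta>: "\<beta> \<le> \<mu>" using assms by (simp add: \<beta>_def divide_simps card_gt_0_iff)
  let ?B = "{ys \<in> lists_of V s. s * \<mu> + a \<le> cnt P ys}"
  have fB: "finite (lists_of V s)" using fV by simp
  have "a\<^sup>2 * card ?B = (\<Sum>ys\<in>?B. a\<^sup>2)" by (simp add: mult.commute)
  also have "\<dots> \<le> (\<Sum>ys\<in>?B. (real (cnt P ys) - s * \<beta>)\<^sup>2)"
  proof (rule sum_mono)
    fix ys assume "ys \<in> ?B"
    moreover have "s * \<beta> \<le> s * \<mu>" using \<beta> by (simp add: mult_left_mono)
    ultimately have "a \<le> real (cnt P ys) - s * \<beta>" by auto
    then show "a\<^sup>2 \<le> (real (cnt P ys) - s * \<beta>)\<^sup>2" using \<open>0 < a\<close> by (intro power_mono) auto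
  qed
  also have "\<dots> \<le> (\<Sum>ys\<in>lists_of V s. (real (cnt P ys) - s * \<beta>)\<^sup>2)"
    using fB by (intro sum_mono2) auto
  also have "\<dots> \<le> s * real (card V) ^ s"
    by (rule sum_cnt_deviation_square[OF fV assms(2) \<beta>_def])
  finally show ?thesis .
qed

text \<open>Here the property depends on an entry of the sample itself. For a fixed value of that
  entry the remaining ones are independent, and the summand 1 accounts for the contribution of the
  entry itself.\<close>

lemma card_large_deviation_nth:
  fixes a \<mu> :: real
  assumes fV: "finite V" and ne: "V \<noteq> {}" and P: "\<And>v. v \<in> V \<Longrightarrow> card {p \<in> V. P v p} \<le> \<mu> * card V"
    and a: "0 < a" and "j < s" and "0 \<le> \<mu>"
  shows "a\<^sup>2 * card {ys \<in> lists_of V s. s * \<mu> + a + 1 \<le> cnt (P (ys ! j)) ys} \<le> s * real (card V) ^ s"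
proof -
  let ?B = "{ys \<in> lists_of V s. s * \<mu> + a + 1 \<le> cnt (P (ys ! j)) ys}"
  obtain s' where s: "s = Suc s'" using \<open>j < s\<close> by (cases s) auto
  let ?C = "\<lambda>v. {zs \<in> lists_of V s'. s' * \<mu> + a \<le> cnt (P v) zs}"
  define f where "f ys = (ys ! j, take j ys @ drop (Suc j) ys)" for ys :: "'a list"
  have "inj_on f ?B"
  proof (rule inj_onI)
    fix xs ys assume xy: "xs \<in> ?B" "ys \<in> ?B" "f xs = f ys"
    then have "length xs = s" "length ys = s" by (auto simp: lists_of_def)
    moreover from this have "take j xs = take j ys" "drop (Suc j) xs = drop (Suc j) ys" "xs ! j = ys ! j"
      using xy(3) \<open>j < s\<close> by (auto simp: f_def)
    ultimately show "xs = ys" using \<open>j < s\<close> by (metis id_take_nth_drop)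
  qed
  then have "card ?B = card (f ` ?B)" by (simp add: card_image)
  also have "\<dots> \<le> card (SIGMA v:V. ?C v)"
  proof (rule card_mono)
    show "f ` ?B \<subseteq> (SIGMA v:V. ?C v)"
    proof
      fix z assume "z \<in> f ` ?B"
      then obtain ys where ys: "ys \<in> ?B" "z = f ys" by blast
      let ?v = "ys ! j" and ?zs = "take j ys @ drop (Suc j) ys"
      have len: "length ys = s" "set ys \<subseteq> V" using ys by (auto simp: lists_of_def)
      have "ys = take j ys @ ?v # drop (Suc j) ys" using len \<open>j < s\<close> by (metis id_take_nth_drop)
      then have "cnt (P ?v) ys = cnt (P ?v) (take j ys @ ?v # drop (Suc j) ys)" by simp
      also have "\<dots> \<le> cnt (P ?v) ?zs + 1" by (simp add: cnt_def)
      finally have "real (cnt (P ?v) ys) \<le> cnt (P ?v) ?zs + 1" by linarith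
      moreover have "s * \<mu> + a + 1 \<le> cnt (P ?v) ys" using ys by auto
      moreover have "s' * \<mu> \<le> s * \<mu>" using s \<open>0 \<le> \<mu>\<close> by (simp add: mult_right_mono)
      ultimately have "s' * \<mu> + a \<le> cnt (P ?v) ?zs" by linarith
      moreover have "?zs \<in> lists_of V s'"
        using len \<open>j < s\<close> s set_take_subset[of j ys] set_drop_subset[of "Suc j" ys]
        by (auto simp: lists_of_def)
      moreover have "?v \<in> V" using len \<open>j < s\<close> nth_mem by blast
      ultimately show "z \<in> (SIGMA v:V. ?C v)" using ys(2) by (auto simp: f_def)
    qed
  qed (use fV in auto)
  also have "\<dots> = (\<Sum>v\<in>V. card (?C v))" using fV by simp
  finally have "real (card ?B) \<le> real (\<Sum>v\<in>V. card (?C v))" by (rule of_nat_mono)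
  then have "a\<^sup>2 * card ?B \<le> a\<^sup>2 * real (\<Sum>v\<in>V. card (?C v))" by (rule mult_left_mono) simp
  also have "\<dots> = (\<Sum>v\<in>V. a\<^sup>2 * card (?C v))" by (simp add: sum_distrib_left)
  also have "\<dots> \<le> (\<Sum>v\<in>V. s' * real (card V) ^ s')"
    by (intro sum_mono card_large_deviation[OF fV ne P a])
  also have "\<dots> = s' * real (card V) ^ s" by (simp add: s)
  also have "\<dots> \<le> s * real (card V) ^ s" using s by (intro mult_right_mono) auto
  finally show ?thesis .
qed

section \<open>Samples of graphs far from being colourable\<close>

definition list_colourable :: "('a \<Rightarrow> 'a \<Rightarrow> bool) \<Rightarrow> 'a set \<Rightarrow> ('a \<Rightarrow> nat set) \<Rightarrow> bool" where
  "list_colourable A S L \<longleftrightarrow>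
     (\<exists>f. (\<forall>v\<in>S. f v \<in> L v) \<and> (\<forall>u\<in>S. \<forall>v\<in>S. A u v \<longrightarrow> f u \<noteq> f v))"

text \<open>In the sampling argument there is one block for each colour of a chosen vertex, refuting
  that colour.\<close>

fun concats :: "'a list set list \<Rightarrow> 'a list set" where
  "concats [] = {[]}"
| "concats (S # Ss) = (\<lambda>(a, b). a @ b) ` (S \<times> concats Ss)"

lemma concats_subset:
  "\<forall>S\<in>set Ss. S \<subseteq> lists_of V t \<Longrightarrow> concats Ss \<subseteq> lists_of V (length Ss * t)"
proof (induction Ss)
  case (Cons S Ss)
  show ?case
  proof
    fix z assume "z \<in> concats (S # Ss)"
    then obtain a b where ab: "z = a @ b" "a \<in> S" "b \<in> concats Ss" by auto
    then have "a \<in> lists_of V t" "b \<in> lists_of V (length Ss * t)" using Cons by auto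
    then show "z \<in> lists_of V (length (S # Ss) * t)" using ab(1) by (simp add: lists_of_def)
  qed
qed simp

lemma card_concats:
  fixes d :: real
  assumes "\<forall>S\<in>set Ss. S \<subseteq> lists_of V t \<and> d \<le> card S" and "finite V" and "0 \<le> d"
  shows "d ^ length Ss \<le> card (concats Ss)"
  using assms(1)
proof (induction Ss)
  case (Cons S Ss)
  have "inj_on (\<lambda>(a, b). a @ b) (S \<times> concats Ss)"
  proof (rule inj_onI, clarify)
    fix a b a' b' assume "a \<in> S" "a' \<in> S" "a @ b = a' @ b'"
    moreover from this have "length a = length a'" using Cons.prems by (auto simp: lists_of_def subset_iff)
    ultimately show "a = a' \<and> b = b'" by simp
  qed
  then have "card (concats (S # Ss)) = card S * card (concats Ss)"
    by (simp add: card_image card_cartesian_product)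
  moreover have "d * d ^ length Ss \<le> real (card S) * real (card (concats Ss))"
    using Cons \<open>0 \<le> d\<close> by (intro mult_mono) auto
  ultimately show ?case by simp
qed simp

lemma concats_nth:
  assumes "ws \<in> concats Ss" "i < length Ss"
  shows "\<exists>w\<in>Ss ! i. set w \<subseteq> set ws"
  using assms
proof (induction Ss arbitrary: ws i)
  case (Cons S Ss)
  then obtain a b where ab: "ws = a @ b" "a \<in> S" "b \<in> concats Ss" by auto
  show ?case
  proof (cases i)
    case 0 then show ?thesis using ab by auto
  next
    case (Suc j)
    then obtain w where "w \<in> Ss ! j" "set w \<subseteq> set b" using Cons.IH[OF ab(3), of j] Cons.prems by auto
    then show ?thesis using Suc ab by auto
  qed
qed simp

text \<open>One vertex, followed by a block of the previous size for each of its \<open>r\<close>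
  colours.\<close>

fun sample_size :: "nat \<Rightarrow> nat \<Rightarrow> nat" where
  "sample_size r 0 = 1"
| "sample_size r (Suc k) = Suc (r * sample_size r k)"

text \<open>If colouring few vertices restricts the lists of many others, one such vertex is chosen and
  the argument is repeated for each of its colours; otherwise a cheap choice of colours would
  be an almost proper colouring.\<close>

lemma many_uncolourable_samples:
  fixes \<gamma> :: real
  assumes fV: "finite V" and ne: "V \<noteq> {}" and sym: "\<And>u v. A u v \<Longrightarrow> A v u" and \<gamma>: "0 < \<gamma>" "\<gamma> \<le> 1" and "r > 0"
    and far: "\<And>f. f ` V \<subseteq> {..<r} \<Longrightarrow>
      3 * \<gamma> * (real (card V))\<^sup>2 < card {(u, v). u \<in> V \<and> v \<in> V \<and> A u v \<and> f u = (f v :: nat)}"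
    and L: "\<And>v. v \<in> V \<Longrightarrow> L v \<subseteq> {..<r}" and "(\<Sum>v\<in>V. real (card (L v))) \<le> k * (\<gamma> * card V)"
  shows "(\<gamma> * card V) ^ sample_size r k \<le>
    card {ws \<in> lists_of V (sample_size r k). \<not> list_colourable A (set ws) L}"
  using assms(8,9)
proof (induction k arbitrary: L)
  case (0 L)
  have "(\<Sum>v\<in>V. real (card (L v))) = 0" using 0(2) by (simp add: sum_nonneg order_antisym)
  then have "card (L v) = 0" if "v \<in> V" for v
    using fV that by (simp add: sum_nonneg_eq_0_iff)
  moreover have "finite (L v)" if "v \<in> V" for v using 0(1)[OF that] finite_subset by blast
  ultimately have "L v = {}" if "v \<in> V" for v using that by simp
  then have "{ws \<in> lists_of V 1. \<not> list_colourable A (set ws) L} = lists_of V 1"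
    by (auto simp: lists_of_def list_colourable_def length_Suc_conv)
  moreover have "\<gamma> * card V \<le> card V" using \<gamma> by (simp add: mult_left_le_one_le)
  ultimately show ?case using fV by (simp add: card_lists_of del: One_nat_def)
next
  case (Suc k L)
  let ?n = "real (card V)" and ?t = "sample_size r k"
  have n: "?n > 0" using fV ne by (simp add: card_gt_0_iff)
  have fL: "finite (L v)" if "v \<in> V" for v using Suc.prems(1)[OF that] finite_subset by blast
  \<comment> \<open>For \<open>x\<close> in \<open>B\<close>, each colour in the list of
    \<open>x\<close> restricts the lists of at least \<open>\<gamma> * card V\<close>
    neighbours.\<close>
  define B where "B = {x \<in> V. \<forall>i\<in>L x. \<gamma> * ?n \<le> card {u \<in> V. A x u \<and> i \<in> L u}}"
  have fB: "finite B" "B \<subseteq> V" using fV by (auto simp: B_def)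
  have cB: "\<gamma> * ?n \<le> card B"
  proof (rule ccontr)
    assume small: "\<not> ?thesis"
    have "\<exists>f. \<forall>v\<in>V - B. f v \<in> L v \<and> card {u \<in> V. A v u \<and> f v \<in> L u} < \<gamma> * ?n"
      by (rule bchoice) (auto simp: B_def not_le)
    then obtain f where f: "\<And>v. v \<in> V - B \<Longrightarrow> f v \<in> L v"
      "\<And>v. v \<in> V - B \<Longrightarrow> card {u \<in> V. A v u \<and> f v \<in> L u} < \<gamma> * ?n" by blast
    \<comment> \<open>Outside \<open>B\<close> the cheap colours are used, on \<open>B\<close> the
      colour 0. If \<open>B\<close> were small, the pairs meeting \<open>B\<close> would number at
      most \<open>2 * \<gamma> * card V ^ 2\<close> and the remaining monochromatic ones at most
      \<open>\<gamma> * card V ^ 2\<close>, against \<open>far\<close>.\<close>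
    define h where "h v = (if v \<in> B then 0 else f v)" for v
    have "h v < r" if "v \<in> V" for v using f(1)[of v] Suc.prems(1) that \<open>r > 0\<close> by (auto simp: h_def)
    then have hV: "h ` V \<subseteq> {..<r}" by blast
    let ?E = "{(u, v). u \<in> V \<and> v \<in> V \<and> A u v \<and> h u = h v}"
    let ?S = "SIGMA v:V - B. {u \<in> V. A v u \<and> f v \<in> L u}"
    have fS: "finite ?S" using fV by auto
    have "?E \<subseteq> B \<times> V \<union> V \<times> B \<union> ?S"
    proof
      fix p assume "p \<in> ?E"
      then obtain u v where p: "p = (u, v)" "u \<in> V" "v \<in> V" "A u v" "h u = h v" by auto
      show "p \<in> B \<times> V \<union> V \<times> B \<union> ?S"
      proof (cases "u \<in> B \<or> v \<in> B")
        case False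
        then have "f u = f v" using p by (simp add: h_def)
        then have "f u \<in> L v" using f(1)[of v] False p by simp
        then show ?thesis using False p by auto
      qed (use p in auto)
    qed
    then have "card ?E \<le> card (B \<times> V \<union> V \<times> B \<union> ?S)"
      by (rule card_mono[rotated]) (use fV fB fS in auto)
    also have "\<dots> \<le> card (B \<times> V) + card (V \<times> B) + card ?S"
      using card_Un_le[of "B \<times> V \<union> V \<times> B" ?S] card_Un_le[of "B \<times> V" "V \<times> B"] by linarith
    also have "\<dots> = 2 * (card B * card V) + card ?S" by (simp add: card_cartesian_product mult.commute)
    finally have "real (card ?E) \<le> real (2 * (card B * card V) + card ?S)" by (rule of_nat_mono)
    also have "\<dots> = 2 * (card B * ?n) + real (card ?S)" by simp
    also have "real (card ?S) = (\<Sum>v\<in>V - B. real (card {u \<in> V. A v u \<and> f v \<in> L u}))"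
      using fV by simp
    also have "\<dots> \<le> (\<Sum>v\<in>V - B. \<gamma> * ?n)" using f(2) by (intro sum_mono less_imp_le) auto
    also have "\<dots> \<le> ?n * (\<gamma> * ?n)"
      using \<gamma> fV by (simp add: card_mono mult_right_mono)
    also have "2 * (card B * ?n) \<le> 2 * (\<gamma> * ?n * ?n)" using small n by (simp add: mult_right_mono)
    finally have "real (card ?E) \<le> 3 * \<gamma> * ?n\<^sup>2" by (simp add: power2_eq_square algebra_simps)
    then show False using far[OF hV] by simp
  qed
  \<comment> \<open>The lists left after \<open>x\<close> has been given colour \<open>i\<close>.
    For \<open>x\<close> in \<open>B\<close> their total size is smaller by at least
    \<open>\<gamma> * card V\<close>, so \<open>k\<close> drops by one.\<close>
  define L' where "L' x i u = (if A x u then L u - {i} else L u)" for x i u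
  define NC where "NC L = {ws \<in> lists_of V ?t. \<not> list_colourable A (set ws) L}" for L
  \<comment> \<open>Block \<open>i\<close> must be uncolourable from the restricted lists. For a
    colour that \<open>x\<close> cannot take, any block will do.\<close>
  define Ss where "Ss x = map (\<lambda>i. if i \<in> L x then NC (L' x i) else lists_of V ?t) [0..<r]" for x
  have NC: "(\<gamma> * ?n) ^ ?t \<le> card (NC (L' x i))" if x: "x \<in> B" and i: "i \<in> L x" for x i
    unfolding NC_def
  proof (rule Suc.IH)
    show "L' x i v \<subseteq> {..<r}" if "v \<in> V" for v using Suc.prems(1)[OF that] by (auto simp: L'_def)
    have "real (card (L' x i v)) + (if A x v \<and> i \<in> L v then 1 else 0) = real (card (L v))" if "v \<in> V" for v
    proof (cases "A x v \<and> i \<in> L v")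
      case True
      then have "Suc (card (L v - {i})) = card (L v)" using card_Suc_Diff1[OF fL[OF that]] by blast
      then show ?thesis using True by (simp add: L'_def)
    qed (auto simp: L'_def)
    then have "(\<Sum>v\<in>V. real (card (L v))) =
        (\<Sum>v\<in>V. real (card (L' x i v)) + (if A x v \<and> i \<in> L v then 1 else 0))" by simp
    also have "\<dots> = (\<Sum>v\<in>V. real (card (L' x i v))) + card {v \<in> V. A x v \<and> i \<in> L v}"
      using fV by (simp add: sum.distrib sum.If_cases Int_def)
    finally have "(\<Sum>v\<in>V. real (card (L' x i v))) + card {v \<in> V. A x v \<and> i \<in> L v} \<le> real (Suc k) * (\<gamma> * ?n)"
      using Suc.prems(2) by simp
    moreover have "\<gamma> * ?n \<le> card {v \<in> V. A x v \<and> i \<in> L v}" using x i by (simp add: B_def)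
    ultimately show "(\<Sum>v\<in>V. real (card (L' x i v))) \<le> k * (\<gamma> * ?n)"
      by (simp add: algebra_simps)
  qed
  have Ss: "S \<subseteq> lists_of V ?t \<and> (\<gamma> * ?n) ^ ?t \<le> card S" if "x \<in> B" and S: "S \<in> set (Ss x)" for x S
  proof -
    obtain i where "S = (if i \<in> L x then NC (L' x i) else lists_of V ?t)"
      using S unfolding Ss_def set_map by blast
    moreover have "(\<gamma> * ?n) ^ ?t \<le> ?n ^ ?t"
      using \<gamma> by (intro power_mono) (auto simp: mult_left_le_one_le)
    ultimately show ?thesis using NC[OF that(1), of i] fV by (auto simp: NC_def card_lists_of)
  qed
  have len: "length (Ss x) = r" for x by (simp add: Ss_def)
  have cc: "(\<gamma> * ?n) ^ (r * ?t) \<le> card (concats (Ss x))" if "x \<in> B" for x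
    using card_concats[of "Ss x" V ?t "(\<gamma> * ?n) ^ ?t"] Ss[OF that] fV \<gamma>
    by (simp add: len power_mult[symmetric] mult.commute)
  have csub: "concats (Ss x) \<subseteq> lists_of V (r * ?t)" if "x \<in> B" for x
    using concats_subset[of "Ss x" V ?t] Ss[OF that] len by auto
  let ?X = "SIGMA x:B. concats (Ss x)"
  let ?R = "{ws \<in> lists_of V (sample_size r (Suc k)). \<not> list_colourable A (set ws) L}"
  \<comment> \<open>A colouring of \<open>x # ws\<close> would colour the block belonging to the
    colour of \<open>x\<close> from the lists restricted by that colour.\<close>
  have sub: "(\<lambda>(x, ws). x # ws) ` ?X \<subseteq> ?R"
  proof
    fix z assume "z \<in> (\<lambda>(x, ws). x # ws) ` ?X"
    then obtain x ws where z: "z = x # ws" "x \<in> B" "ws \<in> concats (Ss x)" by auto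
    have "\<not> list_colourable A (set z) L"
    proof
      assume "list_colourable A (set z) L"
      then obtain f where f: "\<And>v. v \<in> set z \<Longrightarrow> f v \<in> L v"
        "\<And>u v. u \<in> set z \<Longrightarrow> v \<in> set z \<Longrightarrow> A u v \<Longrightarrow> f u \<noteq> f v" unfolding list_colourable_def by blast
      have fx: "f x \<in> L x" "f x < r" using f(1)[of x] z fB(2) Suc.prems(1)[of x] by auto
      then have "Ss x ! f x = NC (L' x (f x))" by (simp add: Ss_def)
      then obtain w where w: "w \<in> NC (L' x (f x))" "set w \<subseteq> set ws"
        using concats_nth[OF z(3), of "f x"] fx len by auto
      have "list_colourable A (set w) (L' x (f x))"
        unfolding list_colourable_def
      proof (intro exI[of _ f] conjI ballI impI)
        fix v assume "v \<in> set w"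
        then have "v \<in> set z" using w(2) z(1) by auto
        then show "f v \<in> L' x (f x) v" using f(1)[of v] f(2)[of x v] z(1) by (auto simp: L'_def)
      next
        fix u v assume "u \<in> set w" "v \<in> set w" "A u v"
        then show "f u \<noteq> f v" using f(2)[of u v] w(2) z(1) by auto
      qed
      then show False using w(1) by (simp add: NC_def)
    qed
    moreover have "z \<in> lists_of V (sample_size r (Suc k))"
      using z csub[OF z(2)] fB(2) by (auto simp: lists_of_def)
    ultimately show "z \<in> ?R" by blast
  qed
  have "card ?X \<le> card ?R"
  proof (rule card_inj_on_le[OF _ sub])
    show "inj_on (\<lambda>(x, ws). x # ws) ?X" by (auto simp: inj_on_def)
  qed (use fV in simp)
  moreover have "(\<gamma> * ?n) ^ sample_size r (Suc k) \<le> card ?X"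
  proof -
    have fin: "finite (concats (Ss x))" if "x \<in> B" for x
      using csub[OF that] finite_lists_of[OF fV] finite_subset by blast
    have "(\<gamma> * ?n) ^ sample_size r (Suc k) = \<gamma> * ?n * (\<gamma> * ?n) ^ (r * ?t)" by simp
    also have "\<dots> \<le> card B * (\<gamma> * ?n) ^ (r * ?t)" using cB \<gamma> by (intro mult_right_mono) auto
    also have "\<dots> = (\<Sum>x\<in>B. (\<gamma> * ?n) ^ (r * ?t))" by simp
    also have "\<dots> \<le> (\<Sum>x\<in>B. real (card (concats (Ss x))))" by (intro sum_mono cc)
    also have "\<dots> = card ?X" using fB fin by simp
    finally show ?thesis .
  qed
  ultimately show ?case by linarith
qed

section \<open>Transfer from bounded samples to large \<open>H\<close>-free graphs\<close>

section \<open>From exact to approximate colourings\<close>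

lemma cnt_eq_card: "cnt P ys = card {j. j < length ys \<and> P (ys ! j)}"
  unfolding cnt_def by (rule length_filter_conv_card)

text \<open>The uncolourable part \<open>ws\<close> alone need not be dense. Together with those
  entries of \<open>ys\<close> that miss at most \<open>b\<close> others it is, as the few entries
  of \<open>ws\<close> hardly count. Without an image of some \<open>K_{r-3} + F_i\<close> the
  enlarged sample, and with it \<open>ws\<close>, would be colourable.\<close>

lemma sample_maps_to:
  fixes b :: real
  assumes sym: "\<And>u v. A u v \<Longrightarrow> A v u" and irrefl: "\<And>v. \<not> A v v" and r: "r \<ge> 3" and g: "1 \<le> g" "g \<le> 11"
    and nc: "\<not> list_colourable A (set ws) (\<lambda>_. {..<r})"
    and ws: "\<And>v. v \<in> set ws \<Longrightarrow> cnt (\<lambda>p. \<not> A v p) ys \<le> b"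
    and dense: "(real r - 1 + c_const g) * (b + length ws) <
      card {j. j < length ys \<and> cnt (\<lambda>p. \<not> A (ys ! j) p) ys \<le> b}" and "0 \<le> b"
  shows "\<exists>i. 1 \<le> i \<and> i \<le> g \<and> maps_to (join (complete_graph (r - 3)) (F_graph i))
    {..<length (ws @ ys)} (\<lambda>i j. A ((ws @ ys) ! i) ((ws @ ys) ! j))"
proof (rule ccontr)
  let ?t = "length ws" and ?xs = "ws @ ys"
  let ?A = "\<lambda>i j. A (?xs ! i) (?xs ! j)"
  define J where "J = {j. j < length ys \<and> cnt (\<lambda>p. \<not> A (ys ! j) p) ys \<le> b}"
  \<comment> \<open>Positions are used as vertices because entries may repeat; equal entries become
    non-adjacent twins.\<close>
  define V where "V = {..<?t} \<union> (+) ?t ` J"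
  define m where "m = ?t + nat \<lfloor>b\<rfloor>"
  let ?B = "induced V ?A"
  assume no: "\<not> ?thesis"
  have fJ: "finite J" by (simp add: J_def)
  have VL: "V \<subseteq> {..<length ?xs}" by (auto simp: V_def J_def)
  have good: "cnt (\<lambda>p. \<not> A (?xs ! v) p) ys \<le> nat \<lfloor>b\<rfloor>" if "v \<in> V" for v
  proof (rule le_nat_floor)
    show "real (cnt (\<lambda>p. \<not> A (?xs ! v) p) ys) \<le> b"
    proof (cases "v < ?t")
      case True then show ?thesis using ws[of "ws ! v"] by (simp add: nth_append)
    next
      case False
      then obtain j where "v = ?t + j" "j \<in> J" using \<open>v \<in> V\<close> by (auto simp: V_def)
      then show ?thesis by (simp add: J_def)
    qed
  qed
  have "dense_graph V ?B m"
  proof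
    fix v assume v: "v \<in> V"
    let ?C = "{j. j < length ys \<and> \<not> A (?xs ! v) (ys ! j)}"
    have "{p \<in> V. \<not> ?B p v} \<subseteq> {..<?t} \<union> (+) ?t ` ?C"
    proof
      fix p assume p: "p \<in> {p \<in> V. \<not> ?B p v}"
      then have np: "\<not> A (?xs ! v) (?xs ! p)" using v sym by (auto simp: induced_def)
      show "p \<in> {..<?t} \<union> (+) ?t ` ?C"
      proof (cases "p < ?t")
        case False
        then obtain j where "p = ?t + j" "j < length ys" using p by (auto simp: V_def J_def)
        then show ?thesis using np by simp
      qed simp
    qed
    then have "card {p \<in> V. \<not> ?B p v} \<le> card ({..<?t} \<union> (+) ?t ` ?C)" by (rule card_mono[rotated]) simp
    also have "\<dots> \<le> card {..<?t} + card ((+) ?t ` ?C)" by (rule card_Un_le)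
    also have "card ((+) ?t ` ?C) \<le> card ?C" by (rule card_image_le) simp
    also have "card ?C = cnt (\<lambda>p. \<not> A (?xs ! v) p) ys" by (simp add: cnt_eq_card)
    also have "\<dots> \<le> nat \<lfloor>b\<rfloor>" by (rule good) fact
    finally show "card {p \<in> V. \<not> ?B p v} \<le> m" by (simp add: m_def)
  next
    show "finite V" using fJ by (simp add: V_def)
  qed (use sym irrefl in \<open>auto simp: induced_def\<close>)
  moreover have "\<not> maps_to (join (complete_graph (r - 3)) (F_graph i)) V ?B" if "1 \<le> i" "i \<le> g" for i
  proof
    assume "maps_to (join (complete_graph (r - 3)) (F_graph i)) V ?B"
    then obtain \<phi> where "\<phi> ` verts (join (complete_graph (r - 3)) (F_graph i)) \<subseteq> V"
      "\<forall>u v. {u, v} \<in> edges (join (complete_graph (r - 3)) (F_graph i)) \<longrightarrow> ?B (\<phi> u) (\<phi> v)"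
      unfolding maps_to_def by blast
    then have "maps_to (join (complete_graph (r - 3)) (F_graph i)) {..<length ?xs} ?A"
      unfolding maps_to_def using VL
      by (intro exI[of _ \<phi>] conjI) (blast, simp add: induced_def)
    then show False using no that by blast
  qed
  moreover have "(real r - 1 + c_const g) * real m < real (card V)"
  proof -
    have "c_const g \<ge> 1/7" using c_const_antimono[of g 11] g c_const_values(11) by simp
    then have R: "real r - 1 + c_const g \<ge> 0" using r by simp
    have "real (nat \<lfloor>b\<rfloor>) \<le> b" using \<open>0 \<le> b\<close> by (simp add: of_nat_nat)
    then have "real m \<le> b + ?t" by (simp add: m_def)
    then have "(real r - 1 + c_const g) * real m \<le> (real r - 1 + c_const g) * (b + ?t)"
      using R by (rule mult_left_mono)
    also have "\<dots> < card J" using dense by (simp add: J_def)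
    also have "card J = card ((+) ?t ` J)" by (simp add: card_image)
    also have "card ((+) ?t ` J) \<le> card V" using fJ by (intro card_mono) (auto simp: V_def)
    finally show ?thesis by simp
  qed
  ultimately obtain f :: "nat \<Rightarrow> nat" where f: "f ` V \<subseteq> {..<r}" "\<forall>x y. ?B x y \<longrightarrow> f x \<noteq> f y"
    using colourable_if_hom_free[of V ?B m r g] r g by blast
  have "\<forall>v\<in>set ws. \<exists>i. i < ?t \<and> ws ! i = v" by (simp add: in_set_conv_nth)
  then obtain pos where pos: "\<And>v. v \<in> set ws \<Longrightarrow> pos v < ?t \<and> ws ! pos v = v" by metis
  have posV: "pos v \<in> V" "?xs ! pos v = v" if "v \<in> set ws" for v
    using pos[OF that] by (auto simp: V_def nth_append)
  have "list_colourable A (set ws) (\<lambda>_. {..<r})"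
    unfolding list_colourable_def
  proof (intro exI[of _ "f \<circ> pos"] conjI ballI impI)
    show "(f \<circ> pos) v \<in> {..<r}" if "v \<in> set ws" for v using f(1) posV[OF that] by auto
    show "(f \<circ> pos) u \<noteq> (f \<circ> pos) v" if "u \<in> set ws" "v \<in> set ws" "A u v" for u v
    proof -
      have "?B (pos u) (pos v)" using that posV[of u] posV[of v] by (simp add: induced_def)
      then show ?thesis using f(2) by simp
    qed
  qed
  then show False using nc by blast
qed

lemma in_listset_iff: "xs \<in> listset Bs \<longleftrightarrow> length xs = length Bs \<and> (\<forall>i<length Bs. xs ! i \<in> Bs ! i)"
proof (induction Bs arbitrary: xs)
  case (Cons B Bs)
  show ?case
  proof (cases xs)
    case (Cons y ys)
    then have "xs \<in> listset (B # Bs) \<longleftrightarrow> y \<in> B \<and> ys \<in> listset Bs" by (simp add: set_Cons_def)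
    then show ?thesis using Cons Cons.IH[of ys] by (auto simp: less_Suc_eq_0_disj)
  qed (simp add: set_Cons_def)
qed simp

text \<open>Here \<open>\<psi>\<close> names the class into which a vertex of \<open>H\<close> goes.
  Classes with \<open>card (verts H)\<close> elements have room for all vertices of
  \<open>H\<close>, so even vertices sharing a class get distinct images, and the image of
  \<open>H\<close> becomes a copy.\<close>

lemma not_free_if_blow_up:
  assumes H: "simple_graph H" and G: "simple_graph G"
    and T: "\<And>xs a b. xs \<in> T \<Longrightarrow> {a, b} \<in> edges H \<Longrightarrow> {xs ! \<psi> a, xs ! \<psi> b} \<in> edges G"
    and blow: "has_blow_up T (verts G) q (card (verts H))" and \<psi>: "\<And>a. a \<in> verts H \<Longrightarrow> \<psi> a < q"
  shows "\<not> free_of H G"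
proof -
  obtain Bs where "length Bs = q \<and> (\<forall>B\<in>set Bs. B \<subseteq> verts G \<and> card B = card (verts H)) \<and>
    (\<forall>i<q. \<forall>j<q. i \<noteq> j \<longrightarrow> Bs ! i \<inter> Bs ! j = {}) \<and> listset Bs \<subseteq> T"
    using blow unfolding has_blow_up_def ..
  then have Bs: "length Bs = q" "\<And>B. B \<in> set Bs \<Longrightarrow> B \<subseteq> verts G \<and> card B = card (verts H)"
    "\<And>i j. i < q \<Longrightarrow> j < q \<Longrightarrow> i \<noteq> j \<Longrightarrow> Bs ! i \<inter> Bs ! j = {}" "listset Bs \<subseteq> T" by simp_all
  have fH: "finite (verts H)" and fG: "finite (verts G)" using H G by (simp_all add: simple_graph_def)
  have B: "Bs ! p \<subseteq> verts G" "card (Bs ! p) = card (verts H)" if "p < q" for p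
    using Bs(1,2) that nth_mem[of p Bs] by auto
  have "\<exists>f. bij_betw f (verts H) (Bs ! p)" if "p < q" for p
    using finite_same_card_bij[OF fH] B[OF that] fG finite_subset by metis
  then obtain \<iota> where \<iota>: "\<And>p. p < q \<Longrightarrow> bij_betw (\<iota> p) (verts H) (Bs ! p)" by metis
  define e where "e a = \<iota> (\<psi> a) a" for a
  have eB: "e a \<in> Bs ! \<psi> a" if "a \<in> verts H" for a
    using \<iota>[OF \<psi>[OF that]] that by (auto simp: e_def bij_betw_def)
  have inj: "inj_on e (verts H)"
  proof (rule inj_onI)
    fix a b assume ab: "a \<in> verts H" "b \<in> verts H" "e a = e b"
    have "\<psi> a = \<psi> b" using Bs(3)[OF \<psi> \<psi>, of a b] ab eB[of a] eB[of b] by auto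
    then show "a = b" using ab \<iota>[OF \<psi>[OF ab(1)]] by (auto simp: e_def bij_betw_def inj_on_def)
  qed
  have edge: "a \<in> verts H \<and> b \<in> verts H \<and> a \<noteq> b" if "{a, b} \<in> edges H" for a b
    using H that by (fastforce simp: simple_graph_def)
  have eE: "{e a, e b} \<in> edges G" if ab: "{a, b} \<in> edges H" for a b
  proof -
    have v: "a \<in> verts H" "b \<in> verts H" using edge[OF ab] by auto
    have xs: "{c (\<psi> a), c (\<psi> b)} \<in> edges G" if "\<And>p. p < q \<Longrightarrow> c p \<in> Bs ! p" for c
    proof -
      have "map c [0..<q] \<in> listset Bs" using that Bs(1) by (simp add: in_listset_iff)
      then have "{map c [0..<q] ! \<psi> a, map c [0..<q] ! \<psi> b} \<in> edges G" using T ab Bs(4) by blast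
      then show ?thesis using \<psi> v by simp
    qed
    \<comment> \<open>A transversal through the images of \<open>a\<close> and \<open>b\<close>; at
      the other positions any element of the class will do, for which \<open>\<iota> p a\<close>
      serves.\<close>
    define c where "c p = (if p = \<psi> a then e a else if p = \<psi> b then e b else \<iota> p a)" for p
    have cB: "\<iota> p a \<in> Bs ! p" if "p < q" for p using \<iota>[OF that] v(1) by (auto simp: bij_betw_def)
    \<comment> \<open>If both ends went to the same class, a single entry of a tuple would be
      adjacent to itself.\<close>
    have "\<psi> a \<noteq> \<psi> b"
    proof
      assume "\<psi> a = \<psi> b"
      then have "{\<iota> (\<psi> a) a} \<in> edges G" using xs[of "\<lambda>p. \<iota> p a"] cB by simp
      then show False using G by (fastforce simp: simple_graph_def)
    qed
    moreover have "{c (\<psi> a), c (\<psi> b)} \<in> edges G"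
      by (rule xs) (use cB eB v in \<open>auto simp: c_def\<close>)
    ultimately show ?thesis by (simp add: c_def)
  qed
  define S where "S = Graph (e ` verts H) ((\<lambda>E. e ` E) ` edges H)"
  have two: "\<exists>a b. E = {a, b} \<and> a \<noteq> b" if "E \<in> edges H" for E
    using H that by (auto simp: simple_graph_def card_2_iff)
  have "e a \<in> verts G" if "a \<in> verts H" for a using eB[OF that] B(1)[OF \<psi>[OF that]] by blast
  then have vS: "verts S \<subseteq> verts G" by (auto simp: S_def)
  have eS: "edges S \<subseteq> edges G"
  proof
    fix F assume "F \<in> edges S"
    then obtain E where "E \<in> edges H" "F = e ` E" by (auto simp: S_def)
    then show "F \<in> edges G" using two[of E] eE by auto
  qed
  have "F \<subseteq> verts S \<and> card F = 2" if F: "F \<in> edges S" for F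
  proof
    obtain E where E: "E \<in> edges H" "F = e ` E" using F by (auto simp: S_def)
    then show "F \<subseteq> verts S" using H by (auto simp: S_def simple_graph_def)
    show "card F = 2" using F eS G by (auto simp: simple_graph_def)
  qed
  then have "subgraph S G" using vS eS fH by (auto simp: subgraph_def simple_graph_def S_def)
  moreover have "isomorphic H S"
    unfolding isomorphic_def by (rule exI[of _ e]) (use inj in \<open>simp add: S_def bij_betw_def\<close>)
  ultimately show ?thesis unfolding free_of_def by blast
qed

text \<open>Two kinds of failure cost at most a quarter of the samples each. For the vertices of
  \<open>W\<close>, Chebyshev's inequality and a union bound over at most \<open>t\<close> vertices
  suffice. The positions of the sample itself are too many for a union bound; the number of bad
  positions is bounded on average instead, so that few samples have \<open>\<kappa> * s\<close> of
  them.\<close>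

lemma many_good_samples:
  fixes \<mu> \<epsilon> \<kappa> b :: real
  assumes fV: "finite V" and ne: "V \<noteq> {}" and deg: "\<And>v. v \<in> V \<Longrightarrow> card {p \<in> V. P v p} \<le> \<mu> * card V"
    and pos: "0 \<le> \<mu>" "0 < \<epsilon>" "0 < \<kappa>" and s: "s > 0" "4 * t \<le> \<epsilon>\<^sup>2 * s" "4 \<le> \<epsilon>\<^sup>2 * \<kappa> * s"
    and W: "W \<subseteq> V" "card W \<le> t" and b: "b = s * \<mu> + \<epsilon> * s + 1"
  shows "real (card V) ^ s / 2 \<le> card {ys \<in> lists_of V s. (\<forall>v\<in>W. cnt (P v) ys \<le> b) \<and>
    (1 - \<kappa>) * s \<le> card {j. j < s \<and> cnt (P (ys ! j)) ys \<le> b}}"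
proof -
  let ?L = "lists_of V s" and ?n = "real (card V)"
  let ?G = "{ys \<in> ?L. (\<forall>v\<in>W. cnt (P v) ys \<le> b) \<and> (1 - \<kappa>) * s \<le> card {j. j < s \<and> cnt (P (ys ! j)) ys \<le> b}}"
  define X where "X v = {ys \<in> ?L. s * \<mu> + \<epsilon> * s \<le> cnt (P v) ys}" for v
  define Y where "Y j = {ys \<in> ?L. b \<le> cnt (P (ys ! j)) ys}" for j
  define Z where "Z = {ys \<in> ?L. \<kappa> * s \<le> card {j \<in> {..<s}. ys \<in> Y j}}"
  have fL: "finite ?L" using fV by simp
  have fW: "finite W" using W(1) fV finite_subset by blast
  have a: "0 < \<epsilon> * s" using pos s(1) by simp
  have X: "(\<epsilon> * s)\<^sup>2 * card (X v) \<le> s * ?n ^ s" if "v \<in> W" for v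
    unfolding X_def by (rule card_large_deviation[OF fV ne deg a]) (use that W in blast)
  have Y: "(\<epsilon> * s)\<^sup>2 * card (Y j) \<le> s * ?n ^ s" if "j < s" for j
    unfolding Y_def using card_large_deviation_nth[where P = P, OF fV ne deg a that pos(1)] by (simp add: b)
  have norm: "\<epsilon>\<^sup>2 * s * c \<le> ?n ^ s" if "(\<epsilon> * s)\<^sup>2 * c \<le> s * ?n ^ s" for c
  proof -
    have "s * (\<epsilon>\<^sup>2 * s * c) \<le> s * ?n ^ s" using that by (simp add: power2_eq_square algebra_simps)
    then show ?thesis using s(1) by simp
  qed
  have cX: "card (\<Union>v\<in>W. X v) \<le> ?n ^ s / 4"
  proof -
    have "real (card (\<Union>v\<in>W. X v)) \<le> real (\<Sum>v\<in>W. card (X v))"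
      using fW by (intro of_nat_mono card_UN_le)
    then have "\<epsilon>\<^sup>2 * s * card (\<Union>v\<in>W. X v) \<le> \<epsilon>\<^sup>2 * s * real (\<Sum>v\<in>W. card (X v))"
      by (rule mult_left_mono) simp
    also have "\<dots> = (\<Sum>v\<in>W. \<epsilon>\<^sup>2 * s * card (X v))" by (simp add: sum_distrib_left)
    also have "\<dots> \<le> (\<Sum>v\<in>W. ?n ^ s)" by (intro sum_mono norm X)
    also have "\<dots> \<le> t * ?n ^ s" using W(2) by (simp add: mult_right_mono)
    finally have *: "\<epsilon>\<^sup>2 * s * card (\<Union>v\<in>W. X v) \<le> t * ?n ^ s" .
    show ?thesis
    proof (cases "t = 0")
      case True
      then have "W = {}" using W(2) fW by simp
      then show ?thesis by simp
    next
      case False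
      define c where "c = real (card (\<Union>v\<in>W. X v))"
      have "4 * real t * c \<le> \<epsilon>\<^sup>2 * s * c"
        using s(2) by (intro mult_right_mono) (auto simp: c_def)
      then have "4 * real t * c \<le> t * ?n ^ s" using * unfolding c_def by linarith
      moreover have "real t * (4 * c) = 4 * real t * c"
        by (simp only: mult.left_commute[of "real t" 4] mult.assoc)
      ultimately have "real t * (4 * c) \<le> t * ?n ^ s" by linarith
      then have "4 * c \<le> ?n ^ s" using False by (simp only: mult_le_cancel_left_pos of_nat_0_less_iff)
      then show ?thesis by (simp add: c_def)
    qed
  qed
  have cZ: "card Z \<le> ?n ^ s / 4"
  proof -
    have fZ: "finite Z" using fL by (simp add: Z_def)
    have "\<kappa> * s * card Z = (\<Sum>ys\<in>Z. \<kappa> * s)" by simp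
    also have "\<dots> \<le> (\<Sum>ys\<in>Z. real (card {j \<in> {..<s}. ys \<in> Y j}))" by (intro sum_mono) (auto simp: Z_def)
    also have "\<dots> \<le> (\<Sum>ys\<in>?L. real (card {j \<in> {..<s}. ys \<in> Y j}))"
      using fL by (intro sum_mono2) (auto simp: Z_def)
    also have "\<dots> = (\<Sum>ys\<in>?L. \<Sum>j<s. if ys \<in> Y j then 1 else 0)"
      by (intro sum.cong refl) (simp add: sum.If_cases Int_def)
    also have "\<dots> = (\<Sum>j<s. \<Sum>ys\<in>?L. if ys \<in> Y j then 1 else 0)" by (rule sum.swap)
    also have "\<dots> = (\<Sum>j<s. real (card (Y j)))"
    proof -
      have "?L \<inter> {ys. ys \<in> Y j} = Y j" for j by (auto simp: Y_def)
      then show ?thesis using fL by (simp add: sum.If_cases)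
    qed
    finally have "\<epsilon>\<^sup>2 * s * (\<kappa> * s * card Z) \<le> \<epsilon>\<^sup>2 * s * (\<Sum>j<s. real (card (Y j)))"
      by (rule mult_left_mono) simp
    also have "\<dots> = (\<Sum>j<s. \<epsilon>\<^sup>2 * s * card (Y j))" by (simp add: sum_distrib_left)
    also have "\<dots> \<le> (\<Sum>j<s. ?n ^ s)" by (intro sum_mono norm Y) simp
    also have "\<dots> = s * ?n ^ s" by simp
    finally have "\<epsilon>\<^sup>2 * s * (\<kappa> * s * card Z) \<le> s * ?n ^ s" .
    moreover have "\<epsilon>\<^sup>2 * s * (\<kappa> * s * card Z) = s * (\<epsilon>\<^sup>2 * \<kappa> * s * card Z)"
      by (simp only: mult.assoc mult.left_commute mult.commute)
    ultimately have "s * (\<epsilon>\<^sup>2 * \<kappa> * s * card Z) \<le> s * ?n ^ s" by linarith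
    then have "\<epsilon>\<^sup>2 * \<kappa> * s * card Z \<le> ?n ^ s"
      using s(1) by (simp only: mult_le_cancel_left_pos of_nat_0_less_iff)
    moreover have "4 * real (card Z) \<le> \<epsilon>\<^sup>2 * \<kappa> * s * card Z" using s(3) by (intro mult_right_mono) auto
    ultimately show ?thesis by simp
  qed
  have "?L \<subseteq> ?G \<union> ((\<Union>v\<in>W. X v) \<union> Z)"
  proof
    fix ys assume ys: "ys \<in> ?L"
    show "ys \<in> ?G \<union> ((\<Union>v\<in>W. X v) \<union> Z)"
    proof (cases "ys \<in> (\<Union>v\<in>W. X v) \<union> Z")
      case False
      then have "cnt (P v) ys \<le> b" if "v \<in> W" for v using that ys by (force simp: X_def b)
      moreover have "(1 - \<kappa>) * s \<le> card {j. j < s \<and> cnt (P (ys ! j)) ys \<le> b}"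
      proof -
        have "card {j \<in> {..<s}. ys \<in> Y j} < \<kappa> * s" using False ys by (auto simp: Z_def not_le)
        moreover have "{..<s} \<subseteq> {j \<in> {..<s}. ys \<in> Y j} \<union> {j. j < s \<and> cnt (P (ys ! j)) ys \<le> b}"
          using ys by (auto simp: Y_def)
        then have "card {..<s} \<le> card ({j \<in> {..<s}. ys \<in> Y j} \<union> {j. j < s \<and> cnt (P (ys ! j)) ys \<le> b})"
          by (rule card_mono[rotated]) simp
        then have "s \<le> card {j \<in> {..<s}. ys \<in> Y j} + card {j. j < s \<and> cnt (P (ys ! j)) ys \<le> b}"
          using card_Un_le[of "{j \<in> {..<s}. ys \<in> Y j}" "{j. j < s \<and> cnt (P (ys ! j)) ys \<le> b}"]
          unfolding card_lessThan by linarith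
        ultimately show ?thesis by (simp add: algebra_simps)
      qed
      ultimately show ?thesis using ys by blast
    qed simp
  qed
  then have "card ?L \<le> card (?G \<union> ((\<Union>v\<in>W. X v) \<union> Z))"
    by (rule card_mono[rotated]) (use fL fW in \<open>auto simp: X_def Z_def\<close>)
  also have "\<dots> \<le> card ?G + (card (\<Union>v\<in>W. X v) + card Z)"
    using card_Un_le[of ?G "(\<Union>v\<in>W. X v) \<union> Z"] card_Un_le[of "\<Union>v\<in>W. X v" Z] by linarith
  finally have "real (card ?L) \<le> real (card ?G) + (real (card (\<Union>v\<in>W. X v)) + real (card Z))" by linarith
  moreover have "real (card ?L) = ?n ^ s" using card_lists_of[OF fV] by simp
  ultimately show ?thesis using cX cZ by linarith
qed

text \<open>If \<open>G\<close> were far from \<open>r\<close>-partite, a positive proportion of the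
  tuples \<open>ws @ ys\<close> would contain an image of \<open>H\<close>. Only boundedly many maps
  \<open>\<psi>\<close> from \<open>H\<close> to positions exist, so one of them works for a
  positive proportion, and a blow-up in this family of tuples gives a copy of
  \<open>H\<close>.\<close>

theorem eventually_partite:
  fixes H :: "'a graph" and c \<eta> :: real
  assumes H: "simple_graph H" and r: "r \<ge> 3" and g: "1 \<le> g" "g \<le> 11"
    and hom: "\<And>i. 1 \<le> i \<Longrightarrow> i \<le> g \<Longrightarrow> homomorphic H (join (complete_graph (r - 3)) (F_graph i))"
    and c: "1 - 1 / (real r - 1 + c_const g) < c" and \<eta>: "0 < \<eta>"
  shows "\<exists>n0. \<forall>G :: nat graph. simple_graph G \<and> n0 \<le> card (verts G) \<and> free_of H G \<and>
    c * real (card (verts G)) \<le> real (min_degree G) \<longrightarrow>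
    (\<exists>D\<subseteq>edges G. real (card D) \<le> \<eta> * (real (card (verts G)))\<^sup>2 \<and> partite r (delete_edges G D))"
proof -
  define R where "R = real r - 1 + c_const g"
  have "c_const g \<ge> 1/7" using c_const_antimono[of g 11] g c_const_values(11) by simp
  then have R: "R > 0" using r by (simp add: R_def)
  \<comment> \<open>The proportion of vertices that a vertex may miss. The maximum keeps it
    nonnegative for \<open>c > 1\<close>.\<close>
  define \<mu> where "\<mu> = max 0 (1 - c)"
  have \<mu>: "0 \<le> \<mu>" "1 - c \<le> \<mu>" by (simp_all add: \<mu>_def)
  have "1 - c < 1 / R" using c by (simp add: R_def)
  then have "\<mu> < 1 / R" using R by (simp add: \<mu>_def)
  then have R\<mu>: "R * \<mu> < 1" using R by (simp add: field_simps)
  define \<tau> where "\<tau> = 1 - R * \<mu>"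
  have \<tau>: "0 < \<tau>" using R\<mu> by (simp add: \<tau>_def)
  \<comment> \<open>The slack \<open>\<tau>\<close> is divided into quarters: one for the deviation
    \<open>\<epsilon>\<close>, one for the bad positions \<open>\<kappa>\<close>, and two for the
    constant terms \<open>R * (1 + t)\<close>, which a large \<open>s\<close> absorbs.\<close>
  define \<epsilon> where "\<epsilon> = \<tau> / (4 * R)"
  have \<epsilon>: "0 < \<epsilon>" "R * \<epsilon> = \<tau> / 4" using \<tau> R by (simp_all add: \<epsilon>_def)
  define \<kappa> where "\<kappa> = \<tau> / 4"
  have \<kappa>: "0 < \<kappa>" using \<tau> by (simp add: \<kappa>_def)
  \<comment> \<open>Then \<open>3 * \<gamma> \<le> \<eta>\<close>, matching the number of
    monochromatic pairs in \<open>many_uncolourable_samples\<close>, and \<open>k\<close> below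
    makes the full lists of total size \<open>r * card V\<close> fit its hypothesis.\<close>
  define \<gamma> where "\<gamma> = min 1 (\<eta> / 3)"
  have \<gamma>: "0 < \<gamma>" "\<gamma> \<le> 1" "3 * \<gamma> \<le> \<eta>" using \<eta> by (auto simp: \<gamma>_def)
  define k where "k = nat \<lceil>r / \<gamma>\<rceil>"
  have "r / \<gamma> \<le> k" unfolding k_def by (rule real_nat_ceiling_ge)
  then have k: "r \<le> k * \<gamma>" using \<gamma>(1) by (simp add: field_simps)
  define t where "t = sample_size r k"
  obtain s :: nat where s0: "4 * real t / \<epsilon>\<^sup>2 + 4 / (\<epsilon>\<^sup>2 * \<kappa>) + 2 * R * (1 + t) / \<tau> < s"
    using reals_Archimedean2 by blast
  have terms: "0 \<le> 4 * real t / \<epsilon>\<^sup>2" "0 < 4 / (\<epsilon>\<^sup>2 * \<kappa>)" "0 \<le> 2 * R * (1 + t) / \<tau>"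
    using \<epsilon> \<kappa> R \<tau> by simp_all
  have "4 * real t / \<epsilon>\<^sup>2 \<le> s" "4 / (\<epsilon>\<^sup>2 * \<kappa>) \<le> s" "2 * R * (1 + t) / \<tau> < s" and "0 < real s"
    using s0 terms by linarith+
  then have s: "s > 0" "4 * real t \<le> \<epsilon>\<^sup>2 * s" "4 \<le> \<epsilon>\<^sup>2 * \<kappa> * s" "2 * R * (1 + t) < \<tau> * s"
    using \<epsilon> \<kappa> \<tau> by (simp_all add: field_simps)
  define b where "b = s * \<mu> + \<epsilon> * s + 1"
  have b0: "0 \<le> b" using \<mu> \<epsilon> by (simp add: b_def)
  have "R * (b + t) = s * (R * \<mu>) + s * (R * \<epsilon>) + R * (1 + t)" by (simp add: b_def algebra_simps)
  also have "\<dots> = s - \<tau> * s + \<tau> * s / 4 + R * (1 + t)" unfolding \<epsilon>(2) by (simp add: \<tau>_def algebra_simps)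
  also have "\<dots> < (1 - \<kappa>) * s" using s(4) by (simp add: \<kappa>_def algebra_simps)
  finally have Rb: "R * (b + t) < (1 - \<kappa>) * s" .
  define q where "q = t + s"
  define h where "h = card (verts H)"
  have fH: "finite (verts H)" using H by (simp add: simple_graph_def)
  \<comment> \<open>The value 0 outside \<open>H\<close> makes the set of maps finite.\<close>
  define \<Psi> where "\<Psi> = {\<psi>. \<forall>a. (a \<in> verts H \<longrightarrow> \<psi> a \<in> {..<q}) \<and> (a \<notin> verts H \<longrightarrow> \<psi> a = 0)}"
  have f\<Psi>: "finite \<Psi>" unfolding \<Psi>_def by (rule finite_set_of_finite_funs[OF fH]) simp
  have "(\<lambda>_. 0) \<in> \<Psi>" using s(1) by (simp add: \<Psi>_def q_def)
  then have ne\<Psi>: "\<Psi> \<noteq> {}" by blast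
  \<comment> \<open>The factors come from the uncolourable part (\<open>\<gamma> ^ t\<close>), the
    good enlargements (one half) and the pigeonhole choice of \<open>\<psi>\<close>.\<close>
  define \<delta> where "\<delta> = \<gamma> ^ t / (2 * card \<Psi>)"
  have M: "card \<Psi> > 0" using f\<Psi> ne\<Psi> by (simp add: card_gt_0_iff)
  then have "0 < \<delta>" using \<gamma> by (simp add: \<delta>_def)
  from blow_up_exists[OF this, of q 0 h] obtain N where "\<forall>V :: nat set. \<forall>T X. T \<subseteq> lists_of V q \<longrightarrow>
    finite V \<longrightarrow> N \<le> card V \<longrightarrow> finite X \<longrightarrow> card X \<le> 0 \<longrightarrow> \<delta> * real (card V) ^ q \<le> card T \<longrightarrow>
    has_blow_up T (V - X) q h" ..
  note N = this[rule_format]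
  show ?thesis
  proof (intro exI[of _ "N + 1"] allI impI, elim conjE)
    fix G :: "nat graph"
    assume G: "simple_graph G" and n0: "N + 1 \<le> card (verts G)" and free: "free_of H G"
      and deg: "c * real (card (verts G)) \<le> real (min_degree G)"
    define V where "V = verts G"
    let ?n = "real (card V)"
    define A where "A u v \<longleftrightarrow> {u, v} \<in> edges G" for u v
    have fV: "finite V" using G by (simp add: V_def simple_graph_def)
    have ne: "V \<noteq> {}" using n0 by (auto simp: V_def)
    then have n: "?n > 0" using fV by (simp add: card_gt_0_iff)
    have sym: "A u v \<Longrightarrow> A v u" for u v by (simp add: A_def insert_commute)
    have irrefl: "\<not> A v v" for v
    proof
      assume "A v v"
      then have "card {v} = 2" using G unfolding A_def simple_graph_def by fastforce
      then show False by simp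
    qed
    show "\<exists>D\<subseteq>edges G. real (card D) \<le> \<eta> * (real (card (verts G)))\<^sup>2 \<and> partite r (delete_edges G D)"
    proof (rule ccontr)
      assume no: "\<not> ?thesis"
      have far: "3 * \<gamma> * ?n\<^sup>2 < card {(u, v). u \<in> V \<and> v \<in> V \<and> A u v \<and> f u = f v}"
        if f: "f ` V \<subseteq> {..<r}" for f :: "nat \<Rightarrow> nat"
      proof (rule ccontr)
        let ?E = "{(u, v). u \<in> V \<and> v \<in> V \<and> A u v \<and> f u = f v}"
        assume small: "\<not> 3 * \<gamma> * ?n\<^sup>2 < card ?E"
        define D where "D = (\<lambda>(u, v). {u, v}) ` ?E"
        have fE: "finite ?E" by (rule finite_subset[of _ "V \<times> V"]) (use fV in auto)
        have "card D \<le> card ?E" unfolding D_def by (rule card_image_le[OF fE])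
        then have "real (card D) \<le> 3 * \<gamma> * ?n\<^sup>2" using small by linarith
        also have "\<dots> \<le> \<eta> * ?n\<^sup>2" using \<gamma>(3) by (rule mult_right_mono) simp
        finally have cD: "real (card D) \<le> \<eta> * (real (card (verts G)))\<^sup>2" by (simp add: V_def)
        have DE: "D \<subseteq> edges G" by (auto simp: D_def A_def)
        have "f u \<noteq> f v" if uv: "{u, v} \<in> edges (delete_edges G D)" for u v
        proof
          assume "f u = f v"
          moreover have e: "{u, v} \<in> edges G" "{u, v} \<notin> D" using uv by (auto simp: delete_edges_def)
          moreover have "u \<in> V" "v \<in> V" using G e(1) unfolding V_def simple_graph_def by blast+
          ultimately have "(u, v) \<in> ?E" by (simp add: A_def)
          then show False using e(2) unfolding D_def by force
        qed
        then have "partite r (delete_edges G D)"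
          unfolding partite_def using f by (intro exI[of _ f]) (auto simp: delete_edges_def V_def)
        then show False using no cD DE by blast
      qed
      define NC where "NC = {ws \<in> lists_of V t. \<not> list_colourable A (set ws) (\<lambda>_. {..<r})}"
      have "?n * r \<le> k * (\<gamma> * ?n)" using mult_right_mono[OF k, of ?n] by (simp add: algebra_simps)
      then have cNC: "(\<gamma> * ?n) ^ t \<le> card NC"
        unfolding NC_def t_def
        by (intro many_uncolourable_samples[where A = A, OF fV ne sym \<gamma>(1,2) _ far]) (use r in auto)
      have degV: "card {p \<in> V. \<not> A v p} \<le> \<mu> * card V" if v: "v \<in> V" for v
      proof -
        have "min_degree G \<le> degree G v"
          unfolding min_degree_def using v fV by (intro Min_le) (auto simp: V_def)
        then have d: "c * ?n \<le> real (degree G v)" using deg by (simp add: V_def)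
        have dA: "degree G v = card {p \<in> V. A v p}"
          unfolding degree_def A_def V_def by (simp add: insert_commute)
        have "{p \<in> V. \<not> A v p} = V - {p \<in> V. A v p}" by auto
        then have "card {p \<in> V. \<not> A v p} = card V - card {p \<in> V. A v p}"
          using fV by (simp add: card_Diff_subset)
        moreover have "card {p \<in> V. A v p} \<le> card V" using fV by (simp add: card_mono)
        ultimately have "real (card {p \<in> V. \<not> A v p}) = ?n - real (degree G v)"
          by (simp add: dA of_nat_diff)
        also have "\<dots> \<le> (1 - c) * ?n" using d by (simp add: algebra_simps)
        also have "\<dots> \<le> \<mu> * ?n" using \<mu>(2) by (rule mult_right_mono) simp
        finally show ?thesis .
      qed
      define Good where "Good ws = {ys \<in> lists_of V s. (\<forall>v\<in>set ws. cnt (\<lambda>p. \<not> A v p) ys \<le> b) \<and>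
        (1 - \<kappa>) * s \<le> card {j. j < s \<and> cnt (\<lambda>p. \<not> A (ys ! j) p) ys \<le> b}}" for ws
      have cGood: "?n ^ s / 2 \<le> card (Good ws)" if ws: "ws \<in> NC" for ws
        unfolding Good_def
      proof (rule many_good_samples[where P = "\<lambda>v p. \<not> A v p", OF fV ne degV \<mu>(1) \<epsilon>(1) \<kappa> s(1-3)])
        show "set ws \<subseteq> V" using ws by (auto simp: NC_def lists_of_def)
        show "card (set ws) \<le> t" using ws card_length[of ws] by (auto simp: NC_def lists_of_def)
      qed (simp_all add: b_def)
      \<comment> \<open>The tuples in which \<open>\<psi>\<close> maps \<open>H\<close>
        homomorphically. Such \<open>\<psi>\<close> arise by composing \<open>H\<close> into
        \<open>K_{r-3} + F_i\<close> with the map of the latter into the sample.\<close>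
      define T where "T \<psi> = {xs \<in> lists_of V q. \<forall>a b. {a, b} \<in> edges H \<longrightarrow> A (xs ! \<psi> a) (xs ! \<psi> b)}"
        for \<psi> :: "'a \<Rightarrow> nat"
      have fT: "finite (T \<psi>)" for \<psi> using fV by (simp add: T_def)
      have edgeH: "a \<in> verts H \<and> b \<in> verts H" if "{a, b} \<in> edges H" for a b
        using H that unfolding simple_graph_def by blast
      have inT: "ws @ ys \<in> (\<Union>\<psi>\<in>\<Psi>. T \<psi>)" if ws: "ws \<in> NC" and ys: "ys \<in> Good ws" for ws ys
      proof -
        have lw: "length ws = t" "set ws \<subseteq> V" and ly: "length ys = s" "set ys \<subseteq> V"
          using ws ys by (auto simp: NC_def Good_def lists_of_def)
        have "\<exists>i. 1 \<le> i \<and> i \<le> g \<and> maps_to (join (complete_graph (r - 3)) (F_graph i))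
          {..<length (ws @ ys)} (\<lambda>i j. A ((ws @ ys) ! i) ((ws @ ys) ! j))"
        proof (rule sample_maps_to[where A = A, OF sym irrefl r g])
          show "\<not> list_colourable A (set ws) (\<lambda>_. {..<r})" using ws by (simp add: NC_def)
          show "cnt (\<lambda>p. \<not> A v p) ys \<le> b" if "v \<in> set ws" for v using ys that by (simp add: Good_def)
          show "(real r - 1 + c_const g) * (b + length ws) <
            card {j. j < length ys \<and> cnt (\<lambda>p. \<not> A (ys ! j) p) ys \<le> b}"
            using Rb ys ly(1) lw(1) by (simp add: R_def Good_def)
        qed (assumption | rule b0)+
        then obtain i where i: "1 \<le> i" "i \<le> g" and "maps_to (join (complete_graph (r - 3)) (F_graph i))
          {..<length (ws @ ys)} (\<lambda>i j. A ((ws @ ys) ! i) ((ws @ ys) ! j))" by blast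
        then obtain \<phi> where \<phi>: "\<phi> ` verts (join (complete_graph (r - 3)) (F_graph i)) \<subseteq> {..<length (ws @ ys)}"
          "\<forall>u v. {u, v} \<in> edges (join (complete_graph (r - 3)) (F_graph i)) \<longrightarrow>
            A ((ws @ ys) ! \<phi> u) ((ws @ ys) ! \<phi> v)" unfolding maps_to_def by blast
        obtain \<theta> where \<theta>: "\<theta> ` verts H \<subseteq> verts (join (complete_graph (r - 3)) (F_graph i))"
          "\<forall>u v. {u, v} \<in> edges H \<longrightarrow> {\<theta> u, \<theta> v} \<in> edges (join (complete_graph (r - 3)) (F_graph i))"
          using hom[OF i] unfolding homomorphic_def by blast
        define \<psi> where "\<psi> a = (if a \<in> verts H then \<phi> (\<theta> a) else 0)" for a
        have "\<phi> (\<theta> a) < q" if "a \<in> verts H" for a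
          using that \<theta>(1) \<phi>(1) lw ly by (auto simp: q_def)
        then have "\<psi> \<in> \<Psi>" by (auto simp: \<Psi>_def \<psi>_def)
        moreover have "A ((ws @ ys) ! \<psi> a) ((ws @ ys) ! \<psi> b)" if "{a, b} \<in> edges H" for a b
          using edgeH[OF that] \<phi>(2) \<theta>(2) that by (simp add: \<psi>_def)
        then have "ws @ ys \<in> T \<psi>" using lw ly by (simp add: T_def lists_of_def q_def)
        ultimately show ?thesis by blast
      qed
      obtain \<psi> where \<psi>: "\<psi> \<in> \<Psi>" "\<forall>\<psi>'\<in>\<Psi>. card (T \<psi>') \<le> card (T \<psi>)"
        using ex_max_nat[OF f\<Psi> ne\<Psi>, of "\<lambda>\<psi>. card (T \<psi>)"] by blast
      have fNC: "finite NC" using fV by (simp add: NC_def)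
      have fGood: "finite (Good ws)" for ws using fV by (simp add: Good_def)
      have "(\<gamma> * ?n) ^ t * (?n ^ s / 2) \<le> card NC * (?n ^ s / 2)"
        using cNC by (rule mult_right_mono) simp
      also have "\<dots> = (\<Sum>ws\<in>NC. ?n ^ s / 2)" by simp
      also have "\<dots> \<le> (\<Sum>ws\<in>NC. real (card (Good ws)))" by (intro sum_mono cGood)
      also have "\<dots> = real (card (SIGMA ws:NC. Good ws))" using fNC fGood by simp
      also have "card (SIGMA ws:NC. Good ws) \<le> card (\<Union>\<psi>\<in>\<Psi>. T \<psi>)"
      proof (rule card_inj_on_le[where f = "\<lambda>(ws, ys). ws @ ys"])
        show "inj_on (\<lambda>(ws, ys). ws @ ys) (SIGMA ws:NC. Good ws)"
          by (auto simp: inj_on_def NC_def lists_of_def)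
        show "(\<lambda>(ws, ys). ws @ ys) ` (SIGMA ws:NC. Good ws) \<subseteq> (\<Union>\<psi>\<in>\<Psi>. T \<psi>)" using inT by auto
      qed (use f\<Psi> fT in blast)
      also have "card (\<Union>\<psi>\<in>\<Psi>. T \<psi>) \<le> (\<Sum>\<psi>\<in>\<Psi>. card (T \<psi>))" by (rule card_UN_le[OF f\<Psi>])
      also have "\<dots> \<le> card \<Psi> * card (T \<psi>)" using sum_bounded_above[of \<Psi> "\<lambda>\<psi>. card (T \<psi>)"] \<psi>(2) by simp
      finally have "(\<gamma> * ?n) ^ t * (?n ^ s / 2) \<le> real (card \<Psi>) * real (card (T \<psi>))" by simp
      then have "\<delta> * ?n ^ q \<le> card (T \<psi>)"
        using M by (simp add: \<delta>_def q_def power_add power_mult_distrib field_simps)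
      then have "has_blow_up (T \<psi>) (V - {}) q h"
        by (intro N) (use n0 fV in \<open>auto simp: T_def V_def\<close>)
      then have blow: "has_blow_up (T \<psi>) (verts G) q (card (verts H))" by (simp add: V_def h_def)
      have "\<not> free_of H G"
      proof (rule not_free_if_blow_up[OF H G _ blow])
        show "{xs ! \<psi> a, xs ! \<psi> b} \<in> edges G" if "xs \<in> T \<psi>" "{a, b} \<in> edges H" for xs a b
          using that by (auto simp: T_def A_def)
        show "\<psi> a < q" if "a \<in> verts H" for a using \<psi>(1) that by (auto simp: \<Psi>_def)
      qed
      then show False using free by blast
    qed
  qed
qed

section \<open>Weighted blow-ups\<close>

definition admissible :: "'a graph \<Rightarrow> real set" where
  "admissible H = {c :: real.
     \<forall>\<eta>>0. \<exists>n0 :: nat. \<forall>G :: nat graph.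
       simple_graph G \<and> card (verts G) \<ge> n0 \<and> free_of H G \<and>
       real (min_degree G) \<ge> c * real (card (verts G))
       \<longrightarrow> (\<exists>D \<subseteq> edges G. real (card D) \<le> \<eta> * (real (card (verts G)))\<^sup>2 \<and>
             partite (chromatic_number H - 1) (delete_edges G D))}"

lemma delta_threshold_eq: "delta_threshold H = Inf (admissible H)"
  by (simp add: delta_threshold_def admissible_def)

text \<open>In a simple graph the weight of \<open>v\<close> itself is included: in the blow-up, a
  vertex misses its whole class.\<close>

definition missing_weight :: "'a graph \<Rightarrow> ('a \<Rightarrow> nat) \<Rightarrow> 'a \<Rightarrow> nat" where
  "missing_weight F w v = (\<Sum>u | u \<in> verts F \<and> {u, v} \<notin> edges F. w u)"

lemma edge_of_simple_graph:
  assumes "simple_graph G" "{u, v} \<in> edges G"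
  shows "u \<in> verts G" "v \<in> verts G" "u \<noteq> v"
  using assms by (auto simp: simple_graph_def card_insert_if split: if_splits)

lemma doubleton_mem_iff:
  assumes "\<And>i j. P i j \<Longrightarrow> P j i"
  shows "{i, j} \<in> {{i, j} | i j. P i j} \<longleftrightarrow> P i j"
  using assms by (auto simp: doubleton_eq_iff)

lemma blow_up_map_exists:
  assumes "finite V"
  shows "\<exists>p :: nat \<Rightarrow> 'b. p ` {..<(\<Sum>v\<in>V. w v)} \<subseteq> V \<and>
    (\<forall>v\<in>V. card {i. i < (\<Sum>v\<in>V. w v) \<and> p i = v} = w v)"
proof -
  let ?S = "SIGMA v:V. {..<w v}"
  let ?n = "\<Sum>v\<in>V. w v"
  have "finite ?S" "card ?S = ?n" using assms by auto
  then obtain e where e: "bij_betw e {0..<?n} ?S" using ex_bij_betw_nat_finite[of ?S] by auto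
  have eS: "e i \<in> ?S" if "i < ?n" for i
    using bij_betw_apply[OF e, of i] that unfolding atLeastLessThan_iff by blast
  have inj: "inj_on e {0..<?n}" using e by (simp add: bij_betw_def)
  have "card {i. i < ?n \<and> fst (e i) = v} = w v" if v: "v \<in> V" for v
  proof -
    have "e ` {i. i < ?n \<and> fst (e i) = v} = {v} \<times> {..<w v}"
    proof
      show "e ` {i. i < ?n \<and> fst (e i) = v} \<subseteq> {v} \<times> {..<w v}"
      proof
        fix z assume "z \<in> e ` {i. i < ?n \<and> fst (e i) = v}"
        then obtain i where "i < ?n" "fst (e i) = v" "z = e i" by blast
        then show "z \<in> {v} \<times> {..<w v}" using eS[of i] by (cases "e i") auto
      qed
      show "{v} \<times> {..<w v} \<subseteq> e ` {i. i < ?n \<and> fst (e i) = v}"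
      proof
        fix z assume z: "z \<in> {v} \<times> {..<w v}"
        then have "z \<in> ?S" using v by auto
        then have "z \<in> e ` {0..<?n}" using bij_betw_imp_surj_on[OF e] by simp
        then obtain i where "i < ?n" "z = e i" by auto
        then show "z \<in> e ` {i. i < ?n \<and> fst (e i) = v}" using z by auto
      qed
    qed
    moreover have "inj_on e {i. i < ?n \<and> fst (e i) = v}" by (rule inj_on_subset[OF inj]) auto
    ultimately have "card {i. i < ?n \<and> fst (e i) = v} = card ({v} \<times> {..<w v})"
      using card_image[of e "{i. i < ?n \<and> fst (e i) = v}"] by simp
    then show ?thesis by (simp add: card_cartesian_product)
  qed
  moreover have "fst (e i) \<in> V" if "i < ?n" for i using eS[OF that] by (cases "e i") auto
  ultimately show ?thesis by (intro exI[of _ "\<lambda>i. fst (e i)"]) auto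
qed

lemma ex_majority_colour:
  assumes "finite C" and "f ` C \<subseteq> {..<r}" and "k \<le> card C" and "0 < k"
  shows "\<exists>i<r. k \<le> r * card {x \<in> C. f x = i}"
proof (rule ccontr)
  assume "\<not> ?thesis"
  then have less: "r * card {x \<in> C. f x = i} < k" if "i < r" for i using that by (auto simp: not_le)
  have r: "r > 0"
  proof (rule ccontr)
    assume "\<not> r > 0"
    then have "C = {}" using assms(2) by auto
    then show False using assms(3,4) by simp
  qed
  have "C = (\<Union>i\<in>{..<r}. {x \<in> C. f x = i})" using assms(2) by auto
  then have "card C \<le> (\<Sum>i<r. card {x \<in> C. f x = i})"
    using card_UN_le[of "{..<r}" "\<lambda>i. {x \<in> C. f x = i}"] by simp
  then have "r * k \<le> (\<Sum>i<r. r * card {x \<in> C. f x = i})"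
    using assms(3) by (simp add: sum_distrib_left[symmetric])
  also have "\<dots> < (\<Sum>i<r. k)" using less r by (intro sum_strict_mono) auto
  finally show False by simp
qed

text \<open>Blow up each vertex \<open>v\<close> of \<open>F\<close> to \<open>k * w v\<close>
  vertices. The blow-up maps to \<open>F\<close>, hence contains no \<open>H\<close>. After the
  deletions, give each vertex of \<open>F\<close> a majority colour of its class; some edge of
  \<open>F\<close> becomes monochromatic, and all edges between the two majority parts must have
  been deleted.\<close>

lemma not_admissible_if_weights:
  fixes F :: "'b graph" and w :: "'b \<Rightarrow> nat"
  assumes F: "simple_graph F" and w: "\<And>v. v \<in> verts F \<Longrightarrow> 1 \<le> w v"
    and missing: "\<And>v. v \<in> verts F \<Longrightarrow> missing_weight F w v \<le> m"
    and n: "n = (\<Sum>v\<in>verts F. w v)" "0 < n" and c: "c * real n \<le> real n - real m"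
    and np: "\<not> partite r F" and r: "0 < r" and H: "\<not> homomorphic H F" and chi: "chromatic_number H - 1 = r"
    and sH: "simple_graph H"
  shows "c \<notin> admissible H"
proof
  assume "c \<in> admissible H"
  \<comment> \<open>At least \<open>(k / r) ^ 2\<close> edges are deleted; this choice permits only
    half as many.\<close>
  define \<eta> :: real where "\<eta> = 1 / (2 * real r ^ 2 * real n ^ 2)"
  have "0 < \<eta>" using r n(2) by (simp add: \<eta>_def)
  then have "\<exists>n0 :: nat. \<forall>G :: nat graph.
       simple_graph G \<and> card (verts G) \<ge> n0 \<and> free_of H G \<and>
       real (min_degree G) \<ge> c * real (card (verts G))
       \<longrightarrow> (\<exists>D \<subseteq> edges G. real (card D) \<le> \<eta> * (real (card (verts G)))\<^sup>2 \<and>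
             partite r (delete_edges G D))"
    using \<open>c \<in> admissible H\<close>[unfolded admissible_def chi mem_Collect_eq] by simp
  then obtain n0 :: nat where n0: "\<forall>G :: nat graph.
       simple_graph G \<and> card (verts G) \<ge> n0 \<and> free_of H G \<and>
       real (min_degree G) \<ge> c * real (card (verts G))
       \<longrightarrow> (\<exists>D \<subseteq> edges G. real (card D) \<le> \<eta> * (real (card (verts G)))\<^sup>2 \<and>
             partite r (delete_edges G D))" ..
  \<comment> \<open>Positive, and large enough for the blow-up to have at least \<open>n0\<close>
    vertices.\<close>
  define k where "k = Suc n0"
  have fF: "finite (verts F)" using F by (simp add: simple_graph_def)
  have kn: "(\<Sum>v\<in>verts F. k * w v) = k * n" by (simp add: n sum_distrib_left)
  obtain p where p: "p ` {..<k * n} \<subseteq> verts F"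
    "\<And>v. v \<in> verts F \<Longrightarrow> card {i. i < k * n \<and> p i = v} = k * w v"
    using blow_up_map_exists[OF fF, of "\<lambda>v. k * w v"] unfolding kn by blast
  define G where "G = Graph {..<k * n} {{i, j} | i j. i < k * n \<and> j < k * n \<and> {p i, p j} \<in> edges F}"
  have edgeG: "{i, j} \<in> edges G \<longleftrightarrow> i < k * n \<and> j < k * n \<and> {p i, p j} \<in> edges F" for i j
  proof -
    have "{p j, p i} = {p i, p j}" for i j by (rule insert_commute)
    then show ?thesis unfolding G_def graph.sel by (intro doubleton_mem_iff) simp
  qed
  have vG: "verts G = {..<k * n}" by (simp add: G_def)
  have sG: "simple_graph G"
    unfolding simple_graph_def
  proof (intro conjI ballI)
    fix e assume "e \<in> edges G"
    then obtain i j where e: "e = {i, j}" "i < k * n" "j < k * n" "{p i, p j} \<in> edges F" by (auto simp: G_def)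
    have "p i \<noteq> p j" using edge_of_simple_graph(3)[OF F e(4)] .
    then have "card {i, j} = 2" by (cases "i = j") simp_all
    then show "card e = 2" unfolding e(1) .
    show "e \<subseteq> verts G" using e(2,3) unfolding e(1) vG by simp
  qed (simp add: vG)
  have cG: "card (verts G) = k * n" by (simp add: vG)
  have "n0 * 1 \<le> k * n" using n(2) by (intro mult_le_mono) (simp_all add: k_def)
  then have "n0 \<le> k * n" by simp
  moreover have "free_of H G"
    unfolding free_of_def
  proof
    assume "\<exists>S. subgraph S G \<and> isomorphic H S"
    then obtain S where sub: "subgraph S G" and iso: "isomorphic H S" by blast
    obtain f where f: "bij_betw f (verts H) (verts S) \<and> (\<lambda>e. f ` e) ` edges H = edges S"
      using iso unfolding isomorphic_def ..
    have fH: "f ` verts H \<subseteq> {..<k * n}"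
      using f sub by (simp add: bij_betw_def subgraph_def vG)
    have fE: "f ` e \<in> edges G" if "e \<in> edges H" for e
    proof -
      have "f ` e \<in> (\<lambda>e. f ` e) ` edges H" using that by (rule imageI)
      then show ?thesis using f sub by (auto simp: subgraph_def)
    qed
    have "homomorphic H F"
      unfolding homomorphic_def
    proof (intro exI[of _ "p \<circ> f"] conjI allI impI)
      show "(p \<circ> f) ` verts H \<subseteq> verts F"
        unfolding image_comp[symmetric] using image_mono[OF fH, of p] p(1) by (rule order_trans)
      fix u v assume "{u, v} \<in> edges H"
      then have "f ` {u, v} \<in> edges G" by (rule fE)
      then show "{(p \<circ> f) u, (p \<circ> f) v} \<in> edges F" using edgeG[of "f u" "f v"] by simp
    qed
    then show False using H by blast
  qed
  moreover have "c * real (k * n) \<le> real (min_degree G)"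
  proof -
    have deg: "k * n \<le> degree G i + k * m" if i: "i < k * n" for i
    proof -
      have pi: "p i \<in> verts F" using p(1) i by blast
      let ?U = "{u \<in> verts F. {u, p i} \<notin> edges F}"
      have "{..<k * n} \<subseteq> {j \<in> verts G. {j, i} \<in> edges G} \<union> (\<Union>u\<in>?U. {j. j < k * n \<and> p j = u})"
        using p(1) i by (auto simp: edgeG vG)
      then have "card {..<k * n} \<le> card ({j \<in> verts G. {j, i} \<in> edges G} \<union> (\<Union>u\<in>?U. {j. j < k * n \<and> p j = u}))"
        by (rule card_mono[rotated]) (use fF in \<open>auto simp: vG\<close>)
      also have "\<dots> \<le> degree G i + card (\<Union>u\<in>?U. {j. j < k * n \<and> p j = u})"
        unfolding degree_def by (rule card_Un_le)
      also have "card (\<Union>u\<in>?U. {j. j < k * n \<and> p j = u}) \<le> (\<Sum>u\<in>?U. card {j. j < k * n \<and> p j = u})"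
        using fF by (intro card_UN_le) simp
      also have "\<dots> = (\<Sum>u\<in>?U. k * w u)" using p(2) by (intro sum.cong) auto
      also have "\<dots> = k * missing_weight F w (p i)" by (simp add: missing_weight_def sum_distrib_left)
      also have "\<dots> \<le> k * m" using missing[OF pi] by simp
      finally show ?thesis by simp
    qed
    have "min_degree G \<in> degree G ` verts G"
      unfolding min_degree_def using n(2) by (intro Min_in) (auto simp: vG k_def)
    then obtain i where "i < k * n" "min_degree G = degree G i" by (auto simp: vG)
    then have "k * n \<le> min_degree G + k * m" using deg[of i] by simp
    then have "real (k * n) \<le> real (min_degree G + k * m)" by (rule of_nat_mono)
    moreover have "k * (c * real n) \<le> k * (real n - real m)" using c by (intro mult_left_mono) auto
    ultimately show ?thesis by (simp add: algebra_simps)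
  qed
  ultimately obtain D where D: "D \<subseteq> edges G" "real (card D) \<le> \<eta> * (real (k * n))\<^sup>2" "partite r (delete_edges G D)"
    using n0[rule_format, of G] sG unfolding cG by blast
  obtain f where f0: "f ` verts (delete_edges G D) \<subseteq> {..<r} \<and>
      (\<forall>u v. {u, v} \<in> edges (delete_edges G D) \<longrightarrow> f u \<noteq> f v)"
    using D(3) unfolding partite_def ..
  then have f: "f ` {..<k * n} \<subseteq> {..<r}" by (simp add: delete_edges_def vG)
  have fD: "{i, j} \<in> D" if "{i, j} \<in> edges G" "f i = f j" for i j
    using f0 that unfolding delete_edges_def by auto
  define C where "C v i = {x. x < k * n \<and> p x = v \<and> f x = i}" for v i
  have "\<exists>i<r. k \<le> r * card (C v i)" if v: "v \<in> verts F" for v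
  proof -
    have "\<exists>i<r. k \<le> r * card {x \<in> {i. i < k * n \<and> p i = v}. f x = i}"
    proof (rule ex_majority_colour)
      show "k \<le> card {i. i < k * n \<and> p i = v}" using p(2)[OF v] w[OF v] by simp
    qed (use f in \<open>auto simp: k_def\<close>)
    then show ?thesis by (simp add: C_def conj_assoc)
  qed
  then obtain h where h: "\<And>v. v \<in> verts F \<Longrightarrow> h v < r \<and> k \<le> r * card (C v (h v))" by metis
  have "\<exists>u v. {u, v} \<in> edges F \<and> h u = h v"
  proof (rule ccontr)
    assume "\<not> ?thesis"
    then have "partite r F" unfolding partite_def using h by (intro exI[of _ h]) auto
    then show False using np by blast
  qed
  then obtain u v where uv: "{u, v} \<in> edges F" "h u = h v" by blast
  have uvF: "u \<in> verts F" "v \<in> verts F" "u \<noteq> v" using edge_of_simple_graph[OF F uv(1)] by auto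
  let ?X = "C u (h u)" and ?Y = "C v (h v)"
  have "(\<lambda>(x, y). {x, y}) ` (?X \<times> ?Y) \<subseteq> D"
    using fD edgeG uv by (auto simp: C_def)
  moreover have "inj_on (\<lambda>(x, y). {x, y}) (?X \<times> ?Y)"
    using uvF(3) by (auto simp: inj_on_def C_def doubleton_eq_iff)
  moreover have "finite (edges G)"
    by (rule finite_subset[of _ "Pow (verts G)"]) (use sG in \<open>auto simp: simple_graph_def\<close>)
  then have "finite D" using D(1) finite_subset by blast
  ultimately have "card (?X \<times> ?Y) \<le> card D" by (intro card_inj_on_le)
  then have "card ?X * card ?Y \<le> card D" by (simp add: card_cartesian_product)
  then have XY: "real (card ?X) * real (card ?Y) \<le> card D"
    using of_nat_mono[of "card ?X * card ?Y" "card D"] by simp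
  have "real k \<le> real r * card ?X" "real k \<le> real r * card ?Y"
    using of_nat_mono[of k "r * card ?X"] of_nat_mono[of k "r * card ?Y"] h[OF uvF(1)] h[OF uvF(2)]
    by simp_all
  then have "real k * real k \<le> (real r * card ?X) * (real r * card ?Y)" by (intro mult_mono) auto
  also have "\<dots> = real r ^ 2 * (real (card ?X) * real (card ?Y))" by (simp add: power2_eq_square)
  also have "\<dots> \<le> real r ^ 2 * (\<eta> * (real (k * n))\<^sup>2)"
    using XY D(2) by (intro mult_left_mono) auto
  also have "\<dots> = real k * real k / 2"
  proof -
    have "real r \<noteq> 0" "real n \<noteq> 0" using r n(2) by simp_all
    then show ?thesis by (simp add: \<eta>_def power2_eq_square)
  qed
  finally have "real k * real k \<le> real k * real k / 2" .
  moreover have "0 < real k" unfolding k_def by (rule of_nat_0_less_iff[THEN iffD2]) (rule zero_less_Suc)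
  then have "0 < real k * real k" by simp
  ultimately show False by linarith
qed

text \<open>Vertices of weight zero are allowed here, since all weights can be increased slightly.\<close>

lemma admissible_lower_bound:
  fixes F :: "'b graph" and w :: "'b \<Rightarrow> nat"
  assumes F: "simple_graph F" and missing: "\<And>v. v \<in> verts F \<Longrightarrow> missing_weight F w v \<le> m"
    and n: "n = (\<Sum>v\<in>verts F. w v)" "0 < n" and np: "\<not> partite r F" and r: "0 < r"
    and H: "\<not> homomorphic H F" and chi: "chromatic_number H - 1 = r" and sH: "simple_graph H"
    and c: "c \<in> admissible H"
  shows "1 - real m / real n \<le> c"
proof (rule ccontr)
  assume "\<not> ?thesis"
  then have d: "0 < (1 - c) * n - m" using n(2) by (simp add: field_simps)
  let ?q = "card (verts F)"
  have fF: "finite (verts F)" using F by (simp add: simple_graph_def)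
  \<comment> \<open>The weights are scaled by \<open>t\<close> before 1 is added, so that the strict
    inequality outweighs the \<open>?q\<close> additional units.\<close>
  obtain t :: nat where "?q * c / ((1 - c) * n - m) < t" using reals_Archimedean2 by blast
  then have t: "?q * c < t * ((1 - c) * n - m)" using d by (simp add: pos_divide_less_eq)
  let ?w = "\<lambda>v. t * w v + 1"
  have "c \<notin> admissible H"
  proof (rule not_admissible_if_weights[where w = ?w and m = "t * m + ?q" and n = "t * n + ?q",
        OF F _ _ _ _ _ np r H chi sH])
    show "missing_weight F ?w v \<le> t * m + ?q" if "v \<in> verts F" for v
    proof -
      have "card {u. u \<in> verts F \<and> {u, v} \<notin> edges F} \<le> ?q" using fF by (intro card_mono) auto
      moreover have "missing_weight F ?w v = t * missing_weight F w v + card {u. u \<in> verts F \<and> {u, v} \<notin> edges F}"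
        unfolding missing_weight_def by (simp add: sum_Suc sum_distrib_left)
      ultimately show ?thesis using mult_le_mono2[OF missing[OF that], of t] by linarith
    qed
    show "t * n + ?q = (\<Sum>v\<in>verts F. ?w v)" 
      unfolding sum.distrib n(1) by (simp add: sum_distrib_left)
    have "verts F \<noteq> {}"
    proof
      assume "verts F = {}"
      then have "n = 0" using n(1) by simp
      then show False using n(2) by simp
    qed
    then have "0 < ?q" using fF by (simp add: card_gt_0_iff)
    then show "0 < t * n + ?q" by simp
    show "c * real (t * n + ?q) \<le> real (t * n + ?q) - real (t * m + ?q)"
    proof -
      have "c * real (t * n + ?q) - (real (t * n + ?q) - real (t * m + ?q)) =
          ?q * c - t * ((1 - c) * n - m)"
        by (simp add: ring_distribs)
      then show ?thesis using t by linarith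
    qed
  qed simp
  then show False using c by blast
qed

section \<open>Joins with complete graphs\<close>

lemma doubleton_eq_image_iff:
  "{Inl a, Inl b} = Inl ` e \<longleftrightarrow> e = {a, b}" "{Inr u, Inr v} = Inr ` f \<longleftrightarrow> f = {u, v}"
  "{Inl a, Inl b} \<noteq> Inr ` f" "{Inr u, Inr v} \<noteq> Inl ` e"
  "{Inl a, Inr v} \<noteq> Inl ` e" "{Inl a, Inr v} \<noteq> Inr ` f"
proof -
  have l: "{Inl a, Inl b} = Inl ` {a, b}" and r: "{Inr u, Inr v} = Inr ` {u, v}" by simp_all
  show "{Inl a, Inl b} = Inl ` e \<longleftrightarrow> e = {a, b}"
    unfolding l inj_image_eq_iff[OF inj_Inl] by (rule eq_commute)
  show "{Inr u, Inr v} = Inr ` f \<longleftrightarrow> f = {u, v}"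
    unfolding r inj_image_eq_iff[OF inj_Inr] by (rule eq_commute)
qed auto

lemma edges_join_iff:
  shows "{Inl a, Inl b} \<in> edges (join K F) \<longleftrightarrow> {a, b} \<in> edges K"
    and "{Inr u, Inr v} \<in> edges (join K F) \<longleftrightarrow> {u, v} \<in> edges F"
    and "{Inl a, Inr v} \<in> edges (join K F) \<longleftrightarrow> a \<in> verts K \<and> v \<in> verts F"
    and "{Inr v, Inl a} \<in> edges (join K F) \<longleftrightarrow> a \<in> verts K \<and> v \<in> verts F"
proof -
  show "{Inl a, Inl b} \<in> edges (join K F) \<longleftrightarrow> {a, b} \<in> edges K"
    by (simp add: join_def image_iff doubleton_eq_image_iff doubleton_eq_iff)
  show "{Inr u, Inr v} \<in> edges (join K F) \<longleftrightarrow> {u, v} \<in> edges F"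
    by (simp add: join_def image_iff doubleton_eq_image_iff doubleton_eq_iff)
  show x: "{Inl a, Inr v} \<in> edges (join K F) \<longleftrightarrow> a \<in> verts K \<and> v \<in> verts F"
    by (simp add: join_def image_iff doubleton_eq_image_iff doubleton_eq_iff)
  show "{Inr v, Inl a} \<in> edges (join K F) \<longleftrightarrow> a \<in> verts K \<and> v \<in> verts F"
    using x by (simp add: insert_commute)
qed

lemma simple_graph_complete: "simple_graph (complete_graph a)"
  by (simp add: simple_graph_def complete_graph_def)

lemma simple_graph_join:
  assumes "simple_graph K" "simple_graph F"
  shows "simple_graph (join K F)"
  unfolding simple_graph_def
proof (intro conjI ballI)
  show "finite (verts (join K F))" using assms by (simp add: simple_graph_def join_def)
  fix e assume "e \<in> edges (join K F)"
  then consider e' where "e' \<in> edges K" "e = Inl ` e'" | e' where "e' \<in> edges F" "e = Inr ` e'"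
    | a b where "a \<in> verts K" "b \<in> verts F" "e = {Inl a, Inr b}"
    unfolding join_def graph.sel by blast
  then have "e \<subseteq> verts (join K F) \<and> card e = 2"
  proof cases
    case 1
    then show ?thesis using assms(1) by (auto simp: simple_graph_def join_def card_image)
  next
    case 2
    then show ?thesis using assms(2) by (auto simp: simple_graph_def join_def card_image)
  next
    case 3
    then show ?thesis by (auto simp: join_def)
  qed
  then show "e \<subseteq> verts (join K F)" "card e = 2" by blast+
qed

lemma verts_complete: "verts (complete_graph a) = {..<a}"
  by (simp add: complete_graph_def)

lemma edges_complete_iff: "{i, j} \<in> edges (complete_graph a) \<longleftrightarrow> i < a \<and> j < a \<and> i \<noteq> j"
  by (auto simp: complete_graph_def card_insert_if split: if_splits)

text \<open>The complete part uses \<open>a\<close> distinct colours, none of which can occur on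
  \<open>F\<close>; the remaining \<open>q\<close> are renumbered.\<close>

lemma partite_join_complete:
  assumes "partite (a + q) (join (complete_graph a) F)" and F: "simple_graph F"
  shows "partite q F"
proof -
  obtain f where f: "f ` verts (join (complete_graph a) F) \<subseteq> {..<a + q} \<and>
      (\<forall>u v. {u, v} \<in> edges (join (complete_graph a) F) \<longrightarrow> f u \<noteq> f v)"
    using assms(1) unfolding partite_def ..
  have ne: "f u \<noteq> f v" if "{u, v} \<in> edges (join (complete_graph a) F)" for u v using f that by blast
  define B where "B = {..<a + q} - (\<lambda>i. f (Inl i)) ` {..<a}"
  have "inj_on (\<lambda>i. f (Inl i)) {..<a}"
  proof (rule inj_onI, rule ccontr)
    fix i j assume "i \<in> {..<a}" "j \<in> {..<a}" "f (Inl i) = f (Inl j)" "i \<noteq> j"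
    then show False using ne[of "Inl i" "Inl j"] by (simp add: edges_join_iff edges_complete_iff)
  qed
  then have "card ((\<lambda>i. f (Inl i)) ` {..<a}) = a" by (simp add: card_image)
  moreover have "(\<lambda>i. f (Inl i)) ` {..<a} \<subseteq> {..<a + q}"
    using f by (auto simp: join_def complete_graph_def)
  ultimately have "card B = q" by (simp add: B_def card_Diff_subset)
  then obtain h where h: "bij_betw h B {..<q}"
    using finite_same_card_bij[of B "{..<q}"] by (auto simp: B_def)
  have fB: "f (Inr v) \<in> B" if v: "v \<in> verts F" for v
  proof -
    have "f (Inl i) \<noteq> f (Inr v)" if "i < a" for i
      by (rule ne) (use that v in \<open>simp add: edges_join_iff complete_graph_def\<close>)
    then have "f (Inr v) \<notin> (\<lambda>i. f (Inl i)) ` {..<a}" by force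
    moreover have "f (Inr v) \<in> {..<a + q}" using f v by (auto simp: join_def)
    ultimately show ?thesis by (simp add: B_def)
  qed
  show ?thesis
    unfolding partite_def
  proof (intro exI[of _ "\<lambda>v. h (f (Inr v))"] conjI allI impI)
    show "(\<lambda>v. h (f (Inr v))) ` verts F \<subseteq> {..<q}" using fB h by (auto simp: bij_betw_def)
    fix u v assume uv: "{u, v} \<in> edges F"
    then have "f (Inr u) \<noteq> f (Inr v)" by (intro ne) (simp add: edges_join_iff)
    moreover have "f (Inr u) \<in> B" "f (Inr v) \<in> B" using edge_of_simple_graph[OF F uv] fB by auto
    ultimately show "h (f (Inr u)) \<noteq> h (f (Inr v))" using h by (auto simp: bij_betw_def inj_on_def)
  qed
qed

text \<open>Each vertex of the complete part misses only itself, so it can carry the full weight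
  \<open>m\<close>. The total becomes \<open>a * m + N\<close>.\<close>

lemma admissible_lower_bound_join:
  fixes F :: "'b graph" and w :: "'b \<Rightarrow> nat"
  assumes F: "simple_graph F" and missing: "\<And>v. v \<in> verts F \<Longrightarrow> missing_weight F w v \<le> m"
    and N: "N = (\<Sum>v\<in>verts F. w v)" "0 < N" and m: "0 < m" and np: "\<not> partite q F" and r: "r = a + q" "0 < r"
    and H: "\<not> homomorphic H (join (complete_graph a) F)" and chi: "chromatic_number H - 1 = r"
    and sH: "simple_graph H" and c: "c \<in> admissible H"
  shows "1 - 1 / (real a + real N / real m) \<le> c"
proof -
  let ?J = "join (complete_graph a) F" and ?w = "case_sum (\<lambda>_ :: nat. m) w"
  have fF: "finite (verts F)" using F by (simp add: simple_graph_def)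
  have loop: "{x} \<notin> edges ?J" for x
    using edge_of_simple_graph(3)[OF simple_graph_join[OF simple_graph_complete F], of x x] by auto
  have vJ: "verts ?J = {..<a} <+> verts F" by (simp add: join_def complete_graph_def)
  have "1 - real m / real (a * m + N) \<le> c"
  proof (rule admissible_lower_bound[where w = ?w and F = ?J and m = m and n = "a * m + N",
        OF _ _ _ _ _ r(2) H chi sH c])
    show "simple_graph ?J" by (rule simple_graph_join[OF simple_graph_complete F])
    show "missing_weight ?J ?w x \<le> m" if x: "x \<in> verts ?J" for x
    proof (cases x)
      case (Inl i)
      then have "i < a" using x by (auto simp: vJ)
      then have "{u. u \<in> verts ?J \<and> {u, x} \<notin> edges ?J} = {Inl i}"
        unfolding Inl vJ using loop[of "Inl i"]
        by (auto simp: edges_join_iff edges_complete_iff verts_complete)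
      then show ?thesis by (simp add: missing_weight_def)
    next
      case (Inr v)
      then have v: "v \<in> verts F" using x by (auto simp: vJ)
      then have "{u. u \<in> verts ?J \<and> {u, x} \<notin> edges ?J} = Inr ` {u. u \<in> verts F \<and> {u, v} \<notin> edges F}"
        unfolding Inr vJ by (auto simp: edges_join_iff verts_complete)
      then have "missing_weight ?J ?w x = missing_weight F w v"
        by (simp add: missing_weight_def sum.reindex)
      then show ?thesis using missing[OF v] by simp
    qed
    show "a * m + N = (\<Sum>x\<in>verts ?J. ?w x)" unfolding vJ by (simp add: sum.Plus fF N(1))
    show "0 < a * m + N" using N(2) by simp
    show "\<not> partite r ?J" using partite_join_complete[of a q F] F np r(1) by blast
  qed
  moreover have "real m / real (a * m + N) = 1 / (real a + real N / real m)"
    using m by (simp add: field_simps)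
  ultimately show ?thesis by simp
qed

section \<open>Explicit edge lists and weights for the exceptional graphs\<close>

lemma simple_graph_pairs:
  assumes "verts F = set vs" "edges F = (\<lambda>(i, j). {i, j}) ` set L"
    and "\<forall>(i, j)\<in>set L. i \<in> set vs \<and> j \<in> set vs \<and> i \<noteq> j"
  shows "simple_graph F"
  using assms by (auto simp: simple_graph_def)

lemma missing_weight_pairs:
  assumes "verts F = set vs" "edges F = (\<lambda>(i, j). {i, j}) ` set L" "distinct vs"
    and "\<forall>v\<in>set vs. (\<Sum>u\<leftarrow>vs. if (u, v) \<in> set L \<or> (v, u) \<in> set L then 0 else w u) \<le> m"
    and "v \<in> verts F"
  shows "missing_weight F w v \<le> m"
proof -
  have e: "{u, v} \<in> edges F \<longleftrightarrow> (u, v) \<in> set L \<or> (v, u) \<in> set L" for u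
    unfolding assms(2) by (force simp: doubleton_eq_iff)
  have "missing_weight F w v = (\<Sum>u\<in>set vs. if (u, v) \<in> set L \<or> (v, u) \<in> set L then 0 else w u)"
    unfolding missing_weight_def e assms(1) by (simp add: sum.If_cases Int_def conj_commute)
  also have "\<dots> = (\<Sum>u\<leftarrow>vs. if (u, v) \<in> set L \<or> (v, u) \<in> set L then 0 else w u)"
    using assms(3) by (simp add: sum_list_distinct_conv_sum_set)
  finally show ?thesis using assms(1,4,5) by simp
qed

text \<open>The colour classes appear as predicates, so that for explicit lists non-colourability
  becomes a propositional contradiction. Covering the vertices is enough for this.\<close>

lemma not_3_partite_pairs:
  assumes "verts F = set vs" "edges F = (\<lambda>(i, j). {i, j}) ` set L"
    and "\<And>P Q R. \<forall>i\<in>set vs. P i \<or> Q i \<or> R i \<Longrightarrow>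
      \<forall>(i, j)\<in>set L. \<not> (P i \<and> P j) \<and> \<not> (Q i \<and> Q j) \<and> \<not> (R i \<and> R j) \<Longrightarrow> False"
  shows "\<not> partite 3 F"
proof
  assume "partite 3 F"
  then obtain f :: "'a \<Rightarrow> nat" where f: "f ` set vs \<subseteq> {..<3} \<and> (\<forall>u v. {u, v} \<in> edges F \<longrightarrow> f u \<noteq> f v)"
    unfolding partite_def assms(1) ..
  have "f i = 0 \<or> f i = 1 \<or> f i = 2" if "i \<in> set vs" for i
  proof -
    have "f i < 3" using f that by auto
    then show ?thesis by presburger
  qed
  moreover have "f i \<noteq> f j" if "(i, j) \<in> set L" for i j
    using f that unfolding assms(2) by force
  ultimately show False using assms(3)[of "\<lambda>i. f i = 0" "\<lambda>i. f i = 1" "\<lambda>i. f i = 2"] by force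
qed

text \<open>One orientation of every edge in an explicit list, on which weights and adjacencies can
  be evaluated.\<close>

definition C7_pairs :: "(nat \<times> nat) list" where
  "C7_pairs = [(0, 1), (0, 2), (1, 2), (1, 3), (2, 3), (2, 4), (3, 4), (3, 5), (4, 5), (4, 6), (5, 6),
    (5, 0), (6, 0), (6, 1)]"

definition H2_pairs :: "(nat \<times> nat) list" where
  "H2_pairs = [(0, 1), (0, 2), (1, 2), (1, 3), (2, 3), (2, 4), (3, 4), (3, 5), (4, 5), (4, 6), (5, 6),
    (5, 0), (6, 0)]"

definition H2_plus_pairs :: "(nat \<times> nat) list" where
  "H2_plus_pairs = H2_pairs @ [(7, 0), (7, 2), (7, 5)]"

definition T0_pairs :: "(nat \<times> nat) list" where
  "T0_pairs = [(0, 1), (1, 2), (2, 3), (3, 4), (4, 5), (5, 6), (6, 0), (8, 0), (8, 2), (8, 3), (8, 4),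
    (8, 5), (8, 6), (9, 0), (9, 1), (9, 2), (9, 3), (9, 4), (9, 5), (7, 0), (7, 8), (7, 9)]"

definition H1_plus_plus_pairs :: "(nat \<times> nat) list" where
  "H1_plus_plus_pairs = [(0, 1), (1, 2), (2, 3), (3, 4), (4, 5), (5, 6), (6, 0), (3, 5), (5, 0), (0, 2),
    (2, 4), (6, 1), (7, 0), (7, 2), (7, 3), (8, 0), (8, 3), (8, 5)]"

lemma C7_edges: "edges C7_complement = (\<lambda>(i, j). {i, j}) ` set C7_pairs"
  and C7_verts: "verts C7_complement = set [0, 1, 2, 3, 4, 5, 6]"
  unfolding edges_C7_complement C7_pairs_def by (simp, auto simp: C7_complement_def)

lemma H2_edges: "edges H2 = (\<lambda>(i, j). {i, j}) ` set H2_pairs"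
  and H2_verts: "verts H2 = set [0, 1, 2, 3, 4, 5, 6]"
  unfolding edges_H2 H2_pairs_def by (simp, simp add: H2_def delete_edges_def C7_verts)

lemma H2_plus_edges: "edges H2_plus = (\<lambda>(i, j). {i, j}) ` set H2_plus_pairs"
proof -
  have "{(0, 1), (0, 2), (1, 2), (1, 3), (2, 3), (2, 4), (3, 4), (3, 5), (4, 5), (4, 6), (5, 6), (5, 0), (6, 0)}
    \<union> {7} \<times> {0, 2, 5} = set H2_plus_pairs" by code_simp
  then show ?thesis unfolding edges_H2_plus by simp
qed

lemma H2_plus_verts: "verts H2_plus = set [0, 1, 2, 3, 4, 5, 6, 7]"
  by (auto simp: H2_plus_def H2_verts)

lemma T0_edges: "edges T0 = (\<lambda>(i, j). {i, j}) ` set T0_pairs"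
proof -
  have "(\<lambda>i. (i, Suc i mod 7)) ` set [0..<7] \<union> {8} \<times> {0, 2, 3, 4, 5, 6} \<union> {9} \<times> {0, 1, 2, 3, 4, 5} \<union>
    {7} \<times> {0, 8, 9} = set T0_pairs" by code_simp
  then show ?thesis unfolding edges_T0 atLeast_upt by simp
qed

lemma T0_verts: "verts T0 = set [0, 1, 2, 3, 4, 5, 6, 7, 8, 9]"
  by (auto simp: T0_def)

lemma H1_plus_plus_edges: "edges H1_plus_plus = (\<lambda>(i, j). {i, j}) ` set H1_plus_plus_pairs"
proof -
  have "(\<lambda>i. (i, Suc i mod 7)) ` set [0..<7] \<union> {(3, 5), (5, 0), (0, 2), (2, 4), (6, 1)} \<union>
    {7} \<times> {0, 2, 3} \<union> {8} \<times> {0, 3, 5} = set H1_plus_plus_pairs" by code_simp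
  moreover have "edges H1_plus_plus = (\<lambda>(i, j). {i, j}) ` ((\<lambda>i. (i, Suc i mod 7)) ` {..<7} \<union>
    {(3, 5), (5, 0), (0, 2), (2, 4), (6, 1)} \<union> {7} \<times> {0, 2, 3} \<union> {8} \<times> {0, 3, 5})"
    unfolding H1_plus_plus_def cycle_edges_eq edges_star graph.sel image_Un by simp
  ultimately show ?thesis unfolding atLeast_upt by simp
qed

lemma H1_plus_plus_verts: "verts H1_plus_plus = set [0, 1, 2, 3, 4, 5, 6, 7, 8]"
  by (auto simp: H1_plus_plus_def)

lemma not_3_partite:
  shows "\<not> partite 3 C7_complement" and "\<not> partite 3 H2" and "\<not> partite 3 H2_plus"
    and "\<not> partite 3 T0" and "\<not> partite 3 H1_plus_plus"
proof -
  show "\<not> partite 3 C7_complement"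
    by (rule not_3_partite_pairs[OF C7_verts C7_edges]) (simp only: C7_pairs_def append.simps list.set ball_simps prod.case; satx)
  show "\<not> partite 3 H2"
    by (rule not_3_partite_pairs[OF H2_verts H2_edges]) (simp only: H2_pairs_def append.simps list.set ball_simps prod.case; satx)
  show "\<not> partite 3 H2_plus"
    by (rule not_3_partite_pairs[OF H2_plus_verts H2_plus_edges])
      (simp only: H2_plus_pairs_def H2_pairs_def append.simps list.set ball_simps prod.case; satx)
  show "\<not> partite 3 T0"
    by (rule not_3_partite_pairs[OF T0_verts T0_edges]) (simp only: T0_pairs_def append.simps list.set ball_simps prod.case; satx)
  show "\<not> partite 3 H1_plus_plus"
    by (rule not_3_partite_pairs[OF H1_plus_plus_verts H1_plus_plus_edges])
      (simp only: H1_plus_plus_pairs_def append.simps list.set ball_simps prod.case; satx)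
qed

lemma pair_graph_bounds:
  assumes "verts F = set vs" "edges F = (\<lambda>(i, j). {i, j}) ` set L" "distinct vs"
    and "\<forall>(i, j)\<in>set L. i \<in> set vs \<and> j \<in> set vs \<and> i \<noteq> j"
    and "\<forall>v\<in>set vs. (\<Sum>u\<leftarrow>vs. if (u, v) \<in> set L \<or> (v, u) \<in> set L then 0 else w u) \<le> m"
    and "sum_list (map w vs) = N"
  shows "simple_graph F" and "\<And>v. v \<in> verts F \<Longrightarrow> missing_weight F w v \<le> m"
    and "N = (\<Sum>v\<in>verts F. w v)"
proof -
  show "simple_graph F" by (rule simple_graph_pairs[OF assms(1,2,4)])
  show "missing_weight F w v \<le> m" if "v \<in> verts F" for v
    by (rule missing_weight_pairs[OF assms(1-3,5) that])
  show "N = (\<Sum>v\<in>verts F. w v)"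
    using assms(3,6) by (simp add: assms(1) sum_list_distinct_conv_sum_set)
qed

section \<open>Odd cycles and odd wheels\<close>

lemma cycle_step_neq: "n \<ge> 3 \<Longrightarrow> i < n \<Longrightarrow> (i + 1) mod n \<noteq> (i :: nat)"
  by (cases "i + 1 < n") (auto simp: mod_if)

lemma card_non_neighbours_cycle:
  assumes n: "n \<ge> 3" and i: "i < n"
  shows "card {u. u < n \<and> {u, i} \<notin> cycle_edges n} \<le> n - 2"
proof -
  define j where "j = (i + n - 1) mod n"
  let ?k = "(i + 1) mod n"
  have j: "j < n" "(j + 1) mod n = i" "j = (if i = 0 then n - 1 else i - 1)"
    using n i by (auto simp: j_def mod_if)
  have k: "?k < n" "?k = (if i = n - 1 then 0 else i + 1)" using n i by (auto simp: mod_if)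
  have "{j, (j + 1) mod n} \<in> cycle_edges n" using j(1) unfolding cycle_edges_def by blast
  then have 1: "{j, i} \<in> cycle_edges n" unfolding j(2) .
  have "{i, ?k} \<in> cycle_edges n" using i unfolding cycle_edges_def by blast
  then have 2: "{?k, i} \<in> cycle_edges n" by (simp add: insert_commute)
  have ne: "j \<noteq> ?k" unfolding j(3) k(2) using n i by auto
  have "{u. u < n \<and> {u, i} \<notin> cycle_edges n} \<subseteq> {..<n} - {j, ?k}" using 1 2 by auto
  then have "card {u. u < n \<and> {u, i} \<notin> cycle_edges n} \<le> card ({..<n} - {j, ?k})"
    by (rule card_mono[rotated]) simp
  also have "\<dots> = n - 2" using j(1) k(1) ne by (subst card_Diff_subset) auto
  finally show ?thesis .
qed

lemma odd_cycle_not_alternating: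
  fixes n :: nat and g :: "nat \<Rightarrow> bool"
  assumes "odd n" and "\<And>i. i < n \<Longrightarrow> g i \<noteq> g ((i + 1) mod n)"
  shows False
proof -
  have "n > 0" using \<open>odd n\<close> by (rule odd_pos)
  have alt: "g i \<longleftrightarrow> (g 0 \<longleftrightarrow> even i)" if "i < n" for i
    using that
  proof (induction i)
    case (Suc i)
    have "g i \<noteq> g (Suc i)" using assms(2)[of i] Suc.prems by simp
    moreover have "g i \<longleftrightarrow> (g 0 \<longleftrightarrow> even i)" using Suc.IH Suc.prems by simp
    ultimately show ?case by simp blast
  qed simp
  obtain k where k: "n = Suc k" using \<open>n > 0\<close> by (cases n) auto
  have "g k \<longleftrightarrow> g 0" using alt[of k] \<open>odd n\<close> k by simp
  moreover have "g k \<noteq> g 0" using assms(2)[of k] k by simp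
  ultimately show False by blast
qed

lemma cycle_graph_bounds:
  assumes "n \<ge> 3" "odd n"
  shows "simple_graph (cycle_graph n)" and "\<not> partite 2 (cycle_graph n)"
    and "\<And>v. v \<in> verts (cycle_graph n) \<Longrightarrow> missing_weight (cycle_graph n) (\<lambda>_. 1) v \<le> n - 2"
    and "n = (\<Sum>v\<in>verts (cycle_graph n). 1)"
proof -
  show "simple_graph (cycle_graph n)"
    unfolding simple_graph_def
  proof (intro conjI ballI)
    fix e assume "e \<in> edges (cycle_graph n)"
    then obtain i where i: "e = {i, (i + 1) mod n}" "i < n"
      unfolding cycle_graph_def cycle_edges_def graph.sel by blast
    have "card {i, (i + 1) mod n} = 2" using cycle_step_neq[OF assms(1) i(2)] by (simp add: card_insert_if)
    then show "card e = 2" unfolding i(1) .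
    show "e \<subseteq> verts (cycle_graph n)" using assms(1) i(2) unfolding i(1) by (simp add: cycle_graph_def)
  qed (simp add: cycle_graph_def)
  show "\<not> partite 2 (cycle_graph n)"
  proof
    assume "partite 2 (cycle_graph n)"
    then obtain f :: "nat \<Rightarrow> nat" where f: "f ` {..<n} \<subseteq> {..<2} \<and> (\<forall>u v. {u, v} \<in> cycle_edges n \<longrightarrow> f u \<noteq> f v)"
      unfolding partite_def cycle_graph_def graph.sel ..
    have "(f i = 0) \<noteq> (f ((i + 1) mod n) = 0)" if "i < n" for i
    proof -
      have "(i + 1) mod n < n" using that by simp
      then have "f i < 2" "f ((i + 1) mod n) < 2" using f that by blast+
      moreover have "f i \<noteq> f ((i + 1) mod n)" using f that unfolding cycle_edges_def by blast
      ultimately show ?thesis by linarith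
    qed
    then show False using odd_cycle_not_alternating[OF assms(2), of "\<lambda>i. f i = 0"] by blast
  qed
  show "missing_weight (cycle_graph n) (\<lambda>_. 1) v \<le> n - 2" if "v \<in> verts (cycle_graph n)" for v
    using card_non_neighbours_cycle[OF assms(1), of v] that by (simp add: missing_weight_def cycle_graph_def)
  show "n = (\<Sum>v\<in>verts (cycle_graph n). 1)" by (simp add: cycle_graph_def)
qed

lemma edges_wheel_iff:
  assumes "n \<ge> 3" "i < n" "j < n"
  shows "{i, j} \<in> edges (wheel n) \<longleftrightarrow> {i, j} \<in> cycle_edges n" and "{n, i} \<in> edges (wheel n)"
  using assms by (auto simp: wheel_def doubleton_eq_iff)

text \<open>The hub gets weight \<open>n - 2\<close> so that, missing only itself, it misses as much
  as a rim vertex does. The ratio \<open>(2n - 2)/(n - 2)\<close> is the one at which counting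
  excludes the wheel.\<close>

lemma wheel_bounds:
  assumes "n \<ge> 3" "odd n"
  defines "w \<equiv> \<lambda>i. if i < n then 1 else n - 2"
  shows "simple_graph (wheel n)" and "\<not> partite 3 (wheel n)"
    and "\<And>v. v \<in> verts (wheel n) \<Longrightarrow> missing_weight (wheel n) w v \<le> n - 2"
    and "2 * n - 2 = (\<Sum>v\<in>verts (wheel n). w v)"
proof -
  show sg: "simple_graph (wheel n)"
    unfolding simple_graph_def
  proof (intro conjI ballI)
    fix e assume "e \<in> edges (wheel n)"
    then consider "e \<in> edges (cycle_graph n)" | i where "e = {n, i}" "i < n"
      by (auto simp: wheel_def cycle_graph_def)
    then have "card e = 2 \<and> e \<subseteq> verts (wheel n)"
    proof cases
      case 1
      then show ?thesis using cycle_graph_bounds(1)[OF assms(1,2)]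
        by (fastforce simp: simple_graph_def wheel_def cycle_graph_def)
    qed (auto simp: wheel_def)
    then show "card e = 2" "e \<subseteq> verts (wheel n)" by blast+
  qed (simp add: wheel_def)
  show "\<not> partite 3 (wheel n)"
  proof
    assume "partite 3 (wheel n)"
    then obtain f :: "nat \<Rightarrow> nat" where f: "f ` verts (wheel n) \<subseteq> {..<3} \<and>
        (\<forall>u v. {u, v} \<in> edges (wheel n) \<longrightarrow> f u \<noteq> f v)"
      unfolding partite_def ..
    have f3: "f i < 3" if "i \<le> n" for i using f that by (auto simp: wheel_def)
    have hub: "f n \<noteq> f i" if "i < n" for i using f edges_wheel_iff(2)[OF assms(1) that that] by blast
    \<comment> \<open>The rim uses only the two colours different from that of the hub, so
      membership in one of them would alternate along an odd cycle.\<close>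
    define a where "a = (f n + 1) mod 3"
    have "(f i = a) \<noteq> (f ((i + 1) mod n) = a)" if i: "i < n" for i
    proof -
      have k: "(i + 1) mod n < n" using i by simp
      have "{i, (i + 1) mod n} \<in> cycle_edges n" using i unfolding cycle_edges_def by blast
      then have "f i \<noteq> f ((i + 1) mod n)" using f edges_wheel_iff(1)[OF assms(1) i k] by blast
      moreover have "f n \<noteq> f i" "f n \<noteq> f ((i + 1) mod n)" using hub i k by blast+
      moreover have "f n < 3" "f i < 3" "f ((i + 1) mod n) < 3" using f3 i k by simp_all
      ultimately show ?thesis unfolding a_def by presburger
    qed
    then show False using odd_cycle_not_alternating[OF assms(2), of "\<lambda>i. f i = a"] by blast
  qed
  show "missing_weight (wheel n) w v \<le> n - 2" if v: "v \<in> verts (wheel n)" for v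
  proof (cases "v = n")
    case True
    have loop: "{n} \<notin> edges (wheel n)" using edge_of_simple_graph(3)[OF sg, of n n] by auto
    have "{u. u \<in> verts (wheel n) \<and> {u, v} \<notin> edges (wheel n)} = {n}"
    proof -
      have "{u, n} \<in> edges (wheel n)" if "u < n" for u
        using edges_wheel_iff(2)[OF assms(1) that that] by (simp add: insert_commute)
      then show ?thesis unfolding True using loop by (auto simp: wheel_def le_less)
    qed
    then show ?thesis by (simp add: missing_weight_def w_def)
  next
    case False
    then have vn: "v < n" using v by (simp add: wheel_def)
    have "{u. u \<in> verts (wheel n) \<and> {u, v} \<notin> edges (wheel n)} = {u. u < n \<and> {u, v} \<notin> cycle_edges n}"
      using edges_wheel_iff[OF assms(1) _ vn] edges_wheel_iff(2)[OF assms(1) vn vn]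
      by (auto simp: wheel_def le_less)
    then have "missing_weight (wheel n) w v = card {u. u < n \<and> {u, v} \<notin> cycle_edges n}"
      by (simp add: missing_weight_def w_def)
    then show ?thesis using card_non_neighbours_cycle[OF assms(1) vn] by simp
  qed
  have "{..n} = insert n {..<n}" by auto
  then show "2 * n - 2 = (\<Sum>v\<in>verts (wheel n). w v)" using assms(1) by (simp add: wheel_def w_def)
qed

text \<open>Optimal weights for the extremal blow-ups. Their ratio \<open>2 + c_const g\<close> is
  the density above which the graph, or for \<open>T0\<close> and \<open>H1_plus_plus\<close> the
  part of it named by \<open>T0m\<close> and \<open>H1\<close>, is excluded by counting.\<close>

lemma F_graph_bounds:
  assumes "1 \<le> g" "g \<le> 11"
  shows "\<exists>w m N. simple_graph (F_graph (g + 1)) \<and>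
    (\<forall>v\<in>verts (F_graph (g + 1)). missing_weight (F_graph (g + 1)) w v \<le> m) \<and>
    N = (\<Sum>v\<in>verts (F_graph (g + 1)). w v) \<and> 0 < N \<and> 0 < m \<and> \<not> partite 3 (F_graph (g + 1)) \<and>
    real N / real m = 2 + c_const g"
proof -
  have wheel: "\<exists>w m N. simple_graph (wheel n) \<and> (\<forall>v\<in>verts (wheel n). missing_weight (wheel n) w v \<le> m) \<and>
      N = (\<Sum>v\<in>verts (wheel n). w v) \<and> 0 < N \<and> 0 < m \<and> \<not> partite 3 (wheel n) \<and> real N / real m = 2 + c"
    if "n \<ge> 3" "odd n" "c = 2 / (real n - 2)" for n c
  proof -
    have "real (2 * n - 2) / real (n - 2) = 2 + c" using that(1) by (simp add: that(3) of_nat_diff field_simps)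
    then show ?thesis using wheel_bounds[OF that(1,2)] that(1)
      by (intro exI[of _ "\<lambda>i. if i < n then 1 else n - 2"] exI[of _ "n - 2"] exI[of _ "2 * n - 2"]) auto
  qed
  have pairs: "\<exists>w m N. simple_graph F \<and> (\<forall>v\<in>verts F. missing_weight F w v \<le> m) \<and>
      N = (\<Sum>v\<in>verts F. w v) \<and> 0 < N \<and> 0 < m \<and> \<not> partite 3 F \<and> real N / real m = 2 + c"
    if "verts F = set vs" "edges F = (\<lambda>(i, j). {i, j}) ` set L" "\<not> partite 3 F" "real N / real m = 2 + c"
      "0 < N" "0 < m"
      "distinct vs \<and> (\<forall>(i, j)\<in>set L. i \<in> set vs \<and> j \<in> set vs \<and> i \<noteq> j) \<and>
      (\<forall>v\<in>set vs. (\<Sum>u\<leftarrow>vs. if (u, v) \<in> set L \<or> (v, u) \<in> set L then 0 else ws ! u) \<le> m) \<and>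
      sum_list (map ((!) ws) vs) = N" for F vs L m N ws c
    using pair_graph_bounds[of F vs L "(!) ws" m N] that
    by (intro exI[of _ "(!) ws"] exI[of _ m] exI[of _ N]) auto
  note c = c_const_values and F = F_graph_values
  have "g = 1 \<or> g = 2 \<or> g = 3 \<or> g = 4 \<or> g = 5 \<or> g = 6 \<or> g = 7 \<or> g = 8 \<or> g = 9 \<or> g = 10 \<or> g = 11"
    using assms by presburger
  then consider "g = 1" | "g = 2" | "g = 3" | "g = 4" | "g = 5" | "g = 6" | "g = 7" | "g = 8" | "g = 9"
    | "g = 10" | "g = 11" by blast
  then show ?thesis
  proof cases
    case 1
    show ?thesis using wheel[of 5 "c_const 1"] unfolding 1 one_add_one F c by simp
  next
    case 2
    show ?thesis using wheel[of 7 "c_const 2"] unfolding 2 by (simp add: F c)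
  next
    case 3
    have "\<exists>w m N. simple_graph C7_complement \<and> (\<forall>v\<in>verts C7_complement. missing_weight C7_complement w v \<le> m) \<and>
      N = (\<Sum>v\<in>verts C7_complement. w v) \<and> 0 < N \<and> 0 < m \<and> \<not> partite 3 C7_complement \<and>
      real N / real m = 2 + c_const 3"
      by (rule pairs[where ws = "[1, 1, 1, 1, 1, 1, 1]" and m = 3 and N = 7, OF C7_verts C7_edges not_3_partite(1)])
        (simp add: c, simp, simp, code_simp)
    then show ?thesis unfolding 3 by (simp add: F)
  next
    case 4
    show ?thesis using wheel[of 9 "c_const 4"] unfolding 4 by (simp add: F c)
  next
    case 5
    have "\<exists>w m N. simple_graph H2_plus \<and> (\<forall>v\<in>verts H2_plus. missing_weight H2_plus w v \<le> m) \<and>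
      N = (\<Sum>v\<in>verts H2_plus. w v) \<and> 0 < N \<and> 0 < m \<and> \<not> partite 3 H2_plus \<and>
      real N / real m = 2 + c_const 5"
      \<comment> \<open>Here \<open>v1\<close> and \<open>v6\<close> carry no weight while
        \<open>u\<close> does: the optimum differs from that of \<open>H2\<close> and uses the
        additional vertex.\<close>
      by (rule pairs[where ws = "[2, 0, 2, 1, 1, 2, 0, 1]" and m = 4 and N = 9,
            OF H2_plus_verts H2_plus_edges not_3_partite(3)])
        (simp add: c, simp, simp, code_simp)
    then show ?thesis unfolding 5 by (simp add: F)
  next
    case 6
    show ?thesis using wheel[of 11 "c_const 6"] unfolding 6 by (simp add: F c)
  next
    case 7
    have "\<exists>w m N. simple_graph H2 \<and> (\<forall>v\<in>verts H2. missing_weight H2 w v \<le> m) \<and>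
      N = (\<Sum>v\<in>verts H2. w v) \<and> 0 < N \<and> 0 < m \<and> \<not> partite 3 H2 \<and> real N / real m = 2 + c_const 7"
      by (rule pairs[where ws = "[3, 1, 2, 1, 1, 2, 1]" and m = 5 and N = 11, OF H2_verts H2_edges not_3_partite(2)])
        (simp add: c, simp, simp, code_simp)
    then show ?thesis unfolding 7 by (simp add: F)
  next
    case 8
    show ?thesis using wheel[of 13 "c_const 8"] unfolding 8 by (simp add: F c)
  next
    case 9
    have "\<exists>w m N. simple_graph T0 \<and> (\<forall>v\<in>verts T0. missing_weight T0 w v \<le> m) \<and>
      N = (\<Sum>v\<in>verts T0. w v) \<and> 0 < N \<and> 0 < m \<and> \<not> partite 3 T0 \<and> real N / real m = 2 + c_const 9"
      by (rule pairs[where ws = "[4, 0, 0, 1, 1, 0, 0, 1, 3, 3]" and m = 6 and N = 13,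
            OF T0_verts T0_edges not_3_partite(4)])
        (simp add: c, simp, simp, code_simp)
    then show ?thesis unfolding 9 by (simp add: F)
  next
    case 10
    show ?thesis using wheel[of 15 "c_const 10"] unfolding 10 by (simp add: F c)
  next
    case 11
    have "\<exists>w m N. simple_graph H1_plus_plus \<and> (\<forall>v\<in>verts H1_plus_plus. missing_weight H1_plus_plus w v \<le> m) \<and>
      N = (\<Sum>v\<in>verts H1_plus_plus. w v) \<and> 0 < N \<and> 0 < m \<and> \<not> partite 3 H1_plus_plus \<and>
      real N / real m = 2 + c_const 11"
      by (rule pairs[where ws = "[5, 0, 3, 2, 0, 3, 0, 1, 1]" and m = 7 and N = 15,
            OF H1_plus_plus_verts H1_plus_plus_edges not_3_partite(5)])
        (simp add: c, simp, simp, code_simp)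
    then show ?thesis unfolding 11 by (simp add: F)
  qed
qed

text \<open>The image misses a vertex of the cycle, and a path is bipartite.\<close>

lemma partite_if_homomorphic_long_cycle:
  assumes sH: "simple_graph H" and hom: "homomorphic H (join (complete_graph a) (cycle_graph n))"
    and n: "card (verts H) < n"
  shows "partite (a + 2) H"
proof -
  obtain \<phi> where \<phi>: "\<phi> ` verts H \<subseteq> verts (join (complete_graph a) (cycle_graph n)) \<and>
      (\<forall>u v. {u, v} \<in> edges H \<longrightarrow> {\<phi> u, \<phi> v} \<in> edges (join (complete_graph a) (cycle_graph n)))"
    using hom unfolding homomorphic_def ..
  have fH: "finite (verts H)" using sH by (simp add: simple_graph_def)
  have "\<exists>i0<n. Inr i0 \<notin> \<phi> ` verts H"
  proof (rule ccontr)
    assume "\<not> ?thesis"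
    then have "Inr ` {..<n} \<subseteq> \<phi> ` verts H" by blast
    then have "card (Inr ` {..<n} :: (nat + nat) set) \<le> card (\<phi> ` verts H)"
      by (rule card_mono[rotated]) (use fH in simp)
    also have "\<dots> \<le> card (verts H)" by (rule card_image_le[OF fH])
    finally show False using n by (simp add: card_image)
  qed
  then obtain i0 where i0: "i0 < n" "Inr i0 \<notin> \<phi> ` verts H" by blast
  \<comment> \<open>A rotation of the cycle that moves the avoided vertex \<open>i0\<close> to the
    end, so that positions increase by one along every edge not at \<open>i0\<close> and their
    parity is a proper colouring.\<close>
  define pos where "pos i = (i + (n - 1 - i0)) mod n" for i
  have pos_last: "pos i \<noteq> n - 1" if "i < n" "i \<noteq> i0" for i
  proof (cases "i < i0")
    case True
    then have "i + (n - 1 - i0) < n - 1" using i0(1) by simp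
    then show ?thesis by (simp add: pos_def)
  next
    case False
    then have "i + (n - 1 - i0) = n + (i - i0 - 1)" "i - i0 - 1 < n - 1" using that i0(1) by auto
    then show ?thesis by (simp add: pos_def)
  qed
  have pos_step: "pos ((i + 1) mod n) = pos i + 1" if "i < n" "i \<noteq> i0" for i
  proof -
    have "pos ((i + 1) mod n) = Suc (i + (n - 1 - i0)) mod n"
      unfolding pos_def mod_add_left_eq by simp
    also have "\<dots> = Suc (pos i) mod n" by (simp add: pos_def mod_Suc_eq)
    also have "pos i < n - 1" using pos_last[OF that] i0(1) mod_less_divisor[of n "i + (n - 1 - i0)"]
      unfolding pos_def by linarith
    then have "Suc (pos i) mod n = pos i + 1" by simp
    finally show ?thesis .
  qed
  define col where "col = case_sum (\<lambda>j. j) (\<lambda>i. a + pos i mod 2)"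
  have cyc: "col (Inr i) \<noteq> col (Inr j)" if ij: "{i, j} \<in> cycle_edges n" and ne: "i \<noteq> i0" "j \<noteq> i0" for i j
  proof -
    obtain k where k: "k < n" "{i, j} = {k, (k + 1) mod n}" using ij unfolding cycle_edges_def by blast
    then have "k \<noteq> i0" using ne by (auto simp: doubleton_eq_iff)
    then have "pos ((k + 1) mod n) mod 2 \<noteq> pos k mod 2" using pos_step[OF k(1)] by (simp; presburger)
    then show ?thesis using k(2) by (auto simp: col_def doubleton_eq_iff)
  qed
  show ?thesis
    unfolding partite_def
  proof (intro exI[of _ "col \<circ> \<phi>"] conjI allI impI)
    show "(col \<circ> \<phi>) ` verts H \<subseteq> {..<a + 2}"
    proof
      fix y assume "y \<in> (col \<circ> \<phi>) ` verts H"
      then obtain v where v: "v \<in> verts H" "y = col (\<phi> v)" by auto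
      then have "\<phi> v \<in> verts (join (complete_graph a) (cycle_graph n))" using \<phi> by blast
      then show "y \<in> {..<a + 2}"
        unfolding v(2) by (cases "\<phi> v") (auto simp: col_def join_def complete_graph_def)
    qed
    fix u v assume uv: "{u, v} \<in> edges H"
    have mem: "u \<in> verts H" "v \<in> verts H" using edge_of_simple_graph[OF sH uv] by blast+
    then have ni: "\<phi> u \<noteq> Inr i0" "\<phi> v \<noteq> Inr i0" using i0(2) by (metis imageI)+
    have e: "{\<phi> u, \<phi> v} \<in> edges (join (complete_graph a) (cycle_graph n))" using \<phi> uv by blast
    show "(col \<circ> \<phi>) u \<noteq> (col \<circ> \<phi>) v"
    proof (cases "\<phi> u")
      case u: (Inl i)
      show ?thesis
      proof (cases "\<phi> v")
        case v: (Inl j)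
        show ?thesis using e unfolding u v by (simp add: edges_join_iff edges_complete_iff col_def u v)
      next
        case v: (Inr j)
        show ?thesis using e unfolding u v by (simp add: edges_join_iff complete_graph_def col_def u v)
      qed
    next
      case u: (Inr i)
      show ?thesis
      proof (cases "\<phi> v")
        case v: (Inl j)
        show ?thesis using e unfolding u v by (simp add: edges_join_iff complete_graph_def col_def u v)
      next
        case v: (Inr j)
        have "{i, j} \<in> cycle_edges n" using e unfolding u v by (simp add: edges_join_iff cycle_graph_def)
        then show ?thesis using cyc[of i j] ni by (simp add: u v)
      qed
    qed
  qed
qed

section \<open>Evaluation of the threshold as an infimum\<close>

lemma admissible_above:
  assumes "simple_graph H" "r \<ge> 3" "1 \<le> g" "g \<le> 11" and "chromatic_number H - 1 = r"
    and "\<And>i. 1 \<le> i \<Longrightarrow> i \<le> g \<Longrightarrow> homomorphic H (join (complete_graph (r - 3)) (F_graph i))"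
    and "1 - 1 / (real r - 1 + c_const g) < c"
  shows "c \<in> admissible H"
  unfolding admissible_def assms(5) mem_Collect_eq
proof (intro allI impI)
  fix \<eta> :: real assume "0 < \<eta>"
  from eventually_partite[OF assms(1-4,6,7) this]
  show "\<exists>n0. \<forall>G :: nat graph. simple_graph G \<and> n0 \<le> card (verts G) \<and> free_of H G \<and>
    c * real (card (verts G)) \<le> real (min_degree G) \<longrightarrow>
    (\<exists>D\<subseteq>edges G. real (card D) \<le> \<eta> * (real (card (verts G)))\<^sup>2 \<and> partite r (delete_edges G D))" .
qed

lemma Inf_le_if_above:
  fixes S :: "real set"
  assumes "bdd_below S" and "\<And>c. L < c \<Longrightarrow> c \<in> S"
  shows "Inf S \<le> L"
proof (rule dense_ge)
  fix c assume "L < c"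
  then show "Inf S \<le> c" using cInf_lower[OF assms(2) assms(1)] by blast
qed

theorem theorem1p4:
  fixes H :: "'a graph" and r :: nat
  assumes "r \<ge> 3"
    and "simple_graph H"
    and "chromatic_number H = r + 1"
  shows "(\<forall>g\<in>{1..11}.
            \<not> homomorphic H (join (complete_graph (r - 3)) (F_graph (g + 1))) \<and>
            (\<forall>i\<in>{1..g}. homomorphic H (join (complete_graph (r - 3)) (F_graph i)))
            \<longrightarrow> delta_threshold H = 1 - 1 / (real r - 1 + c_const g)) \<and>
         ((\<forall>i\<in>{1..12}. homomorphic H (join (complete_graph (r - 3)) (F_graph i)))
            \<longrightarrow> (\<exists>g\<ge>1.
                  \<not> homomorphic H (join (complete_graph (r - 2)) (cycle_graph (2 * g + 1))) \<and>
                  (\<forall>g'. 1 \<le> g' \<and> g' < g \<longrightarrow>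
                     homomorphic H (join (complete_graph (r - 2)) (cycle_graph (2 * g' + 1)))) \<and>
                  1 - 1 / (real r - 1) < 1 - 1 / (real r - 1 + 2 / (2 * real g - 1)) \<and>
                  1 - 1 / (real r - 1 + 2 / (2 * real g - 1)) \<le> delta_threshold H \<and>
                  delta_threshold H \<le> 1 - 1 / (real r - 1 + 1 / 7)))"
proof -
  note r = assms(1) and sH = assms(2)
  have chi: "chromatic_number H - 1 = r" using assms(3) by simp
  have np: "\<not> partite r H"
  proof
    assume "partite r H"
    then have "chromatic_number H \<le> r" unfolding chromatic_number_def by (rule Least_le)
    then show False using assms(3) by simp
  qed
  have part1: "delta_threshold H = 1 - 1 / (real r - 1 + c_const g)"
    if g: "1 \<le> g" "g \<le> 11" and nh: "\<not> homomorphic H (join (complete_graph (r - 3)) (F_graph (g + 1)))"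
      and hom: "\<And>i. 1 \<le> i \<Longrightarrow> i \<le> g \<Longrightarrow> homomorphic H (join (complete_graph (r - 3)) (F_graph i))" for g
  proof -
    let ?L = "1 - 1 / (real r - 1 + c_const g)"
    from F_graph_bounds[OF g] obtain w m N where w: "simple_graph (F_graph (g + 1))"
      "\<And>v. v \<in> verts (F_graph (g + 1)) \<Longrightarrow> missing_weight (F_graph (g + 1)) w v \<le> m"
      "N = (\<Sum>v\<in>verts (F_graph (g + 1)). w v)" "0 < N" "0 < m" "\<not> partite 3 (F_graph (g + 1))"
      "real N / real m = 2 + c_const g" by blast
    have rr: "r = (r - 3) + 3" "0 < r" using r by simp_all
    have eq: "real (r - 3) + real N / real m = real r - 1 + c_const g"
      unfolding w(7) using r by (simp add: of_nat_diff)
    have low: "?L \<le> c" if "c \<in> admissible H" for c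
      using admissible_lower_bound_join[OF w(1-6) rr nh chi sH that] unfolding eq .
    have up: "c \<in> admissible H" if "?L < c" for c
      by (rule admissible_above[OF sH r g chi hom that])
    \<comment> \<open>A member of the set is needed for the infimum to be bounded below by
      \<open>?L\<close>.\<close>
    have "?L + 1 \<in> admissible H" by (rule up) simp
    then have "?L \<le> Inf (admissible H)" by (intro cInf_greatest low) auto
    moreover have "bdd_below (admissible H)" using low by (rule bdd_belowI)
    then have "Inf (admissible H) \<le> ?L" using up by (rule Inf_le_if_above)
    ultimately show ?thesis unfolding delta_threshold_eq by simp
  qed
  let ?hom = "\<lambda>g. homomorphic H (join (complete_graph (r - 2)) (cycle_graph (2 * g + 1)))"
  have part2: "\<exists>g\<ge>1. \<not> ?hom g \<and> (\<forall>g'. 1 \<le> g' \<and> g' < g \<longrightarrow> ?hom g') \<and>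
      1 - 1 / (real r - 1) < 1 - 1 / (real r - 1 + 2 / (2 * real g - 1)) \<and>
      1 - 1 / (real r - 1 + 2 / (2 * real g - 1)) \<le> delta_threshold H \<and>
      delta_threshold H \<le> 1 - 1 / (real r - 1 + 1 / 7)"
    if hom: "\<And>i. 1 \<le> i \<Longrightarrow> i \<le> 12 \<Longrightarrow> homomorphic H (join (complete_graph (r - 3)) (F_graph i))"
  proof -
    have r2: "r = (r - 2) + 2" "0 < r" using r by simp_all
    let ?P = "\<lambda>g. 1 \<le> g \<and> \<not> ?hom g"
    \<comment> \<open>A cycle with more vertices than \<open>H\<close> cannot be covered by the
      image of \<open>H\<close>, so a homomorphism would give an \<open>r\<close>-colouring of
      \<open>H\<close>. This proves that the required \<open>g\<close> exists.\<close>
    have "?P (card (verts H) + 1)"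
    proof
      show "\<not> ?hom (card (verts H) + 1)"
      proof
        assume "?hom (card (verts H) + 1)"
        then have "partite ((r - 2) + 2) H" by (rule partite_if_homomorphic_long_cycle[OF sH]) simp
        then show False using np r2(1) by simp
      qed
    qed simp
    then have P: "?P (LEAST g. ?P g)" by (rule LeastI)
    define g where "g = (LEAST g. ?P g)"
    have g: "1 \<le> g" "\<not> ?hom g" using P unfolding g_def by blast+
    have least: "?hom g'" if "1 \<le> g'" "g' < g" for g'
      using not_less_Least[of g' ?P] that unfolding g_def by blast
    have n: "2 * g + 1 \<ge> 3" "odd (2 * g + 1)" using g(1) by simp_all
    have m: "0 < 2 * g + 1 - 2" using g(1) by simp
    let ?L = "1 - 1 / (real r - 1 + 2 / (2 * real g - 1))"
    have d: "2 * real g - 1 > 0" using g(1) by simp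
    \<comment> \<open>With unit weights the cycle has total weight \<open>2g + 1\<close>, and each
      vertex misses all but two. One more vertex in the complete part than in the first case leaves
      ratio \<open>1 + 2/(2g - 1)\<close> to the cycle.\<close>
    have "real (2 * g + 1) / real (2 * g + 1 - 2) = 1 + 2 / (2 * real g - 1)"
      using d g(1) by (simp add: of_nat_diff field_simps)
    then have eq: "real (r - 2) + real (2 * g + 1) / real (2 * g + 1 - 2) =
        real r - 1 + 2 / (2 * real g - 1)" using r by (simp add: of_nat_diff)
    have low: "?L \<le> c" if "c \<in> admissible H" for c
      using admissible_lower_bound_join[OF cycle_graph_bounds(1,3,4)[OF n] _ m
          cycle_graph_bounds(2)[OF n] r2 g(2) chi sH that] unfolding eq by simp
    have up: "c \<in> admissible H" if "1 - 1 / (real r - 1 + 1 / 7) < c" for c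
    proof (rule admissible_above[OF sH r _ _ chi, of 11])
      show "1 - 1 / (real r - 1 + c_const 11) < c" unfolding c_const_values(11) by (rule that)
    qed (use hom in simp_all)
    have "1 - 1 / (real r - 1 + 1 / 7) + 1 \<in> admissible H" by (rule up) simp
    then have "?L \<le> Inf (admissible H)" by (intro cInf_greatest low) auto
    moreover have "bdd_below (admissible H)" using low by (rule bdd_belowI)
    then have "Inf (admissible H) \<le> 1 - 1 / (real r - 1 + 1 / 7)" using up by (rule Inf_le_if_above)
    moreover have "1 - 1 / (real r - 1) < ?L"
    proof -
      have "0 < 2 / (2 * real g - 1)" using d by simp
      moreover have "0 < real r - 1" using r by simp
      ultimately have "1 / (real r - 1 + 2 / (2 * real g - 1)) < 1 / (real r - 1)"
        by (intro divide_strict_left_mono mult_pos_pos add_pos_pos) auto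
      then show ?thesis by simp
    qed
    ultimately show ?thesis unfolding delta_threshold_eq using g least by (intro exI[of _ g]) blast
  qed
  show ?thesis
  proof (intro conjI ballI impI)
    fix g assume "g \<in> {1..11}"
      and h: "\<not> homomorphic H (join (complete_graph (r - 3)) (F_graph (g + 1))) \<and>
        (\<forall>i\<in>{1..g}. homomorphic H (join (complete_graph (r - 3)) (F_graph i)))"
    then show "delta_threshold H = 1 - 1 / (real r - 1 + c_const g)" by (intro part1) auto
  next
    assume "\<forall>i\<in>{1..12}. homomorphic H (join (complete_graph (r - 3)) (F_graph i))"
    then show "\<exists>g\<ge>1.
                  \<not> homomorphic H (join (complete_graph (r - 2)) (cycle_graph (2 * g + 1))) \<and>
                  (\<forall>g'. 1 \<le> g' \<and> g' < g \<longrightarrow>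
                     homomorphic H (join (complete_graph (r - 2)) (cycle_graph (2 * g' + 1)))) \<and>
                  1 - 1 / (real r - 1) < 1 - 1 / (real r - 1 + 2 / (2 * real g - 1)) \<and>
                  1 - 1 / (real r - 1 + 2 / (2 * real g - 1)) \<le> delta_threshold H \<and>
                  delta_threshold H \<le> 1 - 1 / (real r - 1 + 1 / 7)"
      by (intro part2) auto
  qed
qed

end
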